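(* Let $F$ be the (complex-valued) diffeomorphism of the liquid region $\mathcal E$, $$F(t,x)=\tau(t)+i\arccos\Big(\frac{\mu(t,x)-b(1;t)}{2a(1;t)}\Big),$$ and let $\Omega$ be the complex slope defined in the context. Then on $\mathcal E$ $$\frac{\partial_{\bar z}F}{\partial_zF}=-\frac{1+(i-1)\Omega}{-1+(1+i)\Omega}\quad\text{for }q>1,\qquad \frac{\partial_{\bar z}F}{\partial_zF}=-\frac{1+(i-1)\overline\Omega}{-1+(1+i)\overline\Omega}\quad\text{for }0<q<1,$$ where $\partial_z=(\partial_t-i\partial_x)/2$ and $\partial_{\bar z}=(\partial_t+i\partial_x)/2$.
   Context: Parameters (of the $q$-Racah weighted lozenge tiling of a hexagon): $b,c>0$; $q>0$, $q\neq1$; and either $\kappa\in i\mathbb R\setminus\{0\}$, or $\kappa\in\mathbb R\setminus\{0\}$ with $|\kappa|$ not in the open interval with endpoints $q^{-1}$ and $q^{(b+c)/2}$. The rescaled hexagon is the set of $(t,x)$ with $0<t<b+c$, $\max\{0,t-b\}\le x\le1+\min\{t,c\}$. Put $\mu(t,x)=q^{-x}+\kappa^2q^{-t-c+x}$, $\tau(t)=\frac12\log\left|\frac{q^t-1}{1-q^{t-b-c}}\right|$, $a(\xi;t)=\sqrt{A(\xi;t)C(\xi;t)}$, $b(\xi;t)=1+\kappa^2q^{-t-c}-A(\xi;t)-C(\xi;t)$, $$A(\xi;t)=\frac{(1-q^{-c+\xi-1})(1-q^{\xi-t-1})(1-q^{-b-c+\xi-2})(1-\kappa^2q^{-b-c+\xi})}{(1-q^{-b-c+2\xi-2})^2},$$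 $$C(\xi;t)=\frac{(1-q^\xi)(1-q^{-b+\xi-1})(\kappa^2q^{1-c}-q^{-c+\xi-1})(q^{-t-1}-q^{-b-c+\xi-2})}{(1-q^{-b-c+2\xi-2})^2}.$$ The liquid region is $\mathcal E=\{(t,x):4a(1;t)^2-(\mu(t,x)-b(1;t))^2>0\}$ (inside the rescaled hexagon). Limiting height function: $h(t,x)=\int_{\max\{0,t-b\}}^x\rho(t,u)\,du$, where, with $\xi_-(x)\le\xi_+(x)$ the solutions $\xi\in[0,1+\min\{t,b,c,b+c-t\}]$ of $4a(\xi;t)^2-(\mu(t,x)-b(\xi;t))^2=0$ and $y(\xi)=q^{-\xi}+q^{\xi-b-c-2}$, $\rho(t,x)=1$ if $\xi_-<\xi_+\le1$; $\rho(t,x)=0$ if $1\le\xi_-<\xi_+$; and $\rho(t,x)=\frac1\pi\arccos\left(\frac{2y(1)-y(\xi_-)-y(\xi_+)}{|y(\xi_-)-y(\xi_+)|}\right)$ if $\xi_-<1<\xi_+$. Lozenge densities (times $\pi$): $\rho_I=-\pi\partial_th$, $\rho_{II}=\pi\partial_th+\pi\partial_xh$, $\rho_{III}=\pi-\pi\partial_xh$. The complex slope $\Omega=\Omega(t,x)$ is the point in the upper half plane such that the triangle with vertices $0,1,\Omega$ has angle $\rho_I$ at $0$, $\rho_{III}$ at $1$, $\rho_{II}$ at $\Omega$; explicitly $$\Omega=\frac{\tan\rho_{III}}{\tan\rho_{III}+\tan\rho_I}+i\frac{\tan\rho_{III}\tan\rho_I}{\tan\rho_{III}+\tan\rho_I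}.$$
   Formalization: For real κ with |κ| ≥ max(1/q, q^((b+c)/2)) the printed identities fail (F has opposite orientation); there Ω and its conjugate are interchanged. At t=b=c the ξ-equation is read with its denominator cleared. *)

theory Defs
  imports "HOL-Analysis.Analysis"
begin

text \<open>
  The parameter \<open>\<kappa>\<close> is a complex number that is either real or purely imaginary. It enters the
  formulas only through \<open>\<kappa>\<^sup>2\<close>, which is real in both cases, so we work with its real part.
\<close>

definition ksq :: "complex \<Rightarrow> real" where
  "ksq \<kappa> = Re (\<kappa>\<^sup>2)"

definition admissible :: "real \<Rightarrow> real \<Rightarrow> real \<Rightarrow> complex \<Rightarrow> bool" where
  "admissible b c q \<kappa> \<longleftrightarrow> 0 < b \<and> 0 < c \<and> 0 < q \<and> q \<noteq> 1 \<and> \<kappa> \<noteq> 0 \<and>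
     (Re \<kappa> = 0 \<or>
      Im \<kappa> = 0 \<and> cmod \<kappa> \<notin> {min (1/q) (q powr ((b+c)/2)) <..< max (1/q) (q powr ((b+c)/2))})"

text \<open>
  The admissible real \<open>\<kappa>\<close> split into those below and those above the excluded interval.
  For \<open>q > 1\<close> the function \<open>\<mu>(t,\<cdot>)\<close> defined below is decreasing on the hexagon, except above the
  interval, where it is increasing; for \<open>q < 1\<close> it is the other way round. This decides whether
  the map \<open>F\<close> preserves orientation, and hence whether \<open>\<Omega>\<close> or its conjugate occurs in the
  Beltrami equation. Above the interval the two are interchanged.
\<close>

definition upper_branch :: "real \<Rightarrow> real \<Rightarrow> real \<Rightarrow> complex \<Rightarrow> bool" where
  "upper_branch b c q \<kappa> \<longleftrightarrow> Im \<kappa> = 0 \<and> max (1/q) (q powr ((b+c)/2)) \<le> cmod \<kappa>"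

definition hexagon :: "real \<Rightarrow> real \<Rightarrow> (real \<times> real) set" where
  "hexagon b c = {(t, x). 0 < t \<and> t < b + c \<and> max 0 (t - b) \<le> x \<and> x \<le> 1 + min t c}"

definition mu :: "real \<Rightarrow> real \<Rightarrow> real \<Rightarrow> complex \<Rightarrow> real \<Rightarrow> real \<Rightarrow> real" where
  "mu b c q \<kappa> t x = q powr (-x) + ksq \<kappa> * q powr (-t-c+x)"

definition tau :: "real \<Rightarrow> real \<Rightarrow> real \<Rightarrow> real \<Rightarrow> real" where
  "tau b c q t = 1/2 * ln \<bar>(q powr t - 1) / (1 - q powr (t-b-c))\<bar>"

definition coefA :: "real \<Rightarrow> real \<Rightarrow> real \<Rightarrow> complex \<Rightarrow> real \<Rightarrow> real \<Rightarrow> real" where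
  "coefA b c q \<kappa> \<xi> t =
     (1 - q powr (-c+\<xi>-1)) * (1 - q powr (\<xi>-t-1)) * (1 - q powr (-b-c+\<xi>-2)) *
     (1 - ksq \<kappa> * q powr (-b-c+\<xi>)) / (1 - q powr (-b-c+2*\<xi>-2))\<^sup>2"

definition coefC :: "real \<Rightarrow> real \<Rightarrow> real \<Rightarrow> complex \<Rightarrow> real \<Rightarrow> real \<Rightarrow> real" where
  "coefC b c q \<kappa> \<xi> t =
     (1 - q powr \<xi>) * (1 - q powr (-b+\<xi>-1)) * (ksq \<kappa> * q powr (1-c) - q powr (-c+\<xi>-1)) *
     (q powr (-t-1) - q powr (-b-c+\<xi>-2)) / (1 - q powr (-b-c+2*\<xi>-2))\<^sup>2"

definition rec_a :: "real \<Rightarrow> real \<Rightarrow> real \<Rightarrow> complex \<Rightarrow> real \<Rightarrow> real \<Rightarrow> real" where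
  "rec_a b c q \<kappa> \<xi> t = sqrt (coefA b c q \<kappa> \<xi> t * coefC b c q \<kappa> \<xi> t)"

definition rec_b :: "real \<Rightarrow> real \<Rightarrow> real \<Rightarrow> complex \<Rightarrow> real \<Rightarrow> real \<Rightarrow> real" where
  "rec_b b c q \<kappa> \<xi> t =
     1 + ksq \<kappa> * q powr (-t-c) - coefA b c q \<kappa> \<xi> t - coefC b c q \<kappa> \<xi> t"

definition discr :: "real \<Rightarrow> real \<Rightarrow> real \<Rightarrow> complex \<Rightarrow> real \<Rightarrow> real \<Rightarrow> real \<Rightarrow> real" where
  "discr b c q \<kappa> \<xi> t x =
     4 * (rec_a b c q \<kappa> \<xi> t)\<^sup>2 - (mu b c q \<kappa> t x - rec_b b c q \<kappa> \<xi> t)\<^sup>2"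

definition liquid :: "real \<Rightarrow> real \<Rightarrow> real \<Rightarrow> complex \<Rightarrow> (real \<times> real) set" where
  "liquid b c q \<kappa> = {(t, x) \<in> hexagon b c. discr b c q \<kappa> 1 t x > 0}"

text \<open>
  The equation \<open>4a(\<xi>;t)\<^sup>2 - (\<mu>(t,x) - b(\<xi>;t))\<^sup>2 = 0\<close> is multiplied by the denominator
  \<open>(1 - q\<^bsup>-b-c+2\<xi>-2\<^esup>)\<^sup>2\<close>. This denominator vanishes only at \<open>\<xi> = 1 + (b+c)/2\<close>, which lies in
  the range \<open>[0, 1 + min{t,b,c,b+c-t}]\<close> only when \<open>t = b = c\<close>; so for all other \<open>t\<close> the solutions
  are literally those of the original equation. For \<open>t = b = c\<close> the point \<open>\<xi> = 1 + b\<close> is a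
  removable singularity of \<open>A\<close> and \<open>C\<close>, and it is the limit of the larger solution as
  \<open>t \<longlongrightarrow> b\<close>. Clearing the denominator retains this solution, which the convention
  \<open>u / 0 = 0\<close> would lose.
\<close>

definition xi_solutions :: "real \<Rightarrow> real \<Rightarrow> real \<Rightarrow> complex \<Rightarrow> real \<Rightarrow> real \<Rightarrow> real set" where
  "xi_solutions b c q \<kappa> t x =
     {\<xi>. 0 \<le> \<xi> \<and> \<xi> \<le> 1 + Min {t, b, c, b+c-t} \<and>
         (1 - q powr (-b-c+2*\<xi>-2))\<^sup>2 * discr b c q \<kappa> \<xi> t x = 0}"

definition xi_minus :: "real \<Rightarrow> real \<Rightarrow> real \<Rightarrow> complex \<Rightarrow> real \<Rightarrow> real \<Rightarrow> real" where
  "xi_minus b c q \<kappa> t x = Inf (xi_solutions b c q \<kappa> t x)"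

definition xi_plus :: "real \<Rightarrow> real \<Rightarrow> real \<Rightarrow> complex \<Rightarrow> real \<Rightarrow> real \<Rightarrow> real" where
  "xi_plus b c q \<kappa> t x = Sup (xi_solutions b c q \<kappa> t x)"

definition yfun :: "real \<Rightarrow> real \<Rightarrow> real \<Rightarrow> real \<Rightarrow> real" where
  "yfun b c q \<xi> = q powr (-\<xi>) + q powr (\<xi>-b-c-2)"

definition rho :: "real \<Rightarrow> real \<Rightarrow> real \<Rightarrow> complex \<Rightarrow> real \<Rightarrow> real \<Rightarrow> real" where
  "rho b c q \<kappa> t x =
     (let xm = xi_minus b c q \<kappa> t x; xp = xi_plus b c q \<kappa> t x; y = yfun b c q in
      if xm < xp \<and> xp \<le> 1 then 1
      else if 1 \<le> xm \<and> xm < xp then 0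
      else 1/pi * arccos ((2 * y 1 - y xm - y xp) / \<bar>y xm - y xp\<bar>))"

definition height :: "real \<Rightarrow> real \<Rightarrow> real \<Rightarrow> complex \<Rightarrow> real \<Rightarrow> real \<Rightarrow> real" where
  "height b c q \<kappa> t x = integral {max 0 (t - b)..x} (\<lambda>u. rho b c q \<kappa> t u)"

definition height_t :: "real \<Rightarrow> real \<Rightarrow> real \<Rightarrow> complex \<Rightarrow> real \<Rightarrow> real \<Rightarrow> real" where
  "height_t b c q \<kappa> t x = deriv (\<lambda>s. height b c q \<kappa> s x) t"

definition height_x :: "real \<Rightarrow> real \<Rightarrow> real \<Rightarrow> complex \<Rightarrow> real \<Rightarrow> real \<Rightarrow> real" where
  "height_x b c q \<kappa> t x = deriv (\<lambda>u. height b c q \<kappa> t u) x"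

definition rho_I :: "real \<Rightarrow> real \<Rightarrow> real \<Rightarrow> complex \<Rightarrow> real \<Rightarrow> real \<Rightarrow> real" where
  "rho_I b c q \<kappa> t x = - pi * height_t b c q \<kappa> t x"

definition rho_II :: "real \<Rightarrow> real \<Rightarrow> real \<Rightarrow> complex \<Rightarrow> real \<Rightarrow> real \<Rightarrow> real" where
  "rho_II b c q \<kappa> t x = pi * height_t b c q \<kappa> t x + pi * height_x b c q \<kappa> t x"

definition rho_III :: "real \<Rightarrow> real \<Rightarrow> real \<Rightarrow> complex \<Rightarrow> real \<Rightarrow> real \<Rightarrow> real" where
  "rho_III b c q \<kappa> t x = pi - pi * height_x b c q \<kappa> t x"

text \<open>The angle at \<open>v\<close> of the triangle with vertices \<open>u\<close>, \<open>v\<close>, \<open>w\<close>.\<close>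

definition vertex_angle :: "complex \<Rightarrow> complex \<Rightarrow> complex \<Rightarrow> real" where
  "vertex_angle u v w = arccos (((u - v) \<bullet> (w - v)) / (cmod (u - v) * cmod (w - v)))"

text \<open>
  The complex slope is defined by the angles of the triangle \<open>0, 1, \<Omega>\<close>. The formula for \<open>\<Omega>\<close> in
  terms of \<open>tan \<rho>\<^sub>I\<close> and \<open>tan \<rho>\<^sub>I\<^sub>I\<^sub>I\<close> has to be read as a limit if one of these angles
  is \<open>\<pi>/2\<close>.
\<close>

definition is_complex_slope ::
    "real \<Rightarrow> real \<Rightarrow> real \<Rightarrow> complex \<Rightarrow> real \<Rightarrow> real \<Rightarrow> complex \<Rightarrow> bool" where
  "is_complex_slope b c q \<kappa> t x w \<longleftrightarrow> Im w > 0 \<and>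
     vertex_angle 1 0 w = rho_I b c q \<kappa> t x \<and>
     vertex_angle 0 1 w = rho_III b c q \<kappa> t x \<and>
     vertex_angle 0 w 1 = rho_II b c q \<kappa> t x"

definition Omega :: "real \<Rightarrow> real \<Rightarrow> real \<Rightarrow> complex \<Rightarrow> real \<Rightarrow> real \<Rightarrow> complex" where
  "Omega b c q \<kappa> t x = (THE w. is_complex_slope b c q \<kappa> t x w)"

definition Fmap :: "real \<Rightarrow> real \<Rightarrow> real \<Rightarrow> complex \<Rightarrow> real \<Rightarrow> real \<Rightarrow> complex" where
  "Fmap b c q \<kappa> t x = complex_of_real (tau b c q t) + \<i> * complex_of_real
     (arccos ((mu b c q \<kappa> t x - rec_b b c q \<kappa> 1 t) / (2 * rec_a b c q \<kappa> 1 t)))"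

definition d_z :: "(real \<Rightarrow> real \<Rightarrow> complex) \<Rightarrow> real \<Rightarrow> real \<Rightarrow> complex" where
  "d_z f t x =
     (vector_derivative (\<lambda>s. f s x) (at t) - \<i> * vector_derivative (\<lambda>u. f t u) (at x)) / 2"

definition d_zbar :: "(real \<Rightarrow> real \<Rightarrow> complex) \<Rightarrow> real \<Rightarrow> real \<Rightarrow> complex" where
  "d_zbar f t x =
     (vector_derivative (\<lambda>s. f s x) (at t) + \<i> * vector_derivative (\<lambda>u. f t u) (at x)) / 2"

end

theory Submission
  imports Defs
begin

text \<open>
  Put \<open>\<theta> = arccos ((\<mu> - b) / (2a))\<close>, so that \<open>F = \<tau> + i \<theta>\<close>. The function \<open>cos \<theta>\<close> can be written as
  \<open>f(x) e\<^sup>\<tau> + g(x) e\<^bsup>-\<tau>\<^esup>\<close> and also as \<open>F(x-t) e\<^sup>\<tau> + G(x-t) e\<^bsup>-\<tau>\<^esup>\<close>. Hence \<open>exp F\<close> maps the three families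
  of lines \<open>t = const\<close>, \<open>x = const\<close>, \<open>x - t = const\<close> to three families of circles. The Beltrami equation is
  equivalent to \<open>\<Omega> = F\<^sub>x / (F\<^sub>x + F\<^sub>t)\<close>, that is, the angles of the triangle \<open>0, 1, \<Omega>\<close> have to be the
  angles between these circles.

  For the density \<open>\<rho>\<close> this is an algebraic identity: cleared of denominators, the equation for \<open>\<xi>\<close> is
  quadratic in \<open>y(\<xi>)\<close>, and its discriminant factors into the invariants of the two families of circles.
  For \<open>\<partial>\<^sub>t h\<close> one uses that, if \<open>\<phi>\<^sub>X\<close> and \<open>\<phi>\<^sub>U\<close> denote the directions of the lines \<open>x = const\<close> and
  \<open>x - t = const\<close> in the \<open>F\<close>-plane, each of them turns along its own line with the same speed
  \<open>- cot \<theta> \<partial>\<^sub>t \<tau>\<close>. So \<open>\<rho> dx + \<sigma> dt\<close> with \<open>\<pi> \<rho> = \<pi> + \<phi>\<^sub>X - \<phi>\<^sub>U\<close> and \<open>\<pi> \<sigma> = \<phi>\<^sub>U - \<pi>/2\<close> is closed in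
  the liquid region. It is locally constant in the frozen regions and continuous across the arctic curve, whence
  \<open>\<partial>\<^sub>t h = \<sigma>\<close>. If \<open>\<mu>\<close> increases in \<open>x\<close>, the same applies to \<open>\<pi> - \<theta>\<close>, which replaces \<open>F\<close> by its
  conjugate up to a constant.
\<close>

section \<open>Webs of circles\<close>

text \<open>In the coordinates \<open>X = r * cos \<theta>\<close>,
  \<open>Y = r * sin \<theta>\<close> with \<open>r = exp \<tau>\<close>, the relation
  \<open>cos \<theta> = f * r + g / r\<close> reads \<open>f * (X^2 + Y^2) - X + g = 0\<close>. This
  is a circle centred on the real axis with squared radius
  \<open>(1 - 4 * f * g) / (4 * f^2)\<close> (a line if \<open>f = 0\<close>), whence the
  invariants. Two such representations exist because \<open>\<mu> - b\<close> at
  \<open>\<xi> = 1\<close> is affine in \<open>q^(-t)\<close> both for fixed \<open>x\<close> and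
  for fixed \<open>x - t\<close>. The obstacle is the time derivative of the height: the integral
  starts at a moving edge and crosses the arctic curve, where \<open>psi\<close> has the vanishing
  denominator \<open>sqrt (1 - w^2)\<close>, so one cannot differentiate under the integral there.
  Instead, only continuity of the density and monotonicity of \<open>cos \<theta>\<close> in
  \<open>x\<close> are used near the curve. At the corner time \<open>t = b\<close>, and when the
  curve touches a lower edge, even this fails; these finitely many times are absorbed by the
  fundamental theorem of calculus.\<close>

definition clip :: "real \<Rightarrow> real" where
  "clip v = max (-1) (min 1 v)"

lemma clip_bounds: "-1 \<le> clip v" "clip v \<le> 1"
  by (auto simp: clip_def)

lemma clip_id: "\<bar>v\<bar> \<le> 1 \<Longrightarrow> clip v = v"
  by (auto simp: clip_def)

lemma clip_ge: "1 \<le> v \<Longrightarrow> clip v = 1"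
  by (auto simp: clip_def)

lemma clip_le: "v \<le> -1 \<Longrightarrow> clip v = -1"
  by (auto simp: clip_def)

lemma continuous_on_clip [continuous_intros]:
  "continuous_on S h \<Longrightarrow> continuous_on S (\<lambda>p. clip (h p))"
  unfolding clip_def by (intro continuous_intros)

lemma sgn_constant_on_interval:
  fixes h :: "real \<Rightarrow> real"
  assumes "continuous_on {a..y} h" "\<And>u. u \<in> {a..y} \<Longrightarrow> h u \<noteq> 0" "u \<in> {a..y}"
  shows "sgn (h u) = sgn (h a)"
proof (rule ccontr)
  assume ne: "sgn (h u) \<noteq> sgn (h a)"
  have au: "a \<le> u" "a \<in> {a..y}" using assms(3) by auto
  have c: "continuous_on {a..u} h"
    using assms(1) by (rule continuous_on_subset) (use assms(3) in auto)
  have "h a \<noteq> 0" "h u \<noteq> 0" using assms au by auto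
  then consider "h a < 0 \<and> 0 < h u" | "h u < 0 \<and> 0 < h a"
    using ne by (cases "h a" "0::real" rule: linorder_cases; cases "h u" "0::real" rule: linorder_cases) auto
  then obtain v where "a \<le> v" "v \<le> u" "h v = 0"
  proof cases
    case 1 then show ?thesis using IVT'[of h a 0 u] c au that by force
  next
    case 2 then show ?thesis using IVT2'[of h u 0 a] c au that by force
  qed
  then show False using assms(2)[of v] assms(3) by auto
qed

text \<open>Meant for the density on a slice: at the lower edge its value is an artefact of division
  by zero, so continuity holds only on the half-open interval.\<close>

lemma integrable_on_bounded_continuous_Ioc:
  fixes h :: "real \<Rightarrow> real"
  assumes "continuous_on {a<..y} h" "\<And>u. u \<in> {a<..y} \<Longrightarrow> \<bar>h u\<bar> \<le> B"
  shows "h integrable_on {a..y}"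
proof -
  have "h absolutely_integrable_on {a<..y}"
  proof (rule measurable_bounded_by_integrable_imp_absolutely_integrable)
    show "h \<in> borel_measurable (lebesgue_on {a<..y})"
      by (rule continuous_imp_measurable_on_sets_lebesgue) (use assms in auto)
    have "(\<lambda>_. B) integrable_on {a..y}" by (rule integrable_const_ivl)
    then show "(\<lambda>_. B) integrable_on {a<..y}"
      by (rule integrable_spike_set)
        (auto intro!: negligible_subset[OF negligible_sing[of a]])
  qed (use assms in auto)
  then have "h integrable_on {a<..y}" by (rule set_lebesgue_integral_eq_integral)
  then show ?thesis
    by (rule integrable_spike_set) (auto intro!: negligible_subset[OF negligible_sing[of a]])
qed

lemma DERIV_shift:
  fixes h :: "real \<Rightarrow> real"
  assumes "(h has_real_derivative d) (at (x - t))"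
  shows "((\<lambda>u. h (u - t)) has_real_derivative d) (at x)" (is ?g1)
    "((\<lambda>s. h (x - s)) has_real_derivative - d) (at t)" (is ?g2)
proof -
  have "((\<lambda>u. h (u - t)) has_real_derivative d * 1) (at x)"
    by (rule DERIV_chain2[of h d "\<lambda>u. u - t"]) (use assms in \<open>auto intro!: derivative_eq_intros\<close>)
  then show ?g1 by simp
  have "((\<lambda>s. h (x - s)) has_real_derivative d * - 1) (at t)"
    by (rule DERIV_chain2[of h d "\<lambda>s. x - s"]) (use assms in \<open>auto intro!: derivative_eq_intros\<close>)
  then show ?g2 by simp
qed

text \<open>
  The two representations of \<open>cos \<theta>\<close>, normalised to decrease in \<open>x\<close> (assumption \<open>F_less_f\<close>). The conditions
  \<open>fg\<close> and \<open>FG\<close> say that the invariants \<open>1 - 4fg\<close> and \<open>1 - 4FG\<close> of the circles are positive inside the hexagon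
  and vanish on its two lower edges.
\<close>

locale circle_web =
  fixes b c :: real and \<tau> \<tau>' f f' g g' F F' G G' :: "real \<Rightarrow> real"
  assumes b_pos: "0 < b" and c_pos: "0 < c"
    and DERIV_\<tau>: "\<And>t. 0 < t \<Longrightarrow> t < b + c \<Longrightarrow> (\<tau> has_real_derivative \<tau>' t) (at t)"
    and \<tau>'_pos: "\<And>t. 0 < t \<Longrightarrow> t < b + c \<Longrightarrow> 0 < \<tau>' t"
    and cont_\<tau>': "continuous_on {0<..<b+c} \<tau>'"
    and DERIV_f: "\<And>x. (f has_real_derivative f' x) (at x)"
    and DERIV_g: "\<And>x. (g has_real_derivative g' x) (at x)"
    and DERIV_F: "\<And>x. (F has_real_derivative F' x) (at x)"
    and DERIV_G: "\<And>x. (G has_real_derivative G' x) (at x)"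
    and cont_F': "continuous_on UNIV F'" and cont_G': "continuous_on UNIV G'"
    and web: "\<And>t x. 0 < t \<Longrightarrow> t < b + c \<Longrightarrow>
       f x * exp (\<tau> t) + g x * exp (- \<tau> t) = F (x - t) * exp (\<tau> t) + G (x - t) * exp (- \<tau> t)"
    and fg: "\<And>x. 0 < x \<Longrightarrow> x < 1 + c \<Longrightarrow> 4 * f x * g x < 1" "4 * f 0 * g 0 = 1"
    and FG: "\<And>v. - b < v \<Longrightarrow> v < 1 \<Longrightarrow> 4 * F v * G v < 1" "4 * F (- b) * G (- b) = 1"
    and F_less_f: "\<And>t x. 0 < t \<Longrightarrow> t < b + c \<Longrightarrow> max 0 (t - b) \<le> x \<Longrightarrow> x < 1 + min t c \<Longrightarrow>
       t \<noteq> b \<or> x \<noteq> 0 \<Longrightarrow> F (x - t) < f x"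
begin

text \<open>
  \<open>nuX\<close> and \<open>nuU\<close> are \<open>sin \<theta>\<close> times the slope \<open>d\<theta>/d\<tau>\<close> along \<open>x = const\<close> and \<open>x - t = const\<close>. Clipping
  extends the directions \<open>phX\<close> and \<open>phU\<close> by \<open>\<plusminus>\<pi>/2\<close> to the frozen regions. On the edges of the hexagon, where \<open>HX\<close> or
  \<open>HU\<close> vanishes, the convention \<open>u / 0 = 0\<close> gives meaningless values.
\<close>

definition w :: "real \<Rightarrow> real \<Rightarrow> real" where
  "w t x = f x * exp (\<tau> t) + g x * exp (- \<tau> t)"
definition nuX :: "real \<Rightarrow> real \<Rightarrow> real" where
  "nuX t x = g x * exp (- \<tau> t) - f x * exp (\<tau> t)"
definition nuU :: "real \<Rightarrow> real \<Rightarrow> real" where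
  "nuU t x = G (x - t) * exp (- \<tau> t) - F (x - t) * exp (\<tau> t)"
definition HX :: "real \<Rightarrow> real" where "HX x = 1 - 4 * f x * g x"
definition HU :: "real \<Rightarrow> real" where "HU v = 1 - 4 * F v * G v"
definition phX :: "real \<Rightarrow> real \<Rightarrow> real" where
  "phX t x = arcsin (clip (nuX t x / sqrt (HX x)))"
definition phU :: "real \<Rightarrow> real \<Rightarrow> real" where
  "phU t x = arcsin (clip (nuU t x / sqrt (HU (x - t))))"
definition dens :: "real \<Rightarrow> real \<Rightarrow> real" where
  "dens t x = 1 + (phX t x - phU t x) / pi"
definition flux :: "real \<Rightarrow> real \<Rightarrow> real" where
  "flux t x = phU t x / pi - 1 / 2"
definition hexint :: "(real \<times> real) set" where
  "hexint = {(t, x). 0 < t \<and> t < b + c \<and> max 0 (t - b) < x \<and> x < 1 + min t c}"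

lemma w_U: "0 < t \<Longrightarrow> t < b + c \<Longrightarrow> w t x = F (x - t) * exp (\<tau> t) + G (x - t) * exp (- \<tau> t)"
  by (simp add: w_def web)

lemma exp_\<tau>: "exp (\<tau> t) * exp (- \<tau> t) = 1"
  by (simp add: exp_minus)

text \<open>The squares of the sum and the difference of two numbers differ by four times their
  product. Read as \<open>nuX^2 + (sin \<theta>)^2 = HX\<close>, this makes
  \<open>nuX / sqrt HX\<close> and \<open>sin \<theta> / sqrt HX\<close> the sine and cosine of
  \<open>phX\<close> wherever \<open>w^2 < 1\<close>.\<close>

lemma nuX_sq: "(nuX t x)\<^sup>2 = HX x - 1 + (w t x)\<^sup>2"
  unfolding nuX_def HX_def w_def using exp_\<tau>[of t] by algebra

lemma nuU_sq: "0 < t \<Longrightarrow> t < b + c \<Longrightarrow> (nuU t x)\<^sup>2 = HU (x - t) - 1 + (w t x)\<^sup>2"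
  unfolding nuU_def HU_def w_U using exp_\<tau>[of t] by algebra

lemma HX_pos: "0 < x \<Longrightarrow> x < 1 + c \<Longrightarrow> 0 < HX x" using fg(1) by (simp add: HX_def)
lemma HX_0: "HX 0 = 0" using fg(2) by (simp add: HX_def)
lemma HU_pos: "- b < v \<Longrightarrow> v < 1 \<Longrightarrow> 0 < HU v" using FG(1) by (simp add: HU_def)
lemma HU_b: "HU (- b) = 0" using FG(2) by (simp add: HU_def)

text \<open>The web identity turns the difference of the two slopes into
  \<open>2 * (f - F) * exp \<tau>\<close>. This order yields both the bounds on the density and the
  monotonicity of \<open>w\<close> in \<open>x\<close>.\<close>

lemma nuX_less_nuU:
  assumes "0 < t" "t < b + c" "max 0 (t - b) \<le> x" "x < 1 + min t c" "t \<noteq> b \<or> x \<noteq> 0"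
  shows "nuX t x < nuU t x"
proof -
  have "nuU t x - nuX t x = 2 * (f x - F (x - t)) * exp (\<tau> t)"
    unfolding nuX_def nuU_def using web[OF assms(1,2), of x] by argo
  moreover have "0 < 2 * (f x - F (x - t)) * exp (\<tau> t)"
    using F_less_f[OF assms] by simp
  ultimately show ?thesis by linarith
qed

lemma hexintD:
  assumes "(t, x) \<in> hexint"
  shows "0 < t" "t < b + c" "max 0 (t - b) < x" "x < 1 + min t c" "0 < HX x" "0 < HU (x - t)"
    "nuX t x < nuU t x"
  using assms HX_pos[of x] HU_pos[of "x - t"] nuX_less_nuU[of t x] by (auto simp: hexint_def)

lemma open_hexint: "open hexint"
proof -
  have "hexint = {p. 0 < fst p} \<inter> {p. fst p < b + c} \<inter> {p. max 0 (fst p - b) < snd p}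
      \<inter> {p. snd p < 1 + min (fst p) c}"
    by (auto simp: hexint_def)
  moreover have "open \<dots>"
    by (intro open_Int open_Collect_less continuous_intros)
  ultimately show ?thesis by simp
qed

lemma cont_\<tau>: "continuous_on {0<..<b+c} \<tau>"
  by (rule DERIV_continuous_on) (auto intro: DERIV_\<tau> has_field_derivative_at_within)
lemma cont_f: "continuous_on S f"
  by (rule DERIV_continuous_on) (auto intro: DERIV_f has_field_derivative_at_within)
lemma cont_g: "continuous_on S g"
  by (rule DERIV_continuous_on) (auto intro: DERIV_g has_field_derivative_at_within)
lemma cont_F: "continuous_on S F"
  by (rule DERIV_continuous_on) (auto intro: DERIV_F has_field_derivative_at_within)
lemma cont_G: "continuous_on S G"
  by (rule DERIV_continuous_on) (auto intro: DERIV_G has_field_derivative_at_within)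

lemma continuous_on_web:
  assumes "continuous_on S \<theta>" "continuous_on S \<xi>" "\<And>p. p \<in> S \<Longrightarrow> 0 < \<theta> p \<and> \<theta> p < b + c"
  shows "continuous_on S (\<lambda>p. w (\<theta> p) (\<xi> p))" (is ?w)
    "continuous_on S (\<lambda>p. nuX (\<theta> p) (\<xi> p))" (is ?X)
    "continuous_on S (\<lambda>p. nuU (\<theta> p) (\<xi> p))" (is ?U)
    "continuous_on S (\<lambda>p. HX (\<xi> p))" (is ?HX)
    "continuous_on S (\<lambda>p. HU (\<xi> p - \<theta> p))" (is ?HU)
proof -
  have t: "continuous_on S (\<lambda>p. \<tau> (\<theta> p))"
    by (rule continuous_on_compose2[OF cont_\<tau> assms(1)]) (use assms(3) in auto)
  have fg: "continuous_on S (\<lambda>p. f (\<xi> p))" "continuous_on S (\<lambda>p. g (\<xi> p))"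
    "continuous_on S (\<lambda>p. F (\<xi> p - \<theta> p))" "continuous_on S (\<lambda>p. G (\<xi> p - \<theta> p))"
    by (auto intro!: continuous_on_compose2[OF cont_f[of UNIV]] continuous_on_compose2[OF cont_g[of UNIV]]
        continuous_on_compose2[OF cont_F[of UNIV]] continuous_on_compose2[OF cont_G[of UNIV]]
        continuous_intros assms)
  show ?w ?X ?U ?HX ?HU
    unfolding w_def nuX_def nuU_def HX_def HU_def by (intro continuous_intros t fg)+
qed

lemma continuous_on_angles:
  assumes "continuous_on S \<theta>" "continuous_on S \<xi>" "\<And>p. p \<in> S \<Longrightarrow> (\<theta> p, \<xi> p) \<in> hexint"
  shows "continuous_on S (\<lambda>p. phX (\<theta> p) (\<xi> p))" (is ?X)
    "continuous_on S (\<lambda>p. phU (\<theta> p) (\<xi> p))" (is ?U)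
    "continuous_on S (\<lambda>p. dens (\<theta> p) (\<xi> p))" (is ?g1)
    "continuous_on S (\<lambda>p. flux (\<theta> p) (\<xi> p))" (is ?g2)
proof -
  have d: "0 < \<theta> p \<and> \<theta> p < b + c" "0 < HX (\<xi> p)" "0 < HU (\<xi> p - \<theta> p)" if "p \<in> S" for p
    using hexintD[OF assms(3)[OF that]] by auto
  note c = continuous_on_web[of S \<theta> \<xi>, OF assms(1,2) d(1)]
  show X: ?X unfolding phX_def
    by (intro continuous_on_arcsin continuous_on_clip continuous_on_divide continuous_on_real_sqrt c)
      (use d(2) clip_bounds in \<open>auto simp: less_imp_neq[symmetric]\<close>)
  show U: ?U unfolding phU_def
    by (intro continuous_on_arcsin continuous_on_clip continuous_on_divide continuous_on_real_sqrt c)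
      (use d(3) clip_bounds in \<open>auto simp: less_imp_neq[symmetric]\<close>)
  show ?g1 ?g2 unfolding dens_def flux_def by (intro continuous_intros X U; simp)+
qed

text \<open>Stated for abstract numbers so as to serve both families. That \<open>n\<close> is
  nonzero matters as much as the value: it keeps the sign of the slope constant along a frozen
  segment.\<close>

lemma arcsin_clip_frozen:
  fixes n e v :: real
  assumes "n\<^sup>2 = e - 1 + v\<^sup>2" "0 < e" "1 \<le> v\<^sup>2"
  shows "n \<noteq> 0" "arcsin (clip (n / sqrt e)) = sgn n * (pi / 2)" (is ?g1)
proof -
  have "e \<le> n\<^sup>2" using assms by simp
  then have "sqrt e \<le> \<bar>n\<bar>" by (metis real_sqrt_abs real_sqrt_le_iff)
  moreover show "n \<noteq> 0" using assms by auto
  ultimately show ?g1 using assms(2) by (cases "n > 0") (auto simp: clip_ge clip_le field_simps)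
qed

text \<open>The tangent is \<open>n / sin \<theta>\<close>, the slope d\<theta>/d\<tau> along the
  line, so the arcsine is indeed the direction of the line in the \<open>F\<close>-plane.\<close>

lemma arcsin_clip_liquid:
  fixes n e v :: real
  assumes "n\<^sup>2 = e - 1 + v\<^sup>2" "0 < e" "v\<^sup>2 < 1"
  shows "\<bar>n / sqrt e\<bar> < 1" "arcsin (clip (n / sqrt e)) = arcsin (n / sqrt e)"
    "cos (arcsin (clip (n / sqrt e))) = sqrt (1 - v\<^sup>2) / sqrt e"
    "tan (arcsin (clip (n / sqrt e))) = n / sqrt (1 - v\<^sup>2)" (is ?g1)
    "\<bar>arcsin (clip (n / sqrt e))\<bar> < pi / 2" (is ?g2)
proof -
  have "n\<^sup>2 < e" using assms by simp
  then have "\<bar>n\<bar> < sqrt e" by (metis real_sqrt_abs real_sqrt_less_iff)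
  then show a: "\<bar>n / sqrt e\<bar> < 1" using assms(2) by (simp add: abs_divide)
  then show b: "arcsin (clip (n / sqrt e)) = arcsin (n / sqrt e)" by (simp add: clip_id)
  have bd: "-1 < n / sqrt e" "n / sqrt e < 1" using a by linarith+
  have "1 - (n / sqrt e)\<^sup>2 = (1 - v\<^sup>2) / e"
    using assms by (simp add: power_divide field_simps)
  then show c: "cos (arcsin (clip (n / sqrt e))) = sqrt (1 - v\<^sup>2) / sqrt e"
    unfolding b using bd by (subst cos_arcsin) (auto simp: real_sqrt_divide)
  show ?g1 unfolding tan_def c unfolding b using bd assms by (subst sin_arcsin) auto
  show ?g2 unfolding b using arcsin_lt_bounded[OF bd] by linarith
qed

lemmas phX_frozen = arcsin_clip_frozen[OF nuX_sq, folded phX_def]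
lemmas phX_liquid = arcsin_clip_liquid[OF nuX_sq, folded phX_def]
lemmas phU_frozen = arcsin_clip_frozen[OF nuU_sq, folded phU_def]
lemmas phU_liquid = arcsin_clip_liquid[OF nuU_sq, folded phU_def]

lemma phX_less_phU:
  assumes "(t, x) \<in> hexint" "(w t x)\<^sup>2 < 1"
  shows "phX t x < phU t x"
proof -
  note d = hexintD[OF assms(1)]
  note X = phX_liquid[OF d(5) assms(2)] and U = phU_liquid[OF d(1,2,6) assms(2)]
  have "tan (phX t x) < tan (phU t x)"
    unfolding X(4) U(4) using d(7) assms(2) by (simp add: divide_strict_right_mono)
  then show ?thesis using X(5) U(5) by (subst (asm) tan_mono_lt_eq) auto
qed

lemma dens_bounds:
  assumes "(t, x) \<in> hexint" shows "0 \<le> dens t x" "dens t x \<le> 1"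
proof -
  note d = hexintD[OF assms]
  have "phX t x \<le> phU t x \<and> phU t x - phX t x \<le> pi"
  proof (cases "(w t x)\<^sup>2 < 1")
    case True
    then show ?thesis
      using phX_less_phU[OF assms] phX_liquid(5)[OF d(5)] phU_liquid(5)[OF d(1,2,6)] by force
  next
    case False
    \<comment> \<open>Both directions are \<pi>/2 or -\<pi>/2 here, and \<open>nuX < nuU\<close>
      rules out the combination for which the density would be 2.\<close>
    then have w: "1 \<le> (w t x)\<^sup>2" by simp
    have "phX t x = (if 0 < nuX t x then pi / 2 else - (pi / 2))"
      using phX_frozen[OF d(5) w] by (cases "0 < nuX t x") (auto simp: sgn_if)
    moreover have "phU t x = (if 0 < nuU t x then pi / 2 else - (pi / 2))"
      using phU_frozen[OF d(1,2,6) w] by (cases "0 < nuU t x") (auto simp: sgn_if)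
    ultimately show ?thesis using d(7) by simp
  qed
  then show "0 \<le> dens t x" "dens t x \<le> 1" by (auto simp: dens_def field_simps)
qed

section \<open>Turning of the directions and closedness of the density form\<close>

lemma DERIV_w_t:
  assumes "0 < t" "t < b + c"
  shows "((\<lambda>s. w s x) has_real_derivative - \<tau>' t * nuX t x) (at t)"
  unfolding w_def nuX_def
  by (auto intro!: derivative_eq_intros DERIV_\<tau> assms simp: algebra_simps)

text \<open>Both representations of \<open>w\<close> are differentiated in \<open>t\<close> and
  compared: in the second one, the argument \<open>x - t\<close> contributes minus the
  \<open>x\<close>-derivative. This removes \<open>F'\<close> and \<open>G'\<close> from the
  result.\<close>

lemma DERIV_w_x:
  assumes t: "0 < t" "t < b + c"
  shows "((\<lambda>u. w t u) has_real_derivative \<tau>' t * (nuX t x - nuU t x)) (at x)"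
proof -
  let ?d = "F' (x - t) * exp (\<tau> t) + G' (x - t) * exp (- \<tau> t)"
  note F = DERIV_shift(2)[OF DERIV_F[of "x - t"]] and G = DERIV_shift(2)[OF DERIV_G[of "x - t"]]
  have "((\<lambda>s. F (x - s) * exp (\<tau> s) + G (x - s) * exp (- \<tau> s))
      has_real_derivative - ?d - \<tau>' t * nuU t x) (at t)"
    unfolding nuU_def
    by (auto intro!: derivative_eq_intros F G DERIV_\<tau> t simp: algebra_simps)
  then have "((\<lambda>s. w s x) has_real_derivative - ?d - \<tau>' t * nuU t x) (at t)"
    by (rule has_field_derivative_transform_within_open[of _ _ _ "{0<..<b+c}"])
      (use t in \<open>auto simp: w_U\<close>)
  from DERIV_unique[OF this DERIV_w_t[OF t]] have "?d = \<tau>' t * (nuX t x - nuU t x)"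
    by (simp add: algebra_simps)
  moreover have "((\<lambda>u. F (u - t) * exp (\<tau> t) + G (u - t) * exp (- \<tau> t)) has_real_derivative ?d) (at x)"
    by (auto intro!: derivative_eq_intros DERIV_chain'[OF _ DERIV_F] DERIV_chain'[OF _ DERIV_G])
  ultimately show ?thesis using w_U[OF t] by simp
qed

text \<open>The common value of \<open>\<pi> \<partial>\<^sub>t dens\<close> and \<open>\<pi> \<partial>\<^sub>x flux\<close>.\<close>

definition psi :: "real \<Rightarrow> real \<Rightarrow> real" where
  "psi t x = (let v = x - t in
     ((F v * (- 2 * (F' v * G v + F v * G' v)) / sqrt (HU v) - F' v * sqrt (HU v)) * exp (\<tau> t)
      - (G v * (- 2 * (F' v * G v + F v * G' v)) / sqrt (HU v) - G' v * sqrt (HU v)) * exp (- \<tau> t))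
     / HU v * sqrt (HU v) / sqrt (1 - (w t x)\<^sup>2))"

definition liq :: "(real \<times> real) set" where
  "liq = {(t, x) \<in> hexint. (w t x)\<^sup>2 < 1}"

lemma liqD: "(t, x) \<in> liq \<Longrightarrow> (t, x) \<in> hexint" "(t, x) \<in> liq \<Longrightarrow> (w t x)\<^sup>2 < 1"
  by (auto simp: liq_def)

lemma open_liq: "open liq"
proof -
  have c: "continuous_on hexint (\<lambda>p. (w (fst p) (snd p))\<^sup>2)"
    by (intro continuous_intros continuous_on_web) (auto simp: hexint_def)
  have "open (hexint \<inter> (\<lambda>p. (w (fst p) (snd p))\<^sup>2) -` {..<1})"
    using continuous_open_preimage[OF c open_hexint, of "{..<1}"] by simp
  also have "hexint \<inter> (\<lambda>p. (w (fst p) (snd p))\<^sup>2) -` {..<1} = liq"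
    by (auto simp: liq_def)
  finally show ?thesis .
qed

lemma open_slices:
  assumes "open S"
  shows "open {s. (s, x) \<in> S}" "open {u. (t, u) \<in> S}"
proof -
  have "open ((\<lambda>s. (s, x)) -` S)" "open ((\<lambda>u. (t, u)) -` S)"
    by (auto intro!: open_vimage[OF assms] continuous_on_Pair continuous_on_const continuous_on_id)
  then show "open {s. (s, x) \<in> S}" "open {u. (t, u) \<in> S}"
    by (simp_all add: vimage_def)
qed

lemma phX_liq: "(t, x) \<in> liq \<Longrightarrow> phX t x = arcsin (nuX t x / sqrt (HX x))"
  using phX_liquid(2)[OF hexintD(5)[OF liqD(1)] liqD(2)] .

lemma phU_liq: "(t, x) \<in> liq \<Longrightarrow> phU t x = arcsin (nuU t x / sqrt (HU (x - t)))"
  using phU_liquid(2)[OF hexintD(1,2,6)[OF liqD(1)] liqD(2)] .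

text \<open>Along \<open>x = const\<close> the invariant \<open>HX\<close> does not change and
  \<open>nuX\<close> has time derivative \<open>- \<tau>' * w\<close>; the factor
  \<open>sqrt HX\<close> cancels. With \<open>w = cos \<theta>\<close> this is the speed
  \<open>- \<tau>' * cot \<theta>\<close>.\<close>

lemma DERIV_phX:
  assumes "(t, x) \<in> liq"
  shows "((\<lambda>s. phX s x) has_real_derivative - \<tau>' t * w t x / sqrt (1 - (w t x)\<^sup>2)) (at t)"
proof -
  note l = liqD[OF assms]
  note d = hexintD[OF l(1)] and X = phX_liquid[OF hexintD(5)[OF l(1)] l(2)]
  have n: "((\<lambda>s. nuX s x / sqrt (HX x)) has_real_derivative - \<tau>' t * w t x / sqrt (HX x)) (at t)"
  proof (rule DERIV_cdivide)
    show "((\<lambda>s. nuX s x) has_real_derivative - \<tau>' t * w t x) (at t)"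
      unfolding nuX_def w_def
      using d by (auto intro!: derivative_eq_intros DERIV_\<tau> simp: algebra_simps)
  qed
  have bd: "-1 < nuX t x / sqrt (HX x)" "nuX t x / sqrt (HX x) < 1" using X(1) by linarith+
  have e: "sqrt (1 - (nuX t x / sqrt (HX x))\<^sup>2) = sqrt (1 - (w t x)\<^sup>2) / sqrt (HX x)"
    using X(2,3) bd by (simp add: cos_arcsin)
  have "((\<lambda>s. arcsin (nuX s x / sqrt (HX x))) has_real_derivative
      inverse (sqrt (1 - (nuX t x / sqrt (HX x))\<^sup>2)) * (- \<tau>' t * w t x / sqrt (HX x))) (at t)"
    by (rule DERIV_chain2[OF DERIV_arcsin[OF bd] n])
  moreover have "inverse (sqrt (1 - (nuX t x / sqrt (HX x))\<^sup>2)) * (- \<tau>' t * w t x / sqrt (HX x))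
      = - \<tau>' t * w t x / sqrt (1 - (w t x)\<^sup>2)"
    unfolding e using d(5) l(2) by (simp add: field_simps)
  ultimately have "((\<lambda>s. arcsin (nuX s x / sqrt (HX x))) has_real_derivative
     - \<tau>' t * w t x / sqrt (1 - (w t x)\<^sup>2)) (at t)" by simp
  then show ?thesis
    by (rule has_field_derivative_transform_within_open[OF _ open_slices(1)[OF open_liq], of _ _ _ x])
      (use assms in \<open>auto simp: phX_liq\<close>)
qed

text \<open>Along \<open>x - t = const\<close> the arguments of \<open>F\<close>, \<open>G\<close>
  and \<open>HU\<close> do not change. So \<open>psi\<close> enters the two partial derivatives with
  opposite signs, and their sum is the turning speed already found for \<open>phX\<close>.\<close>

lemma DERIV_phU:
  assumes "(t, x) \<in> liq"
  shows "((\<lambda>u. phU t u) has_real_derivative psi t x) (at x)" (is ?g1)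
    "((\<lambda>s. phU s x) has_real_derivative - psi t x - \<tau>' t * w t x / sqrt (1 - (w t x)\<^sup>2)) (at t)" (is ?g2)
proof -
  note l = liqD[OF assms]
  note d = hexintD[OF l(1)]
  note U = phU_liquid[OF d(1,2,6) l(2)]
  have bd: "-1 < nuU t x / sqrt (HU (x - t))" "nuU t x / sqrt (HU (x - t)) < 1" using U(1) by linarith+
  have e: "sqrt (1 - (nuU t x / sqrt (HU (x - t)))\<^sup>2) = sqrt (1 - (w t x)\<^sup>2) / sqrt (HU (x - t))"
    using U(2,3) bd by (simp add: cos_arcsin)
  let ?v = "x - t"
  define r where "r = (- 2 * (F' ?v * G ?v + F ?v * G' ?v)) / sqrt (HU ?v)"
  have sH: "((\<lambda>v. sqrt (HU v)) has_real_derivative r) (at ?v)"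
    unfolding HU_def r_def using d(6)
    by (auto intro!: derivative_eq_intros DERIV_F DERIV_G simp: HU_def field_simps)
  define p1 where "p1 = (F ?v * r - F' ?v * sqrt (HU ?v)) / HU ?v"
  define p2 where "p2 = (G' ?v * sqrt (HU ?v) - G ?v * r) / HU ?v"
  have sq: "sqrt (HU ?v) * sqrt (HU ?v) = HU ?v" using d(6) by simp
  have R1: "((\<lambda>v. - F v / sqrt (HU v)) has_real_derivative p1) (at ?v)"
    using DERIV_divide[OF DERIV_minus[OF DERIV_F] sH] d(6) sq unfolding p1_def
    by (simp add: algebra_simps)
  have R2: "((\<lambda>v. G v / sqrt (HU v)) has_real_derivative p2) (at ?v)"
    using DERIV_divide[OF DERIV_G sH] d(6) sq unfolding p2_def by simp
  have nu: "nuU s u / sqrt (HU (u - s)) = - F (u - s) / sqrt (HU (u - s)) * exp (\<tau> s)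
      + G (u - s) / sqrt (HU (u - s)) * exp (- \<tau> s)" for s u
    unfolding nuU_def by (simp add: field_simps diff_divide_distrib)
  have R1u: "((\<lambda>u. - F (u - t) / sqrt (HU (u - t))) has_real_derivative p1) (at x)"
    and R2u: "((\<lambda>u. G (u - t) / sqrt (HU (u - t))) has_real_derivative p2) (at x)"
    using DERIV_shift(1)[OF R1] DERIV_shift(1)[OF R2] .
  have R1t: "((\<lambda>s. - F (x - s) / sqrt (HU (x - s))) has_real_derivative - p1) (at t)"
    and R2t: "((\<lambda>s. G (x - s) / sqrt (HU (x - s))) has_real_derivative - p2) (at t)"
    using DERIV_shift(2)[OF R1] DERIV_shift(2)[OF R2] .
  define q where "q = p1 * exp (\<tau> t) + p2 * exp (- \<tau> t)"
  have Nu: "((\<lambda>u. nuU t u / sqrt (HU (u - t))) has_real_derivative q) (at x)"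
    unfolding nu q_def by (intro DERIV_add DERIV_cmult_right R1u R2u)
  have Nt: "((\<lambda>s. nuU s x / sqrt (HU (x - s))) has_real_derivative
      - q - \<tau>' t * w t x / sqrt (HU ?v)) (at t)"
  proof -
    have E: "((\<lambda>s. exp (\<tau> s)) has_real_derivative exp (\<tau> t) * \<tau>' t) (at t)"
      "((\<lambda>s. exp (- \<tau> s)) has_real_derivative - (exp (- \<tau> t) * \<tau>' t)) (at t)"
      by (auto intro!: derivative_eq_intros DERIV_\<tau> d)
    show ?thesis
      unfolding nu by (rule DERIV_cong[OF DERIV_add[OF DERIV_mult[OF R1t E(1)] DERIV_mult[OF R2t E(2)]]])
        (simp add: q_def w_U[OF d(1,2)] algebra_simps add_divide_distrib)
  qed
  have psi: "psi t x = inverse (sqrt (1 - (nuU t x / sqrt (HU ?v))\<^sup>2)) * q"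
  proof -
    define n1 n2 where "n1 = F ?v * r - F' ?v * sqrt (HU ?v)" and "n2 = G ?v * r - G' ?v * sqrt (HU ?v)"
    have "psi t x = (n1 * exp (\<tau> t) - n2 * exp (- \<tau> t)) / HU ?v * sqrt (HU ?v) / sqrt (1 - (w t x)\<^sup>2)"
      by (simp add: psi_def Let_def n1_def n2_def r_def)
    moreover have "q = (n1 * exp (\<tau> t) - n2 * exp (- \<tau> t)) / HU ?v"
      by (simp add: q_def p1_def p2_def n1_def[symmetric] n2_def[symmetric] diff_divide_distrib)
        (simp add: n2_def diff_divide_distrib algebra_simps)
    ultimately show ?thesis unfolding e by (simp add: mult.commute)
  qed
  have "((\<lambda>u. arcsin (nuU t u / sqrt (HU (u - t)))) has_real_derivative psi t x) (at x)"
    unfolding psi by (rule DERIV_chain2[OF DERIV_arcsin[OF bd] Nu])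
  then show ?g1 by (rule has_field_derivative_transform_within_open[OF _ open_slices(2)[OF open_liq], of _ _ _ t])
      (use assms in \<open>auto simp: phU_liq\<close>)
  have "((\<lambda>s. arcsin (nuU s x / sqrt (HU (x - s)))) has_real_derivative
      inverse (sqrt (1 - (nuU t x / sqrt (HU ?v))\<^sup>2)) * (- q - \<tau>' t * w t x / sqrt (HU ?v))) (at t)"
    by (rule DERIV_chain2[OF DERIV_arcsin[OF bd] Nt])
  moreover have "inverse (sqrt (1 - (nuU t x / sqrt (HU ?v))\<^sup>2)) * (- q - \<tau>' t * w t x / sqrt (HU ?v))
      = - psi t x - \<tau>' t * w t x / sqrt (1 - (w t x)\<^sup>2)"
    unfolding psi unfolding e using d(6) l(2) by (simp add: field_simps)
  ultimately have "((\<lambda>s. arcsin (nuU s x / sqrt (HU (x - s)))) has_real_derivative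
     - psi t x - \<tau>' t * w t x / sqrt (1 - (w t x)\<^sup>2)) (at t)" by simp
  then show ?g2 by (rule has_field_derivative_transform_within_open[OF _ open_slices(1)[OF open_liq], of _ _ _ x])
      (use assms in \<open>auto simp: phU_liq\<close>)
qed

text \<open>The equal turning speeds of \<open>phX\<close> and \<open>phU\<close> cancel in
  \<open>dens\<close>, and only \<open>psi\<close> remains: the form
  \<open>dens dx + flux dt\<close> is closed.\<close>

lemma DERIV_dens_flux:
  assumes "(t, x) \<in> liq"
  shows "((\<lambda>s. dens s x) has_real_derivative psi t x / pi) (at t)" (is ?g1)
    "((\<lambda>u. flux t u) has_real_derivative psi t x / pi) (at x)" (is ?g2)
proof -
  show ?g1 unfolding dens_def
    by (auto intro!: derivative_eq_intros DERIV_phX[OF assms] DERIV_phU(2)[OF assms])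
  show ?g2 unfolding flux_def by (auto intro!: derivative_eq_intros DERIV_phU(1)[OF assms])
qed

lemma continuous_on_psi:
  assumes "continuous_on S \<theta>" "continuous_on S \<xi>" "\<And>p. p \<in> S \<Longrightarrow> (\<theta> p, \<xi> p) \<in> liq"
  shows "continuous_on S (\<lambda>p. psi (\<theta> p) (\<xi> p))"
proof -
  have d: "0 < \<theta> p \<and> \<theta> p < b + c" "0 < HU (\<xi> p - \<theta> p)" "(w (\<theta> p) (\<xi> p))\<^sup>2 < 1" if "p \<in> S" for p
    using hexintD[OF liqD(1)[OF assms(3)[OF that]]] liqD(2)[OF assms(3)[OF that]] by auto
  note c = continuous_on_web[of S \<theta> \<xi>, OF assms(1,2) d(1)]
  have e: "continuous_on S (\<lambda>p. \<tau> (\<theta> p))"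
    by (rule continuous_on_compose2[OF cont_\<tau> assms(1)]) (use d(1) in auto)
  have F: "continuous_on S (\<lambda>p. F (\<xi> p - \<theta> p))" "continuous_on S (\<lambda>p. G (\<xi> p - \<theta> p))"
    "continuous_on S (\<lambda>p. F' (\<xi> p - \<theta> p))" "continuous_on S (\<lambda>p. G' (\<xi> p - \<theta> p))"
    by (auto intro!: continuous_on_compose2[OF cont_F[of UNIV]] continuous_on_compose2[OF cont_G[of UNIV]]
        continuous_on_compose2[OF cont_F'] continuous_on_compose2[OF cont_G'] continuous_intros assms)
  show ?thesis unfolding psi_def Let_def
    by (intro continuous_intros e F c) (use d in \<open>force+\<close>)
qed

lemma DERIV_integral_dens_liquid:
  assumes "\<And>s u. s \<in> {t1..t2} \<Longrightarrow> u \<in> {u1..u2} \<Longrightarrow> (s, u) \<in> liq"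
    and "u1 \<le> u2" and t: "t \<in> {t1..t2}"
  shows "((\<lambda>s. integral {u1..u2} (dens s)) has_real_derivative flux t u2 - flux t u1) (at t within {t1..t2})"
proof -
  have "((\<lambda>s. integral (cbox u1 u2) (dens s)) has_real_derivative
      integral (cbox u1 u2) (\<lambda>u. psi t u / pi)) (at t within {t1..t2})"
  proof (rule leibniz_rule_field_derivative[where fx = "\<lambda>s u. psi s u / pi"])
    show "((\<lambda>s. dens s u) has_real_derivative psi s u / pi) (at s within {t1..t2})"
      if "s \<in> {t1..t2}" "u \<in> cbox u1 u2" for s u
      using DERIV_dens_flux(1)[of s u] assms(1)[of s u] that by (auto intro: has_field_derivative_at_within)
    show "dens s integrable_on cbox u1 u2" if "s \<in> {t1..t2}" for s
      by (rule integrable_continuous, rule continuous_on_angles(3)[of _ "\<lambda>_. s" "\<lambda>u. u"])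
        (use assms(1) that liqD in \<open>auto intro: continuous_intros\<close>)
    show "continuous_on ({t1..t2} \<times> cbox u1 u2) (\<lambda>(s, u). psi s u / pi)"
      unfolding split_beta
      by (intro continuous_on_divide continuous_on_psi continuous_intros) (use assms(1) in auto)
  qed (use t in auto)
  moreover have "((\<lambda>u. psi t u / pi) has_integral (flux t u2 - flux t u1)) {u1..u2}"
  proof (rule fundamental_theorem_of_calculus[OF assms(2)])
    show "(flux t has_vector_derivative psi t u / pi) (at u within {u1..u2})" if "u \<in> {u1..u2}" for u
      using DERIV_dens_flux(2)[OF assms(1)[OF t that]]
      by (auto simp: has_real_derivative_iff_has_vector_derivative[symmetric] intro: has_field_derivative_at_within)
  qed
  ultimately show ?thesis by (simp only: integral_unique cbox_interval)
qed

section \<open>The time derivative of the height\<close>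

abbreviation bot :: "real \<Rightarrow> real" where "bot t \<equiv> max 0 (t - b)"

lemma w_strict_decreasing:
  assumes "0 < t" "t < b + c" "bot t \<le> u1" "u1 < u2" "u2 < 1 + min t c"
  shows "w t u2 < w t u1"
proof (rule DERIV_neg_imp_decreasing_open[OF assms(4)])
  \<comment> \<open>Only interior points are differentiated, so the corner \<open>t = b\<close>,
    \<open>x = 0\<close> can occur only as the end point \<open>u1\<close>.\<close>
  fix u assume u: "u1 < u" "u < u2"
  have "nuX t u < nuU t u" by (rule nuX_less_nuU) (use assms u in auto)
  then have "\<tau>' t * (nuX t u - nuU t u) < 0"
    using \<tau>'_pos[OF assms(1,2)] by (simp add: mult_pos_neg)
  then show "\<exists>y. (w t has_real_derivative y) (at u) \<and> y < 0"
    using DERIV_w_x[OF assms(1,2), of u] by blast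
next
  show "continuous_on {u1..u2} (w t)"
    by (rule continuous_on_web(1)[of _ "\<lambda>_. t" "\<lambda>u. u"]) (use assms in \<open>auto intro: continuous_intros\<close>)
qed

lemma w_decreasing:
  assumes "0 < t" "t < b + c" "bot t \<le> u1" "u1 \<le> u2" "u2 < 1 + min t c"
  shows "w t u2 \<le> w t u1"
  using w_strict_decreasing[OF assms(1-3) _ assms(5)] assms(4) by fastforce

lemma integrable_dens:
  assumes "0 < t" "t < b + c" "bot t \<le> u1" "u2 < 1 + min t c"
  shows "dens t integrable_on {u1..u2}"
proof (rule integrable_on_bounded_continuous_Ioc[where B = 1])
  have m: "(t, u) \<in> hexint" if "u \<in> {u1<..u2}" for u
    using that assms by (auto simp: hexint_def)
  show "continuous_on {u1<..u2} (dens t)"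
    by (rule continuous_on_angles(3)[of _ "\<lambda>_. t" "\<lambda>u. u"]) (use m in \<open>auto intro: continuous_intros\<close>)
  show "\<bar>dens t u\<bar> \<le> 1" if "u \<in> {u1<..u2}" for u
    using dens_bounds[OF m[OF that]] by simp
qed

text \<open>Neither slope vanishes on a frozen segment reaching down to \<open>x = 0\<close>, so the
  signs can be read off at the edge. There \<open>HX 0 = 0\<close> makes \<open>nuX\<close> the
  smaller one in absolute value, and together with \<open>nuX < nuU\<close> this forces
  \<open>nuU\<close> to be positive. Consequently \<open>flux\<close> is zero and
  \<open>dens\<close> is 0 or 1.\<close>

lemma frozen_below_left:
  assumes "0 < t" "t < b" "0 < y" "y < 1 + min t c" "1 \<le> w t y" "0 < u" "u \<le> y"
  shows "phX t u = sgn (nuX t 0) * (pi / 2)" (is ?g1) "phU t u = pi / 2"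
proof -
  have t: "0 < t" "t < b + c" using assms(1,2) c_pos by linarith+
  have y: "y < 1 + c" "y < 1 + t" using assms(4) by linarith+
  have w1: "1 \<le> (w t v)\<^sup>2" and HX: "0 < v \<Longrightarrow> 0 < HX v" and HU: "0 < HU (v - t)"
    if v: "v \<in> {0..y}" for v
  proof -
    have "w t y \<le> w t v" by (rule w_decreasing[OF t]) (use v assms(2,4) in simp_all)
    then have "1 \<le> w t v" using assms(5) by linarith
    then show "1 \<le> (w t v)\<^sup>2" by (rule one_le_power)
    show "0 < v \<Longrightarrow> 0 < HX v" by (rule HX_pos) (use v y in simp_all)
    have "v \<le> y" "0 \<le> v" using v by simp_all
    then show "0 < HU (v - t)" by (intro HU_pos) (use assms(2) y in linarith)+
  qed
  have "w t y < w t 0" by (rule w_strict_decreasing[OF t]) (use assms(2-4) in simp_all)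
  then have "1 < w t 0" using assms(5) by linarith
  then have w0: "1 < (w t 0)\<^sup>2" by (simp add: one_less_power)
  have X0: "nuX t v \<noteq> 0" if "v \<in> {0..y}" for v
  proof (cases "v = 0")
    case True
    \<comment> \<open>Since \<open>HX\<close> vanishes at the edge, \<open>phX_frozen\<close> does
      not apply; the strict inequality \<open>1 < w t 0\<close> takes its place.\<close>
    have "(nuX t 0)\<^sup>2 \<noteq> 0" unfolding nuX_sq HX_0 using w0 by simp
    then show ?thesis using True by simp
  next
    case False
    then show ?thesis using phX_frozen(1)[OF HX[OF that] w1[OF that]] that by simp
  qed
  have U0: "nuU t v \<noteq> 0" if "v \<in> {0..y}" for v
    by (rule phU_frozen(1)[OF t HU[OF that] w1[OF that]])
  have cX: "continuous_on {0..y} (nuX t)" and cU: "continuous_on {0..y} (nuU t)"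
    by (rule continuous_on_web(2,3)[of _ "\<lambda>_. t" "\<lambda>u. u"], use t in \<open>auto intro: continuous_intros\<close>)+
  have u: "u \<in> {0..y}" using assms(6,7) by simp
  have z: "0 \<in> {0..y}" using assms(3) by simp
  have "(nuX t 0)\<^sup>2 < (nuU t 0)\<^sup>2"
    unfolding nuX_sq nuU_sq[OF t] HX_0 using HU[OF z] by simp
  moreover have "nuX t 0 < nuU t 0" by (rule nuX_less_nuU) (use assms(1-4) t in simp_all)
  ultimately have "0 < nuU t 0"
    using abs_le_square_iff[of "nuU t 0" "nuX t 0"] by linarith
  then show "phU t u = pi / 2"
    using phU_frozen(2)[OF t HU[OF u] w1[OF u]] sgn_constant_on_interval[OF cU U0 u] by simp
  show ?g1 using phX_frozen(2)[OF HX[OF u] w1[OF u]] sgn_constant_on_interval[OF cX X0 u] assms(6) by simp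
qed

text \<open>The mirror image: on the edge \<open>x = t - b\<close> it is \<open>HU\<close> that
  vanishes, so \<open>nuX\<close> must be negative. Then \<open>flux = - dens\<close>, which
  accounts for the lower edge moving with speed one.\<close>

lemma frozen_below_right:
  assumes "b < t" "t < b + c" "t - b < y" "y < 1 + min t c" "1 \<le> w t y" "t - b < u" "u \<le> y"
  shows "phX t u = - (pi / 2)" "phU t u = sgn (nuU t (t - b)) * (pi / 2)" (is ?g1)
proof -
  have t: "0 < t" "t < b + c" using assms(1,2) b_pos by linarith+
  have y: "y < 1 + c" "y < 1 + t" using assms(4) by linarith+
  have w1: "1 \<le> (w t v)\<^sup>2" and HX: "0 < HX v" and HU: "t - b < v \<Longrightarrow> 0 < HU (v - t)"
    if v: "v \<in> {t-b..y}" for v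
  proof -
    have "w t y \<le> w t v" by (rule w_decreasing[OF t]) (use v assms(1,4) in simp_all)
    then have "1 \<le> w t v" using assms(5) by linarith
    then show "1 \<le> (w t v)\<^sup>2" by (rule one_le_power)
    have v': "v \<le> y" "t - b \<le> v" using v by simp_all
    then show "0 < HX v" by (intro HX_pos) (use assms(1) y in linarith)+
    show "t - b < v \<Longrightarrow> 0 < HU (v - t)" by (intro HU_pos) (use v' y in linarith)+
  qed
  have "w t y < w t (t - b)" by (rule w_strict_decreasing[OF t]) (use assms(1,3,4) in simp_all)
  then have "1 < w t (t - b)" using assms(5) by linarith
  then have w0: "1 < (w t (t - b))\<^sup>2" by (simp add: one_less_power)
  have X0: "nuX t v \<noteq> 0" if "v \<in> {t-b..y}" for v
    by (rule phX_frozen(1)[OF HX[OF that] w1[OF that]])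
  have U0: "nuU t v \<noteq> 0" if "v \<in> {t-b..y}" for v
  proof (cases "v = t - b")
    case True
    have "(nuU t (t - b))\<^sup>2 \<noteq> 0" unfolding nuU_sq[OF t] using HU_b w0 by simp
    then show ?thesis using True by simp
  next
    case False
    then show ?thesis using phU_frozen(1)[OF t HU[OF that] w1[OF that]] that by simp
  qed
  have cX: "continuous_on {t-b..y} (nuX t)" and cU: "continuous_on {t-b..y} (nuU t)"
    by (rule continuous_on_web(2,3)[of _ "\<lambda>_. t" "\<lambda>u. u"], use t in \<open>auto intro: continuous_intros\<close>)+
  have u: "u \<in> {t-b..y}" using assms(6,7) by simp
  have z: "t - b \<in> {t-b..y}" using assms(3) by simp
  have "(nuU t (t - b))\<^sup>2 < (nuX t (t - b))\<^sup>2"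
    unfolding nuX_sq nuU_sq[OF t] using HX[OF z] HU_b by simp
  moreover have "nuX t (t - b) < nuU t (t - b)"
    by (rule nuX_less_nuU) (use assms(1,2,3,4) t in simp_all)
  ultimately have "nuX t (t - b) < 0"
    using abs_le_square_iff[of "nuX t (t - b)" "nuU t (t - b)"] by linarith
  then show "phX t u = - (pi / 2)"
    using phX_frozen(2)[OF HX[OF u] w1[OF u]] sgn_constant_on_interval[OF cX X0 u] by simp
  show ?g1 using phU_frozen(2)[OF t HU[OF u] w1[OF u]] sgn_constant_on_interval[OF cU U0 u] assms(6) by simp
qed

lemma DERIV_w_line:
  assumes t: "0 < t" "t < b + c"
  shows "((\<lambda>a. w (t + a) (x + l * a)) has_real_derivative
    - \<tau>' t * nuX t x + l * (\<tau>' t * (nuX t x - nuU t x))) (at 0)"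
proof -
  have "(w t has_real_derivative f' x * exp (\<tau> t) + g' x * exp (- \<tau> t)) (at x)"
    unfolding w_def[abs_def] by (auto intro!: derivative_eq_intros DERIV_f DERIV_g)
  from DERIV_unique[OF this DERIV_w_x[OF t]]
  have e: "\<tau>' t * (nuX t x - nuU t x) = f' x * exp (\<tau> t) + g' x * exp (- \<tau> t)" by simp
  have f: "((\<lambda>a. f (x + l * a)) has_real_derivative f' x * l) (at 0)"
    and g: "((\<lambda>a. g (x + l * a)) has_real_derivative g' x * l) (at 0)"
    by (rule DERIV_chain2[of f "f' x"], use DERIV_f[of x] in \<open>auto intro!: derivative_eq_intros\<close>)
      (rule DERIV_chain2[of g "g' x"], use DERIV_g[of x] in \<open>auto intro!: derivative_eq_intros\<close>)
  have T: "((\<lambda>a. \<tau> (t + a)) has_real_derivative \<tau>' t * 1) (at 0)"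
    by (rule DERIV_chain2[of \<tau> "\<tau>' t"], use DERIV_\<tau>[OF t] in \<open>auto intro!: derivative_eq_intros\<close>)
  have E1: "((\<lambda>a. exp (\<tau> (t + a))) has_real_derivative exp (\<tau> t) * \<tau>' t) (at 0)"
    by (rule DERIV_cong[OF DERIV_fun_exp[OF T]]) simp
  have E2: "((\<lambda>a. exp (- \<tau> (t + a))) has_real_derivative - (exp (- \<tau> t) * \<tau>' t)) (at 0)"
    by (rule DERIV_cong[OF DERIV_fun_exp[OF DERIV_minus[OF T]]]) simp
  show ?thesis unfolding w_def e unfolding nuX_def
    by (rule DERIV_cong[OF DERIV_add[OF DERIV_mult[OF f E1] DERIV_mult[OF g E2]]])
      (simp add: algebra_simps)
qed

text \<open>The arctic curve stays within a cone around each of its points, since \<open>w\<close> is strictly decreasing in \<open>x\<close>.\<close>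

lemma interface_cone:
  assumes "(t0, xm) \<in> hexint" "w t0 xm = 1"
  obtains L d where "0 < L" "0 < d"
    "\<And>t. t \<noteq> t0 \<Longrightarrow> \<bar>t - t0\<bar> < d \<Longrightarrow> w t (xm + L * \<bar>t - t0\<bar>) < 1 \<and> 1 < w t (xm - L * \<bar>t - t0\<bar>)"
proof -
  note h = hexintD[OF assms(1)]
  define A B where "A = - \<tau>' t0 * nuX t0 xm" and "B = \<tau>' t0 * (nuX t0 xm - nuU t0 xm)"
  have B: "B < 0" unfolding B_def using \<tau>'_pos[OF h(1,2)] h(7) by (simp add: mult_pos_neg)
  \<comment> \<open>\<open>A\<close> and \<open>B\<close> are the partial derivatives of
    \<open>w\<close> in \<open>t\<close> and \<open>x\<close>. The slope is steep enough for the
    \<open>x\<close>-derivative to dominate: \<open>A + L * B\<close> is at most -1 and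
    \<open>A - L * B\<close> at least 1.\<close>
  define L where "L = (\<bar>A\<bar> + 1) / - B"
  have L: "0 < L" unfolding L_def using B by (intro divide_pos_pos) auto
  have LB: "L * B = - (\<bar>A\<bar> + 1)" unfolding L_def using B by (simp add: field_simps)
  have p: "((\<lambda>a. w (t0 + a) (xm + L * a)) has_real_derivative A + L * B) (at 0)"
    and m: "((\<lambda>a. w (t0 + a) (xm + (- L) * a)) has_real_derivative A + (- L) * B) (at 0)"
    unfolding A_def B_def by (rule DERIV_w_line[OF h(1,2)])+
  have s: "A + L * B < 0" "0 < A + (- L) * B" using LB by auto
  from DERIV_neg_dec_right[OF p s(1)] obtain d1 where d1: "d1 > 0"
    "\<And>h. 0 < h \<Longrightarrow> h < d1 \<Longrightarrow> w (t0 + h) (xm + L * h) < 1" using assms(2) by auto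
  from DERIV_neg_dec_left[OF p s(1)] obtain d2 where d2: "d2 > 0"
    "\<And>h. 0 < h \<Longrightarrow> h < d2 \<Longrightarrow> 1 < w (t0 - h) (xm - L * h)" using assms(2) by auto
  from DERIV_pos_inc_right[OF m s(2)] obtain d3 where d3: "d3 > 0"
    "\<And>h. 0 < h \<Longrightarrow> h < d3 \<Longrightarrow> 1 < w (t0 + h) (xm - L * h)" using assms(2) by auto
  from DERIV_pos_inc_left[OF m s(2)] obtain d4 where d4: "d4 > 0"
    "\<And>h. 0 < h \<Longrightarrow> h < d4 \<Longrightarrow> w (t0 - h) (xm + L * h) < 1" using assms(2) by auto
  show thesis
  proof (rule that[OF L, of "min (min d1 d2) (min d3 d4)"])
    fix t assume t: "t \<noteq> t0" "\<bar>t - t0\<bar> < min (min d1 d2) (min d3 d4)"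
    show "w t (xm + L * \<bar>t - t0\<bar>) < 1 \<and> 1 < w t (xm - L * \<bar>t - t0\<bar>)"
    proof (cases "t0 < t")
      case True
      then show ?thesis using d1(2)[of "t - t0"] d3(2)[of "t - t0"] t by auto
    next
      case False
      then show ?thesis using d2(2)[of "t0 - t"] d4(2)[of "t0 - t"] t by auto
    qed
  qed (use d1 d2 d3 d4 in auto)
qed

definition Ht :: "real \<Rightarrow> real \<Rightarrow> real" where
  "Ht t x = integral {bot t..x} (dens t)"

lemma continuous_at_pairD:
  assumes "continuous_on hexint (\<lambda>p. h (fst p) (snd p))" "(t0, x0) \<in> hexint" "0 < \<delta>"
  obtains r where "0 < r" "\<And>t x. \<bar>t - t0\<bar> < r \<Longrightarrow> \<bar>x - x0\<bar> < r \<Longrightarrow>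
    (t, x) \<in> hexint \<and> \<bar>h t x - (h t0 x0 :: real)\<bar> < \<delta>"
proof -
  obtain r1 where r1: "0 < r1" "\<And>p. p \<in> hexint \<Longrightarrow> dist p (t0, x0) < r1 \<Longrightarrow>
      dist (h (fst p) (snd p)) (h t0 x0) < \<delta>"
    using assms(1)[unfolded continuous_on_iff, rule_format, OF assms(2,3)] by auto
  obtain r2 where r2: "0 < r2" "ball (t0, x0) r2 \<subseteq> hexint"
    using open_hexint assms(2) open_contains_ball by blast
  have d: "dist (t, x) (t0, x0) < min r1 r2" if "\<bar>t - t0\<bar> < min r1 r2 / 2" "\<bar>x - x0\<bar> < min r1 r2 / 2" for t x
  proof -
    have "dist (t, x) (t0, x0) \<le> \<bar>t - t0\<bar> + \<bar>x - x0\<bar>"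
      unfolding dist_Pair_Pair dist_real_def using sqrt_sum_squares_le_sum_abs by simp
    then show ?thesis using that by linarith
  qed
  show thesis
  proof (rule that[of "min r1 r2 / 2"])
    show "(t, x) \<in> hexint \<and> \<bar>h t x - h t0 x0\<bar> < \<delta>"
      if "\<bar>t - t0\<bar> < min r1 r2 / 2" "\<bar>x - x0\<bar> < min r1 r2 / 2" for t x
    proof -
      have "(t, x) \<in> hexint" using d[OF that] r2(2) by (auto simp: mem_ball dist_commute)
      then show ?thesis using r1(2)[of "(t, x)"] d[OF that] by (auto simp: dist_real_def)
    qed
  qed (use r1 r2 in auto)
qed

lemma dens_near_bottom:
  assumes "0 < t0" "t0 < b + c" "t0 \<noteq> b" "(t0, xm) \<in> hexint" "w t0 xm = 1"
  obtains d e where "0 < d" "flux t0 xm = - e * dens t0 xm" "\<And>t. \<bar>t - t0\<bar> < d \<Longrightarrow> bot t - bot t0 = e * (t - t0)"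
    "\<And>t y u. \<bar>t - t0\<bar> < d \<Longrightarrow> bot t < y \<Longrightarrow> y < 1 + min t c \<Longrightarrow> 1 \<le> w t y \<Longrightarrow>
       u \<in> {bot t<..y} \<Longrightarrow> dens t u = dens t0 xm"
proof (cases "t0 < b")
  case True
  note h = hexintD[OF assms(4)]
  have "w t0 xm < w t0 0" using w_strict_decreasing[OF h(1,2), of 0 xm] h True by auto
  then have "1 < (w t0 0)\<^sup>2" using assms(5) by (simp add: one_less_power)
  then have "nuX t0 0 \<noteq> 0" using nuX_sq[of t0 0] HX_0 by auto
  moreover have "continuous_on {0<..<b} (\<lambda>t. nuX t 0)"
    by (rule continuous_on_web(2)) (use c_pos in \<open>auto intro: continuous_intros\<close>)
  ultimately have "\<exists>d>0. \<forall>t\<in>{0<..<b}. dist t t0 < d \<longrightarrow> dist (nuX t 0) (nuX t0 0) < \<bar>nuX t0 0\<bar>"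
    unfolding continuous_on_iff using h True by simp
  then obtain d1 where d1: "0 < d1" "\<And>t. t \<in> {0<..<b} \<Longrightarrow> \<bar>t - t0\<bar> < d1 \<Longrightarrow> \<bar>nuX t 0 - nuX t0 0\<bar> < \<bar>nuX t0 0\<bar>"
    unfolding dist_real_def by blast
  define d where "d = min d1 (min t0 (b - t0))"
  have near: "t \<in> {0<..<b} \<and> sgn (nuX t 0) = sgn (nuX t0 0)" if "\<bar>t - t0\<bar> < d" for t
  proof -
    have "t \<in> {0<..<b}" "\<bar>t - t0\<bar> < d1" using that by (auto simp: d_def)
    with d1(2)[OF this] show ?thesis by (simp add: sgn_if abs_if split: if_splits)
  qed
  have r0: "dens t0 xm = 1 + (sgn (nuX t0 0) * (pi / 2) - pi / 2) / pi" "flux t0 xm = 0"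
    using frozen_below_left[of t0 xm xm] h True assms(5) by (simp_all add: dens_def flux_def)
  show thesis
  proof (rule that[of d 0])
    show "dens t u = dens t0 xm" if H: "\<bar>t - t0\<bar> < d" "bot t < y" "y < 1 + min t c" "1 \<le> w t y"
       "u \<in> {bot t<..y}" for t y u
    proof -
      have "0 < t" "t < b" and n: "sgn (nuX t 0) = sgn (nuX t0 0)" using near[OF H(1)] by simp_all
      then have "phX t u = sgn (nuX t 0) * (pi / 2)" "phU t u = pi / 2"
        using frozen_below_left[of t y u] H by simp_all
      then show ?thesis unfolding r0(1) unfolding dens_def n by simp
    qed
    show "0 < d" using d1(1) h(1) True by (simp add: d_def)
    show "bot t - bot t0 = 0 * (t - t0)" if "\<bar>t - t0\<bar> < d" for t
      using near[OF that] True by simp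
    show "flux t0 xm = - 0 * dens t0 xm" using r0(2) by simp
  qed
next
  case False
  then have b: "b < t0" using assms(3) by simp
  note h = hexintD[OF assms(4)]
  have "w t0 xm < w t0 (t0 - b)" using w_strict_decreasing[OF h(1,2), of "t0 - b" xm] h b by auto
  then have "1 < (w t0 (t0 - b))\<^sup>2" using assms(5) by (simp add: one_less_power)
  then have "nuU t0 (t0 - b) \<noteq> 0" using nuU_sq[OF h(1,2), of "t0 - b"] HU_b by auto
  moreover have "continuous_on {b<..<b+c} (\<lambda>t. nuU t (t - b))"
    by (rule continuous_on_web(3)) (use b_pos in \<open>auto intro!: continuous_intros\<close>)
  ultimately have "\<exists>d>0. \<forall>t\<in>{b<..<b+c}. dist t t0 < d \<longrightarrow>
      dist (nuU t (t - b)) (nuU t0 (t0 - b)) < \<bar>nuU t0 (t0 - b)\<bar>"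
    unfolding continuous_on_iff using h b by simp
  then obtain d1 where d1: "0 < d1" "\<And>t. t \<in> {b<..<b+c} \<Longrightarrow> \<bar>t - t0\<bar> < d1 \<Longrightarrow>
      \<bar>nuU t (t - b) - nuU t0 (t0 - b)\<bar> < \<bar>nuU t0 (t0 - b)\<bar>"
    unfolding dist_real_def by blast
  define d where "d = min d1 (min (t0 - b) (b + c - t0))"
  have near: "t \<in> {b<..<b+c} \<and> sgn (nuU t (t - b)) = sgn (nuU t0 (t0 - b))" if "\<bar>t - t0\<bar> < d" for t
  proof -
    have "t \<in> {b<..<b+c}" "\<bar>t - t0\<bar> < d1" using that by (auto simp: d_def)
    with d1(2)[OF this] show ?thesis by (simp add: sgn_if abs_if split: if_splits)
  qed
  have r0: "dens t0 xm = 1 + (- (pi / 2) - sgn (nuU t0 (t0 - b)) * (pi / 2)) / pi"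
      "flux t0 xm = sgn (nuU t0 (t0 - b)) * (pi / 2) / pi - 1 / 2"
    using frozen_below_right[of t0 xm xm] h b assms(5) by (simp_all add: dens_def flux_def)
  show thesis
  proof (rule that[of d 1])
    show "flux t0 xm = - 1 * dens t0 xm" unfolding r0 by (simp add: field_simps)
    show "dens t u = dens t0 xm" if H: "\<bar>t - t0\<bar> < d" "bot t < y" "y < 1 + min t c" "1 \<le> w t y"
       "u \<in> {bot t<..y}" for t y u
    proof -
      have "b < t" "t < b + c" and n: "sgn (nuU t (t - b)) = sgn (nuU t0 (t0 - b))"
        using near[OF H(1)] by simp_all
      then have "phX t u = - (pi / 2)" "phU t u = sgn (nuU t (t - b)) * (pi / 2)"
        using frozen_below_right[of t y u] H by simp_all
      then show ?thesis unfolding r0(1) unfolding dens_def n by simp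
    qed
    show "0 < d" using d1(1) h(2) b by (simp add: d_def)
    show "bot t - bot t0 = 1 * (t - t0)" if "\<bar>t - t0\<bar> < d" for t
      using near[OF that] b by simp
  qed
qed

text \<open>Closedness on a liquid rectangle combined with the mean value theorem in time, so that
  \<open>flux\<close> enters at a single intermediate time.\<close>

lemma integral_dens_liquid_increment:
  assumes "t \<noteq> t0" "\<And>s u. \<bar>s - t0\<bar> \<le> \<bar>t - t0\<bar> \<Longrightarrow> u \<in> {u1..u2} \<Longrightarrow> (s, u) \<in> liq" "u1 \<le> u2"
  obtains z where "\<bar>z - t0\<bar> \<le> \<bar>t - t0\<bar>"
    "integral {u1..u2} (dens t) - integral {u1..u2} (dens t0) = (t - t0) * (flux z u2 - flux z u1)"
proof -
  define lo hi where "lo = min t t0" and "hi = max t t0"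
  have "lo < hi" using assms(1) by (auto simp: lo_def hi_def)
  moreover have "((\<lambda>s. integral {u1..u2} (dens s)) has_derivative (\<lambda>h. h * (flux s u2 - flux s u1))) (at s within {lo..hi})"
    if "lo \<le> s" "s \<le> hi" for s
  proof -
    have "(s, u) \<in> liq" if "s \<in> {lo..hi}" "u \<in> {u1..u2}" for s u
      by (rule assms(2)) (use that in \<open>auto simp: lo_def hi_def\<close>)
    from DERIV_integral_dens_liquid[OF this assms(3), of lo hi s] that show ?thesis
      by (simp add: has_field_derivative_def mult.commute[of _ "flux s u2 - flux s u1"])
  qed
  ultimately obtain z where z: "z \<in> {lo<..<hi}"
    "integral {u1..u2} (dens hi) - integral {u1..u2} (dens lo) = (hi - lo) * (flux z u2 - flux z u1)"
    using mvt_simple[of lo hi "\<lambda>s. integral {u1..u2} (dens s)" "\<lambda>s h. h * (flux s u2 - flux s u1)"] by auto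
  show thesis
  proof (rule that[of z])
    show "\<bar>z - t0\<bar> \<le> \<bar>t - t0\<bar>" using z(1) by (auto simp: lo_def hi_def)
    show "integral {u1..u2} (dens t) - integral {u1..u2} (dens t0) = (t - t0) * (flux z u2 - flux z u1)"
      using z(2) by (cases "t < t0") (auto simp: lo_def hi_def algebra_simps)
  qed
qed

text \<open>One of the two invariants vanishes on the lower edge, which makes \<open>w^2 - 1\<close>
  a square there. The value cannot be below -1, because \<open>w\<close> decreases towards the
  liquid point.\<close>

lemma w_bottom:
  assumes "(t, x) \<in> liq" "t \<noteq> b"
  shows "1 \<le> w t (bot t)"
proof -
  note h = hexintD[OF liqD(1)[OF assms(1)]]
  have "1 \<le> (w t (bot t))\<^sup>2"
  proof (cases "t < b")
    case True
    then show ?thesis using nuX_sq[of t 0] HX_0 zero_le_power2[of "nuX t 0"] by simp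
  next
    case False
    then show ?thesis
      using nuU_sq[OF h(1,2), of "t - b"] HU_b zero_le_power2[of "nuU t (t - b)"] assms(2) by simp
  qed
  moreover have "w t x < w t (bot t)"
    by (rule w_strict_decreasing[OF h(1,2)]) (use h in simp_all)
  moreover have "-1 < w t x"
    using liqD(2)[OF assms(1)] by (simp add: abs_square_less_1)
  ultimately show ?thesis
    using abs_le_square_iff[of 1 "w t (bot t)"] by simp
qed

lemma liqI:
  assumes "(s, x) \<in> liq" "bot s < y" "w s y < 1" "y \<le> u" "u \<le> x"
  shows "(s, u) \<in> liq"
proof -
  note h = hexintD[OF liqD(1)[OF assms(1)]]
  have "w s u \<le> w s y" "w s x \<le> w s u"
    by (rule w_decreasing[OF h(1,2)]; use assms h in simp)+
  moreover have "-1 < w s x"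
    using liqD(2)[OF assms(1)] by (simp add: abs_square_less_1)
  ultimately have "(w s u)\<^sup>2 < 1" using assms(3) by (simp add: abs_square_less_1)
  then show ?thesis using assms h by (simp add: liq_def hexint_def)
qed

lemma integral_const_Ioc:
  fixes h :: "real \<Rightarrow> real"
  assumes "\<And>u. u \<in> {a<..y} \<Longrightarrow> h u = r" "a \<le> y"
  shows "integral {a..y} h = r * (y - a)"
proof -
  have "integral {a..y} h = integral {a..y} (\<lambda>_. r)"
    by (rule integral_spike[of "{a}"]) (use assms in auto)
  then show ?thesis using assms(2) by simp
qed

lemma integral_const_near:
  fixes h :: "real \<Rightarrow> real"
  assumes "h integrable_on {u1..u2}" "\<And>u. u \<in> {u1..u2} \<Longrightarrow> \<bar>h u - r\<bar> \<le> \<delta>" "u1 \<le> u2"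
  shows "\<bar>integral {u1..u2} h - r * (u2 - u1)\<bar> \<le> \<delta> * (u2 - u1)"
proof -
  have "integral {u1..u2} h \<le> integral {u1..u2} (\<lambda>_. r + \<delta>)"
    by (rule integral_le) (use assms in \<open>force+\<close>)
  moreover have "integral {u1..u2} (\<lambda>_. r - \<delta>) \<le> integral {u1..u2} h"
    by (rule integral_le) (use assms in \<open>force+\<close>)
  ultimately show ?thesis using assms(3) by (simp add: abs_le_iff algebra_simps)
qed

text \<open>
  The slice through \<open>t\<close> is cut at distance \<open>\<eta> = L \<bar>t - t0\<bar>\<close> from the interface \<open>xm\<close> of the slice through \<open>t0\<close>. Below
  the cut the density is constant; above it, closedness applies; and in between, the density is nearly constant by
  continuity, so that this part of the increment is \<open>o(\<bar>t - t0\<bar>)\<close>.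
\<close>

lemma DERIV_Ht_generic:
  assumes "(t0, x) \<in> liq" "t0 \<noteq> b" "w t0 (bot t0) \<noteq> 1"
  shows "((\<lambda>t. Ht t x) has_real_derivative flux t0 x) (at t0)"
proof -
  note h = hexintD[OF liqD(1)[OF assms(1)]]
  have w: "-1 < w t0 x" "w t0 x < 1"
    using liqD(2)[OF assms(1)] by (simp_all add: abs_square_less_1)
  have "1 < w t0 (bot t0)" using w_bottom[OF assms(1,2)] assms(3) by simp
  moreover have "continuous_on {bot t0..x} (w t0)"
    by (rule continuous_on_web(1)[of _ "\<lambda>_. t0" "\<lambda>u. u"]) (use h in \<open>auto intro: continuous_intros\<close>)
  ultimately obtain xm where "bot t0 \<le> xm" "xm \<le> x" "w t0 xm = 1"
    using IVT2'[of "w t0" x 1 "bot t0"] w h by auto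
  moreover have "xm \<noteq> bot t0" "xm \<noteq> x" using \<open>w t0 xm = 1\<close> assms(3) w by auto
  ultimately have xm: "bot t0 < xm" "xm < x" "w t0 xm = 1" by auto
  have xmh: "(t0, xm) \<in> hexint" using xm h by (simp add: hexint_def)
  obtain L d1 where L: "0 < L" "0 < d1" "\<And>t. t \<noteq> t0 \<Longrightarrow> \<bar>t - t0\<bar> < d1 \<Longrightarrow>
      w t (xm + L * \<bar>t - t0\<bar>) < 1 \<and> 1 < w t (xm - L * \<bar>t - t0\<bar>)"
    by (rule interface_cone[OF xmh xm(3)], rule that; assumption)
  obtain d2 e where d2: "0 < d2" "flux t0 xm = - e * dens t0 xm"
    "\<And>t. \<bar>t - t0\<bar> < d2 \<Longrightarrow> bot t - bot t0 = e * (t - t0)"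
    "\<And>t y u. \<bar>t - t0\<bar> < d2 \<Longrightarrow> bot t < y \<Longrightarrow> y < 1 + min t c \<Longrightarrow> 1 \<le> w t y \<Longrightarrow>
       u \<in> {bot t<..y} \<Longrightarrow> dens t u = dens t0 xm"
    by (rule dens_near_bottom[OF h(1,2) assms(2) xmh xm(3)], rule that; assumption)
  have cr: "continuous_on hexint (\<lambda>p. dens (fst p) (snd p))"
    and cs: "continuous_on hexint (\<lambda>p. flux (fst p) (snd p))"
    by (rule continuous_on_angles(3,4); auto intro: continuous_intros)+
  have "((\<lambda>t. (Ht t x - Ht t0 x) / (t - t0)) \<longlongrightarrow> flux t0 x) (at t0)"
  proof (rule LIM_I)
    fix \<epsilon> :: real assume "0 < \<epsilon>"
    \<comment> \<open>The error budget: the strip of width \<open>2 * \<eta>\<close> contributes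
      \<open>2 * \<eta> * \<delta>\<close> at each of two times, that is
      \<open>4 * L * \<delta>\<close> after division by \<open>t - t0\<close>, and the two values of
      \<open>flux\<close> contribute \<delta> each.\<close>
    define \<delta> where "\<delta> = \<epsilon> / (4 * L + 3)"
    have \<delta>: "0 < \<delta>" "(4 * L + 2) * \<delta> < \<epsilon>"
      using \<open>0 < \<epsilon>\<close> L(1) by (simp_all add: \<delta>_def field_simps)
    obtain r1 where r1: "0 < r1" "\<And>t u. \<bar>t - t0\<bar> < r1 \<Longrightarrow> \<bar>u - xm\<bar> < r1 \<Longrightarrow>
        (t, u) \<in> hexint \<and> \<bar>dens t u - dens t0 xm\<bar> < \<delta>"
      by (rule continuous_at_pairD[OF cr xmh \<delta>(1)], rule that; assumption)
    obtain r2 where r2: "0 < r2" "\<And>t u. \<bar>t - t0\<bar> < r2 \<Longrightarrow> \<bar>u - xm\<bar> < r2 \<Longrightarrow>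
        (t, u) \<in> hexint \<and> \<bar>flux t u - flux t0 xm\<bar> < \<delta>"
      by (rule continuous_at_pairD[OF cs xmh \<delta>(1)], rule that; assumption)
    obtain r3 where r3: "0 < r3" "\<And>t u. \<bar>t - t0\<bar> < r3 \<Longrightarrow> \<bar>u - x\<bar> < r3 \<Longrightarrow>
        (t, u) \<in> hexint \<and> \<bar>flux t u - flux t0 x\<bar> < \<delta>"
      by (rule continuous_at_pairD[OF cs liqD(1)[OF assms(1)] \<delta>(1)], rule that; assumption)
    have "open {s. (s, x) \<in> liq}" "t0 \<in> {s. (s, x) \<in> liq}"
      using open_slices(1)[OF open_liq] assms(1) by auto
    then obtain r4 where r4: "0 < r4" "ball t0 r4 \<subseteq> {s. (s, x) \<in> liq}"
      using open_contains_ball by blast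
    have r4': "(t, x) \<in> liq" if "\<bar>t - t0\<bar> < r4" for t
      using subsetD[OF r4(2), of t] that by (simp add: dist_real_def abs_minus_commute)
    define r where "r = min (min (min d1 d2) (min r1 r2)) (min (min r3 r4) (min (r1 / (2 * L)) (min (r2 / (2 * L)) ((x - xm) / L))))"
    have r: "0 < r" unfolding r_def using L(1,2) d2(1) r1(1) r2(1) r3(1) r4(1) xm(2) by simp
    show "\<exists>r>0. \<forall>t. t \<noteq> t0 \<and> norm (t - t0) < r \<longrightarrow>
        norm ((Ht t x - Ht t0 x) / (t - t0) - flux t0 x) < \<epsilon>"
    proof (intro exI[of _ r] conjI r allI impI, elim conjE)
      fix t assume t: "t \<noteq> t0" "norm (t - t0) < r"
      define \<eta> where "\<eta> = L * \<bar>t - t0\<bar>"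
      have \<eta>0: "0 < \<eta>" using L(1) t(1) by (simp add: \<eta>_def)
      have "\<bar>t - t0\<bar> < r1 / (2 * L)" "\<bar>t - t0\<bar> < r2 / (2 * L)" "\<bar>t - t0\<bar> < (x - xm) / L"
        using t(2) by (simp_all add: r_def)
      then have \<eta>: "\<eta> < r1" "\<eta> < r2" "xm + \<eta> < x"
        using L(1) r1(1) r2(1) by (simp_all add: \<eta>_def field_simps)
      have near: "\<bar>s - t0\<bar> < d1" "\<bar>s - t0\<bar> < d2" "\<bar>s - t0\<bar> < r1" "\<bar>s - t0\<bar> < r2"
        "\<bar>s - t0\<bar> < r3" "\<bar>s - t0\<bar> < r4" if "\<bar>s - t0\<bar> \<le> \<bar>t - t0\<bar>" for s
        using that t(2) by (simp_all add: r_def)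
      have strip: "(s, u) \<in> hexint" "\<bar>dens s u - dens t0 xm\<bar> < \<delta>" "\<bar>flux s u - flux t0 xm\<bar> < \<delta>"
        if "\<bar>s - t0\<bar> \<le> \<bar>t - t0\<bar>" "\<bar>u - xm\<bar> \<le> \<eta>" for s u
        using r1(2)[of s u] r2(2)[of s u] near[OF that(1)] that(2) \<eta> by auto
      have above: "(s, u) \<in> liq" if s: "\<bar>s - t0\<bar> \<le> \<bar>t - t0\<bar>" and u: "u \<in> {xm + \<eta>..x}" for s u
      proof (rule liqI)
        have m: "(s, xm + \<eta>) \<in> hexint" by (rule strip(1)[OF s]) (use \<eta>0 in simp)
        note hm = hexintD[OF m]
        show "(s, x) \<in> liq" by (rule r4'[OF near(6)[OF s]])
        show "bot s < xm + \<eta>" "xm + \<eta> \<le> u" "u \<le> x" using hm(3) u by simp_all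
        show "w s (xm + \<eta>) < 1"
        \<comment> \<open>The cone says nothing about \<open>t0\<close> itself; there strict
          monotonicity below and above \<open>xm\<close> replaces it.\<close>
        proof (cases "s = t0")
          case True
          have "w t0 (xm + \<eta>) < w t0 xm"
            by (rule w_strict_decreasing[OF h(1,2)]) (use xm(1) \<eta>0 hm True in simp_all)
          then show ?thesis using xm(3) True by simp
        next
          case False
          have le: "xm + L * \<bar>s - t0\<bar> \<le> xm + \<eta>" using s L(1) by (simp add: \<eta>_def)
          have m': "(s, xm + L * \<bar>s - t0\<bar>) \<in> hexint"
            by (rule strip(1)[OF s]) (use le L(1) in simp)
          have "w s (xm + \<eta>) \<le> w s (xm + L * \<bar>s - t0\<bar>)"
            by (rule w_decreasing[OF hm(1,2) _ le hm(4)]) (use hexintD(3)[OF m'] in simp)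
          then show ?thesis using L(3)[OF False near(1)[OF s]] by simp
        qed
      qed
      have split: "Ht s x = dens t0 xm * (xm - \<eta> - bot s) + integral {xm - \<eta>..xm + \<eta>} (dens s)
            + integral {xm + \<eta>..x} (dens s)"
        and mid: "\<bar>integral {xm - \<eta>..xm + \<eta>} (dens s) - dens t0 xm * (2 * \<eta>)\<bar> \<le> \<delta> * (2 * \<eta>)"
        if s: "s = t \<or> s = t0" for s
      proof -
        have s': "\<bar>s - t0\<bar> \<le> \<bar>t - t0\<bar>" using s by auto
        have m: "(s, xm - \<eta>) \<in> hexint" "(s, xm + \<eta>) \<in> hexint"
          by (rule strip(1)[OF s'], use \<eta>0 in simp)+
        note hm = hexintD[OF m(1)]
        have sx: "x < 1 + min s c" using hexintD(4)[OF liqD(1)[OF r4'[OF near(6)[OF s']]]] .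
        have int: "dens s integrable_on {u1..u2}" if "bot s \<le> u1" "u2 \<le> x" for u1 u2
          by (rule integrable_dens[OF hm(1,2) that(1)]) (use that(2) sx in simp)
        have "1 \<le> w s (xm - \<eta>)"
        proof (cases "s = t0")
          case True
          have "w t0 xm < w t0 (xm - \<eta>)"
            by (rule w_strict_decreasing[OF h(1,2)]) (use hm(3) True \<eta>0 hexintD(4)[OF xmh] in simp_all)
          then show ?thesis using xm(3) True by simp
        next
          case False
          then show ?thesis using L(3)[OF False near(1)[OF s']] s by (simp add: \<eta>_def)
        qed
        then have c: "dens s u = dens t0 xm" if "u \<in> {bot s<..xm - \<eta>}" for u
          using d2(4)[OF near(2)[OF s'] hm(3,4) _ that] by simp
        have "integral {bot s..xm - \<eta>} (dens s) = dens t0 xm * (xm - \<eta> - bot s)"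
          by (rule integral_const_Ioc[OF c less_imp_le[OF hm(3)]])
        moreover have "integral {bot s..xm - \<eta>} (dens s) + integral {xm - \<eta>..x} (dens s) = Ht s x"
          unfolding Ht_def by (rule Henstock_Kurzweil_Integration.integral_combine)
            (use hm(3) \<eta>0 \<eta>(3) int in simp_all)
        moreover have "integral {xm - \<eta>..xm + \<eta>} (dens s) + integral {xm + \<eta>..x} (dens s)
            = integral {xm - \<eta>..x} (dens s)"
          by (rule Henstock_Kurzweil_Integration.integral_combine)
            (use hm(3) \<eta>0 \<eta>(3) int in simp_all)
        ultimately show "Ht s x = dens t0 xm * (xm - \<eta> - bot s) + integral {xm - \<eta>..xm + \<eta>} (dens s)
            + integral {xm + \<eta>..x} (dens s)" by simp
        have "\<bar>integral {xm - \<eta>..xm + \<eta>} (dens s) - dens t0 xm * (xm + \<eta> - (xm - \<eta>))\<bar>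
            \<le> \<delta> * (xm + \<eta> - (xm - \<eta>))"
        proof (rule integral_const_near)
          show "dens s integrable_on {xm - \<eta>..xm + \<eta>}" by (rule int) (use hm(3) \<eta>(3) in simp_all)
          show "\<bar>dens s u - dens t0 xm\<bar> \<le> \<delta>" if "u \<in> {xm - \<eta>..xm + \<eta>}" for u
          proof -
            have "\<bar>u - xm\<bar> \<le> \<eta>" using that by (simp add: abs_le_iff)
            then show ?thesis by (rule less_imp_le[OF strip(2)[OF s']])
          qed
        qed (use \<eta>0 in simp)
        then show "\<bar>integral {xm - \<eta>..xm + \<eta>} (dens s) - dens t0 xm * (2 * \<eta>)\<bar> \<le> \<delta> * (2 * \<eta>)"
          by simp
      qed
      obtain z where z: "\<bar>z - t0\<bar> \<le> \<bar>t - t0\<bar>"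
        "integral {xm + \<eta>..x} (dens t) - integral {xm + \<eta>..x} (dens t0) = (t - t0) * (flux z x - flux z (xm + \<eta>))"
        using integral_dens_liquid_increment[OF t(1) above less_imp_le[OF \<eta>(3)]] by blast
      define m where "m = integral {xm - \<eta>..xm + \<eta>} (dens t) - integral {xm - \<eta>..xm + \<eta>} (dens t0)"
      have "\<bar>m\<bar> \<le> 4 * \<eta> * \<delta>" unfolding m_def using mid[of t] mid[of t0] by (simp add: abs_le_iff algebra_simps)
      then have mb: "\<bar>m / (t - t0)\<bar> \<le> 4 * L * \<delta>"
        using t(1) by (simp add: \<eta>_def abs_divide field_simps)
      have "Ht t x - Ht t0 x = - dens t0 xm * (bot t - bot t0) + m + (t - t0) * (flux z x - flux z (xm + \<eta>))"
        using split[of t] split[of t0] z(2) unfolding m_def by (simp add: algebra_simps)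
      also have "\<dots> = (t - t0) * (flux t0 xm) + m + (t - t0) * (flux z x - flux z (xm + \<eta>))"
        using d2(2) d2(3)[OF near(2)] by simp
      finally have "(Ht t x - Ht t0 x) / (t - t0) - flux t0 x
          = m / (t - t0) + (flux z x - flux t0 x) - (flux z (xm + \<eta>) - flux t0 xm)"
        using t(1) by (simp add: field_simps)
      moreover have "\<bar>flux z x - flux t0 x\<bar> < \<delta>" using r3(2)[OF near(5)[OF z(1)], of x] r3(1) by simp
      moreover have "\<bar>flux z (xm + \<eta>) - flux t0 xm\<bar> < \<delta>" using strip(3)[OF z(1), of "xm + \<eta>"] \<eta>0 by simp
      moreover have "4 * L * \<delta> + \<delta> + \<delta> < \<epsilon>" using \<delta>(2) by (simp add: algebra_simps)
      ultimately show "norm ((Ht t x - Ht t0 x) / (t - t0) - flux t0 x) < \<epsilon>"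
        using mb unfolding real_norm_def by linarith
    qed
  qed
  then show ?thesis by (simp add: has_field_derivative_iff)
qed

lemma integral_dens_bounds:
  assumes "0 < t" "t < b + c" "bot t \<le> u1" "u1 \<le> u2" "u2 < 1 + min t c"
  shows "0 \<le> integral {u1..u2} (dens t)" (is ?g1) "integral {u1..u2} (dens t) \<le> 2 * (u2 - u1)" (is ?g2)
proof -
  have "\<bar>integral {u1..u2} (dens t) - 1 * (u2 - u1)\<bar> \<le> 1 * (u2 - u1)"
  proof (rule integral_const_near[OF integrable_dens])
    show "\<bar>dens t u - 1\<bar> \<le> 1" for u
    proof -
      have "\<bar>phX t u\<bar> \<le> pi / 2" "\<bar>phU t u\<bar> \<le> pi / 2"
        unfolding phX_def phU_def abs_le_iff
        using arcsin_bounded[OF clip_bounds] by (simp_all add: minus_le_iff)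
      then have "\<bar>phX t u - phU t u\<bar> \<le> pi" by linarith
      then show ?thesis by (simp add: dens_def abs_divide)
    qed
  qed (use assms in auto)
  then show ?g1 ?g2 by (auto simp: abs_le_iff)
qed

text \<open>
  Continuity suffices to pass over the finitely many times at which the cone argument fails: the corner time \<open>b\<close> and
  the times at which the arctic curve touches a lower edge.
\<close>

lemma isCont_Ht:
  assumes "(t0, x) \<in> hexint"
  shows "isCont (\<lambda>t. Ht t x) t0"
proof -
  note h = hexintD[OF assms]
  have "(\<lambda>t. Ht t x) \<midarrow>t0\<rightarrow> Ht t0 x"
  proof (rule LIM_I)
    fix \<epsilon> :: real assume "0 < \<epsilon>"
    define \<delta> where "\<delta> = min (\<epsilon> / 16) ((x - bot t0) / 2)"
    have \<delta>: "0 < \<delta>" "6 * \<delta> < \<epsilon> / 2" "bot t0 + \<delta> < x"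
      using \<open>0 < \<epsilon>\<close> h(3) by (auto simp: \<delta>_def min_def field_simps)
    \<comment> \<open>The layer between the moving edge and the fixed height \<open>u1\<close> has
      thickness at most \<open>2 * \<delta>\<close> and integral at most
      \<open>4 * \<delta>\<close>; above it the limits of integration are fixed.\<close>
    define u1 where "u1 = bot t0 + \<delta>"
    define r where "r = min (\<delta> / 2) (min (min (t0 / 2) ((b + c - t0) / 2)) ((1 + min t0 c - x) / 2))"
    have r: "0 < r" using \<delta>(1) h by (simp add: r_def)
    have n: "0 < t \<and> t < b + c \<and> bot t < u1 \<and> x < 1 + min t c \<and> u1 - bot t \<le> 2 * \<delta>" if "\<bar>t - t0\<bar> \<le> r" for t
    proof -
      have "\<bar>t - t0\<bar> \<le> \<delta> / 2" "\<bar>t - t0\<bar> \<le> t0 / 2" "\<bar>t - t0\<bar> \<le> (b + c - t0) / 2"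
          "\<bar>t - t0\<bar> \<le> (1 + min t0 c - x) / 2"
        using that by (simp_all add: r_def)
      moreover have "bot t \<le> bot t0 + \<bar>t - t0\<bar>" "bot t0 \<le> bot t + \<bar>t - t0\<bar>" "min t0 c \<le> min t c + \<bar>t - t0\<bar>"
        by auto
      moreover have "t0 - \<bar>t - t0\<bar> \<le> t" "t \<le> t0 + \<bar>t - t0\<bar>" by auto
      ultimately show ?thesis using h(1-4) \<delta>(1) unfolding u1_def by argo
    qed
    have "continuous_on {t0 - r..t0 + r} (\<lambda>t. integral (cbox u1 x) (dens t))"
    proof (rule integral_continuous_on_param)
      show "continuous_on ({t0 - r..t0 + r} \<times> cbox u1 x) (\<lambda>(t, u). dens t u)"
        unfolding split_beta
      proof (rule continuous_on_angles(3))
        fix p assume "p \<in> {t0 - r..t0 + r} \<times> cbox u1 x"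
        then show "(fst p, snd p) \<in> hexint"
          using n[of "fst p"] by (auto simp: hexint_def abs_le_iff)
      qed (auto intro: continuous_intros)
    qed
    from this[unfolded continuous_on_iff, rule_format, of t0 "\<epsilon> / 2"]
    have "\<exists>d>0. \<forall>t\<in>{t0 - r..t0 + r}. dist t t0 < d \<longrightarrow>
        dist (integral (cbox u1 x) (dens t)) (integral (cbox u1 x) (dens t0)) < \<epsilon> / 2"
      using r \<open>0 < \<epsilon>\<close> by simp
    then obtain d where d: "0 < d" "\<And>t. t \<in> {t0 - r..t0 + r} \<Longrightarrow> \<bar>t - t0\<bar> < d \<Longrightarrow>
        \<bar>integral {u1..x} (dens t) - integral {u1..x} (dens t0)\<bar> < \<epsilon> / 2"
      unfolding dist_real_def cbox_interval by blast
    have split: "Ht t x = integral {bot t..u1} (dens t) + integral {u1..x} (dens t)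
        \<and> 0 \<le> integral {bot t..u1} (dens t) \<and> integral {bot t..u1} (dens t) \<le> 4 * \<delta>"
      if "\<bar>t - t0\<bar> \<le> r" for t
    proof -
      note n' = n[OF that]
      have "integral {bot t..u1} (dens t) + integral {u1..x} (dens t) = Ht t x"
        unfolding Ht_def by (rule Henstock_Kurzweil_Integration.integral_combine)
          (use n' \<delta>(3) in \<open>auto intro!: integrable_dens simp: u1_def\<close>)
      moreover have "u1 < x" using \<delta>(3) by (simp add: u1_def)
      ultimately show ?thesis using integral_dens_bounds[of t "bot t" u1] n' by simp
    qed
    show "\<exists>r>0. \<forall>t. t \<noteq> t0 \<and> norm (t - t0) < r \<longrightarrow> norm (Ht t x - Ht t0 x) < \<epsilon>"
    proof (intro exI[of _ "min r d"] conjI allI impI, simp add: r d(1), elim conjE)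
      fix t assume t: "norm (t - t0) < min r d"
      then have t': "\<bar>t - t0\<bar> \<le> r" "\<bar>t - t0\<bar> < d" "t \<in> {t0 - r..t0 + r}" by auto
      have "\<bar>t0 - t0\<bar> \<le> r" using r by simp
      then show "norm (Ht t x - Ht t0 x) < \<epsilon>"
        using split[OF t'(1)] split[of t0] d(2)[OF t'(3,2)] \<delta>(2)
        unfolding real_norm_def abs_less_iff by linarith
    qed
  qed
  then show ?thesis by (simp add: isCont_def)
qed

lemma exp_\<tau>_inj:
  assumes "t1 \<in> {0<..<b+c}" "t2 \<in> {0<..<b+c}" "exp (\<tau> t1) = exp (\<tau> t2)"
  shows "t1 = t2"
proof -
  have less: "\<tau> s < \<tau> t" if "0 < s" "s < t" "t < b + c" for s t
  proof (rule DERIV_pos_imp_increasing[OF that(2)])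
    fix v assume "s \<le> v" "v \<le> t"
    then have "0 < v" "v < b + c" using that by linarith+
    then show "\<exists>y. (\<tau> has_real_derivative y) (at v) \<and> 0 < y"
      using DERIV_\<tau> \<tau>'_pos by blast
  qed
  show ?thesis using less[of t1 t2] less[of t2 t1] assms by (cases t1 t2 rule: linorder_cases) auto
qed

text \<open>If \<open>w = 1\<close> on a lower edge, the slope there vanishes too, because the
  invariant is zero. The difference of the two equations is \<open>2 * f 0 * exp \<tau> = 1\<close>,
  or the same with \<open>F (- b)\<close>, and the strictly increasing \<tau> satisfies it at most
  once.\<close>

lemma finite_exceptional_times: "finite {t \<in> {0<..<b+c}. t = b \<or> w t (bot t) = 1}"
proof -
  have unique: "finite {t \<in> {0<..<b+c}. p * exp (\<tau> t) = 1 / 2}" (is "finite ?S") for p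
  proof -
    have eq: "t1 = t2" if t1: "t1 \<in> ?S" and t2: "t2 \<in> ?S" for t1 t2
    proof (rule exp_\<tau>_inj)
      have e: "p * exp (\<tau> t1) = 1 / 2" "p * exp (\<tau> t2) = 1 / 2" using t1 t2 by simp_all
      have "p \<noteq> 0" using e(1) by force
      moreover have "p * exp (\<tau> t1) = p * exp (\<tau> t2)" by (simp only: e)
      ultimately show "exp (\<tau> t1) = exp (\<tau> t2)" by (simp only: mult_cancel_left simp_thms)
    qed (use t1 t2 in simp_all)
    show ?thesis
    proof (cases "?S = {}")
      case True
      then show ?thesis by (simp only: finite.emptyI)
    next
      case False
      then obtain a where "a \<in> ?S" by blast
      then have "?S \<subseteq> {a}" using eq by blast
      then show ?thesis by (rule finite_subset) simp
    qed
  qed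
  have "{t \<in> {0<..<b+c}. t = b \<or> w t (bot t) = 1} \<subseteq> {b} \<union>
     {t \<in> {0<..<b+c}. f 0 * exp (\<tau> t) = 1 / 2} \<union> {t \<in> {0<..<b+c}. F (- b) * exp (\<tau> t) = 1 / 2}"
  proof
    fix t assume "t \<in> {t \<in> {0<..<b+c}. t = b \<or> w t (bot t) = 1}"
    then have t: "0 < t" "t < b + c" "t = b \<or> w t (bot t) = 1" by auto
    consider "t = b" | "t < b" "w t 0 = 1" | "b < t" "w t (t - b) = 1" using t(3) by fastforce
    then show "t \<in> {b} \<union> {t \<in> {0<..<b+c}. f 0 * exp (\<tau> t) = 1 / 2}
        \<union> {t \<in> {0<..<b+c}. F (- b) * exp (\<tau> t) = 1 / 2}"
    proof cases
      case 2
      then have "(nuX t 0)\<^sup>2 = 0" unfolding nuX_sq HX_0 by simp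
      then have "f 0 * exp (\<tau> t) = 1 / 2" using 2 unfolding nuX_def w_def by simp
      then show ?thesis using t by simp
    next
      case 3
      then have "(nuU t (t - b))\<^sup>2 = 0" unfolding nuU_sq[OF t(1,2)] using HU_b by simp
      then have "F (- b) * exp (\<tau> t) = 1 / 2" using 3 unfolding nuU_def w_U[OF t(1,2)] by simp
      then show ?thesis using t by simp
    qed simp
  qed
  then show ?thesis by (rule finite_subset) (use unique in simp)
qed

text \<open>A finite exceptional set does not disturb the fundamental theorem of calculus for the
  continuous \<open>Ht\<close>. As \<open>flux\<close> is continuous, differentiating its integral
  gives the derivative at the exceptional times as well.\<close>

lemma DERIV_Ht_t:
  assumes "(t0, x) \<in> liq"
  shows "((\<lambda>t. Ht t x) has_real_derivative flux t0 x) (at t0)"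
proof -
  have "open {s. (s, x) \<in> liq}" "t0 \<in> {s. (s, x) \<in> liq}"
    using open_slices(1)[OF open_liq] assms by auto
  then obtain r where r: "0 < r" "cball t0 r \<subseteq> {s. (s, x) \<in> liq}"
    using open_contains_cball by blast
  have l: "(t, x) \<in> liq" if "t \<in> {t0 - r..t0 + r}" for t
    using subsetD[OF r(2), of t] that by (auto simp: dist_real_def abs_le_iff)
  have cont: "continuous_on {t0 - r..t0 + r} (\<lambda>t. Ht t x)"
    by (intro continuous_at_imp_continuous_on ballI isCont_Ht liqD(1)[OF l])
  have FTC: "integral {t0 - r..t} (\<lambda>s. flux s x) = Ht t x - Ht (t0 - r) x" if t: "t \<in> {t0 - r..t0 + r}" for t
  proof (rule integral_unique, rule fundamental_theorem_of_calculus_strong[OF finite_exceptional_times])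
    fix s assume s: "s \<in> {t0 - r..t} - {t \<in> {0<..<b+c}. t = b \<or> w t (bot t) = 1}"
    then have sl: "(s, x) \<in> liq" using t by (intro l) auto
    then have "s \<in> {0<..<b+c}" using hexintD(1,2)[OF liqD(1)] by auto
    then show "((\<lambda>t. Ht t x) has_vector_derivative flux s x) (at s)"
      using DERIV_Ht_generic[OF sl] s by (auto simp: has_real_derivative_iff_has_vector_derivative)
  qed (use t in \<open>auto intro: continuous_on_subset[OF cont]\<close>)
  have "continuous_on {t0 - r..t0 + r} (\<lambda>s. flux s x)"
    by (rule continuous_on_angles(4)) (use l liqD in \<open>auto intro: continuous_intros\<close>)
  from integral_has_real_derivative[OF this, of t0] r(1)
  have "((\<lambda>t. integral {t0 - r..t} (\<lambda>s. flux s x)) has_real_derivative flux t0 x) (at t0 within {t0 - r..t0 + r})"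
    by simp
  then have "((\<lambda>t. integral {t0 - r..t} (\<lambda>s. flux s x)) has_real_derivative flux t0 x) (at t0)"
    using at_within_interior[of t0 "{t0 - r..t0 + r}"] r(1) by simp
  from DERIV_add[OF this DERIV_const[of "Ht (t0 - r) x"]]
  have "((\<lambda>t. integral {t0 - r..t} (\<lambda>s. flux s x) + Ht (t0 - r) x) has_real_derivative flux t0 x) (at t0)"
    by simp
  then show ?thesis
    by (rule has_field_derivative_transform_within_open[of _ _ _ "{t0 - r<..<t0 + r}"])
      (use FTC r(1) in auto)
qed

lemma DERIV_Ht_x:
  assumes "(t, x) \<in> hexint"
  shows "((\<lambda>u. Ht t u) has_real_derivative dens t x) (at x)"
proof -
  note h = hexintD[OF assms]
  obtain u1 u2 where u: "bot t < u1" "u1 < x" "x < u2" "u2 < 1 + min t c"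
    using dense[OF h(3)] dense[OF h(4)] by blast
  have "continuous_on {u1..u2} (dens t)"
    by (rule continuous_on_angles(3)[of _ "\<lambda>_. t" "\<lambda>u. u"])
      (use u h in \<open>auto intro: continuous_intros simp: hexint_def\<close>)
  from integral_has_real_derivative[OF this, of x] u
  have "((\<lambda>u. integral {u1..u} (dens t)) has_real_derivative dens t x) (at x within {u1..u2})"
    by simp
  then have "((\<lambda>u. integral {u1..u} (dens t)) has_real_derivative dens t x) (at x)"
    using at_within_interior[of x "{u1..u2}"] u by simp
  from DERIV_add[OF DERIV_const[of "integral {bot t..u1} (dens t)"] this]
  have "((\<lambda>u. integral {bot t..u1} (dens t) + integral {u1..u} (dens t)) has_real_derivative dens t x) (at x)"
    by simp
  then show ?thesis
  proof (rule has_field_derivative_transform_within_open[of _ _ _ "{u1<..<u2}"])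
    show "integral {bot t..u1} (dens t) + integral {u1..v} (dens t) = Ht t v" if "v \<in> {u1<..<u2}" for v
      unfolding Ht_def by (rule Henstock_Kurzweil_Integration.integral_combine)
        (use that u h in \<open>auto intro!: integrable_dens\<close>)
  qed (use u in auto)
qed
lemma dens_eq_arccos:
  assumes "(t, x) \<in> hexint"
  shows "dens t x = arccos (clip (- (1 - (w t x)\<^sup>2 + nuX t x * nuU t x) / (sqrt (HX x) * sqrt (HU (x - t))))) / pi"
proof -
  note h = hexintD[OF assms]
  define v where "v = - (1 - (w t x)\<^sup>2 + nuX t x * nuU t x) / (sqrt (HX x) * sqrt (HU (x - t)))"
  define D where "D = 1 - (w t x)\<^sup>2"
  have H: "HX x = (nuX t x)\<^sup>2 + D" "HU (x - t) = (nuU t x)\<^sup>2 + D"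
    using nuX_sq[of t x] nuU_sq[OF h(1,2), of x] by (simp_all add: D_def)
  have "dens t x = arccos (clip v) / pi"
  proof (cases "(w t x)\<^sup>2 < 1")
    case True
    note X = phX_liquid[OF h(5) True] and U = phU_liquid[OF h(1,2,6) True]
    have sX: "sin (phX t x) = nuX t x / sqrt (HX x)"
    proof -
      have "-1 \<le> nuX t x / sqrt (HX x)" "nuX t x / sqrt (HX x) \<le> 1" using X(1) by linarith+
      then show ?thesis unfolding X(2) by (rule sin_arcsin)
    qed
    have sU: "sin (phU t x) = nuU t x / sqrt (HU (x - t))"
    proof -
      have "-1 \<le> nuU t x / sqrt (HU (x - t))" "nuU t x / sqrt (HU (x - t)) \<le> 1" using U(1) by linarith+
      then show ?thesis unfolding U(2) by (rule sin_arcsin)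
    qed
    have "cos (phX t x) * cos (phU t x) = (1 - (w t x)\<^sup>2) / (sqrt (HX x) * sqrt (HU (x - t)))"
      unfolding X(3) U(3) using True by simp
    moreover have "sin (phX t x) * sin (phU t x) = nuX t x * nuU t x / (sqrt (HX x) * sqrt (HU (x - t)))"
      unfolding sX sU by simp
    moreover have "v = - ((1 - (w t x)\<^sup>2) / (sqrt (HX x) * sqrt (HU (x - t)))
        + nuX t x * nuU t x / (sqrt (HX x) * sqrt (HU (x - t))))"
      unfolding v_def by (simp only: divide_minus_left add_divide_distrib)
    ultimately have v: "v = cos (pi + (phX t x - phU t x))"
      by (simp add: cos_add cos_diff)
    have "phX t x < phU t x" by (rule phX_less_phU[OF assms True])
    then have "arccos v = pi + (phX t x - phU t x)"
      unfolding v by (intro arccos_cos; use X(5) U(5) in linarith)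
    moreover have "\<bar>v\<bar> \<le> 1" unfolding v by (rule abs_cos_le_one)
    ultimately show ?thesis by (simp add: clip_id dens_def field_simps)
  next
    case False
    then have w: "1 \<le> (w t x)\<^sup>2" and D: "D \<le> 0" by (simp_all add: D_def)
    note X = phX_frozen[OF h(5) w] and U = phU_frozen[OF h(1,2,6) w]
    define m where "m = sqrt (HX x) * sqrt (HU (x - t))"
    have m: "0 < m" "m\<^sup>2 = HX x * HU (x - t)" using h(5,6) by (simp_all add: m_def power_mult_distrib)
    \<comment> \<open>Since \<open>D\<close> is nonpositive, this identity gives a reversed
      Cauchy-Schwarz inequality, which pushes the quotient out of the open interval.\<close>
    have "(D + nuX t x * nuU t x)\<^sup>2 = m\<^sup>2 - D * (nuU t x - nuX t x)\<^sup>2"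
      unfolding m(2) H by (simp add: algebra_simps power2_eq_square)
    then have "m\<^sup>2 \<le> (D + nuX t x * nuU t x)\<^sup>2" using D by (simp add: mult_nonpos_nonneg)
    then have ge: "m \<le> \<bar>D + nuX t x * nuU t x\<bar>"
      using m(1) abs_le_square_iff[of m "D + nuX t x * nuU t x"] by simp
    have v: "v = - (D + nuX t x * nuU t x) / m" by (simp add: v_def D_def m_def)
    show ?thesis
    proof (cases "0 < nuX t x * nuU t x")
      case True
      \<comment> \<open>Both invariants are positive, so \<open>- D\<close> lies below both squared
        slopes; hence the product of the slopes outweighs \<open>D\<close> and decides the sign of
        \<open>v\<close>.\<close>
      have "(- D)\<^sup>2 \<le> (nuX t x * nuU t x)\<^sup>2"
      proof -
        have "- D \<le> (nuX t x)\<^sup>2" "- D \<le> (nuU t x)\<^sup>2" using H h(5,6) by linarith+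
        then have "(- D) * (- D) \<le> (nuX t x)\<^sup>2 * (nuU t x)\<^sup>2"
            by (intro mult_mono zero_le_power2) (use D in simp_all)
        then show ?thesis by (simp add: power2_eq_square mult_ac)
      qed
      then have "- D \<le> nuX t x * nuU t x" by (rule power2_le_imp_le) (use True in simp)
      then have "v \<le> -1" unfolding v pos_divide_le_eq[OF m(1)] using ge D by linarith
      moreover have "phX t x = phU t x"
        using True unfolding X(2) U(2) zero_less_mult_iff by (elim disjE conjE) simp_all
      ultimately show ?thesis by (simp add: clip_le dens_def)
    next
      case False
      then have le: "nuX t x * nuU t x \<le> 0" by simp
      have n: "nuX t x < 0" "0 < nuU t x"
        using le[unfolded mult_le_0_iff] h(7) X(1) U(1) by linarith+
      have "D + nuX t x * nuU t x \<le> 0" using D le by linarith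
      then have "1 \<le> v" unfolding v pos_le_divide_eq[OF m(1)] using ge by linarith
      moreover have "phX t x - phU t x = - pi" unfolding X(2) U(2) using n by simp
      ultimately show ?thesis by (simp add: clip_ge dens_def)
    qed
  qed
  then show ?thesis by (simp add: v_def)
qed

lemma inner_product_identity:
  assumes "0 < t" "t < b + c"
  shows "1 - (w t x)\<^sup>2 + nuX t x * nuU t x = 1 - 2 * (f x * G (x - t) + g x * F (x - t))"
proof -
  \<comment> \<open>Writing the square as the product of the two different representations makes the
    terms with \<open>exp (2 * \<tau>)\<close> and \<open>exp (- 2 * \<tau>)\<close> cancel.\<close>
  have "(w t x)\<^sup>2 = w t x * (F (x - t) * exp (\<tau> t) + G (x - t) * exp (- \<tau> t))"
    unfolding w_U[OF assms, symmetric] by (rule power2_eq_square)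
  then show ?thesis unfolding w_def nuX_def nuU_def using exp_\<tau>[of t] by algebra
qed

end

section \<open>The complex slope\<close>

lemma vertex_angle_simps:
  "vertex_angle 1 0 w = arccos (Re w / cmod w)"
  "vertex_angle 0 1 w = arccos ((1 - Re w) / cmod (w - 1))"
  "vertex_angle 0 w 1 = arccos ((Re w * (Re w - 1) + Im w * Im w) / (cmod w * cmod (w - 1)))"
  by (simp_all add: vertex_angle_def inner_complex_def norm_minus_commute algebra_simps)

text \<open>The three angles add up to \<pi>, so by the law of sines the sides from 0 and from 1 to
  \<open>W\<close> have lengths \<open>sin (u - p) / cos p\<close> and \<open>cos u / cos p\<close>.
  The angles at 0 and 1 already determine the point.\<close>

lemma triangle_of_angles:
  fixes p u :: real
  assumes p: "- (pi / 2) < p" and pu: "p < u" and u: "u < pi / 2"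
  defines "r \<equiv> sin (u - p) / cos p"
  defines "W \<equiv> Complex (r * sin u) (r * cos u)"
  shows "0 < Im W \<and> vertex_angle 1 0 W = pi / 2 - u \<and> vertex_angle 0 1 W = u - p
      \<and> vertex_angle 0 W 1 = p + pi / 2" (is ?g1)
    and "\<And>w. 0 < Im w \<Longrightarrow> vertex_angle 1 0 w = pi / 2 - u \<Longrightarrow> vertex_angle 0 1 w = u - p \<Longrightarrow> w = W"
proof -
  have cp: "0 < cos p" and cu: "0 < cos u" using assms by (auto intro!: cos_gt_zero_pi)
  have s: "0 < sin (u - p)" using assms by (intro sin_gt_zero) auto
  have r: "0 < r" using s cp by (simp add: r_def)
  have rd: "r * cos p = sin (u - p)" using cp by (simp add: r_def)
  have su: "(sin u)\<^sup>2 = 1 - (cos u)\<^sup>2" by (simp add: sin_squared_eq)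
  have mW: "cmod W = r"
    using r by (simp add: W_def cmod_def power_mult_distrib su algebra_simps)
  define v where "v = cos u / cos p"
  have v: "0 < v" using cp cu by (simp add: v_def)
  have re: "r * sin u - 1 = - (v * cos (u - p))" and im: "r * cos u = v * sin (u - p)"
  proof -
    have "(r * sin u - 1) * cos p = sin u * (r * cos p) - cos p" by (simp add: algebra_simps)
    also have "\<dots> = sin u * (sin u * cos p - cos u * sin p) - cos p" by (simp only: rd sin_diff)
    also have "\<dots> = - cos u * (cos u * cos p + sin u * sin p)"
      using sin_cos_squared_add[of u] by algebra
    also have "\<dots> = - cos u * cos (u - p)" by (simp only: cos_diff)
    finally have "(r * sin u - 1) * cos p = - cos u * cos (u - p)" .
    then show "r * sin u - 1 = - (v * cos (u - p))" using cp by (simp add: v_def field_simps)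
    show "r * cos u = v * sin (u - p)" by (simp add: v_def r_def)
  qed
  have mW1: "cmod (W - 1) = v"
  proof -
    have "(Re (W - 1))\<^sup>2 + (Im (W - 1))\<^sup>2 = v\<^sup>2 * (cos (u - p))\<^sup>2 + v\<^sup>2 * (sin (u - p))\<^sup>2"
      by (simp add: W_def re im power_mult_distrib)
    also have "\<dots> = v\<^sup>2" by (simp flip: distrib_left)
    finally have "(Re (W - 1))\<^sup>2 + (Im (W - 1))\<^sup>2 = v\<^sup>2" .
    then show ?thesis using v by (simp add: cmod_def)
  qed
  have "vertex_angle 1 0 W = pi / 2 - u"
    unfolding vertex_angle_simps mW using r p pu u arccos_cos[of "pi / 2 - u"]
    by (simp add: W_def cos_diff)
  moreover have "vertex_angle 0 1 W = u - p"
  proof -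
    have "1 - Re W = v * cos (u - p)" using re by (simp add: W_def)
    then show ?thesis
      unfolding vertex_angle_simps mW1 using v p pu u arccos_cos[of "u - p"] by simp
  qed
  moreover have "vertex_angle 0 W 1 = p + pi / 2"
  proof -
    have "Re W * (Re W - 1) + Im W * Im W = r * v * (cos u * sin (u - p) - sin u * cos (u - p))"
    proof -
      have "Re W * (Re W - 1) + Im W * Im W = r * sin u * (r * sin u - 1) + r * cos u * (r * cos u)"
        by (simp add: W_def)
      also have "\<dots> = r * sin u * - (v * cos (u - p)) + r * cos u * (v * sin (u - p))"
        by (simp only: re im)
      finally show ?thesis by (simp add: algebra_simps)
    qed
    also have "cos u * sin (u - p) - sin u * cos (u - p) = - sin p"
      using sin_diff[of "u - p" u] by (simp add: algebra_simps)
    finally have "(Re W * (Re W - 1) + Im W * Im W) / (cmod W * cmod (W - 1)) = cos (p + pi / 2)"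
      unfolding mW mW1 using r v by (simp add: cos_add)
    then show ?thesis
      unfolding vertex_angle_simps using p pu u arccos_cos[of "p + pi / 2"] by simp
  qed
  moreover have "0 < Im W" using r cu by (simp add: W_def)
  ultimately show ?g1 by simp
  fix w assume w: "0 < Im w" "vertex_angle 1 0 w = pi / 2 - u" "vertex_angle 0 1 w = u - p"
  have w0: "0 < cmod w" "0 < cmod (w - 1)" using w(1) by auto
  have arccos: "x = cos y" if "arccos x = y" "\<bar>x\<bar> \<le> 1" for x y :: real
    using that by (auto simp: abs_le_iff)
  have "\<bar>Re w / cmod w\<bar> \<le> 1" using abs_Re_le_cmod[of w] w0 by (simp add: abs_divide)
  from arccos[OF w(2)[unfolded vertex_angle_simps] this]
  have "Re w / cmod w = sin u" by (simp add: cos_diff)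
  then have a: "Re w = cmod w * sin u" using w0 by (simp add: field_simps)
  have "\<bar>(1 - Re w) / cmod (w - 1)\<bar> \<le> 1"
    using abs_Re_le_cmod[of "w - 1"] w0 by (simp add: abs_divide)
  from arccos[OF w(3)[unfolded vertex_angle_simps] this]
  have a1: "1 - Re w = cmod (w - 1) * cos (u - p)" using w0 by (simp add: field_simps)
  have "(Im w)\<^sup>2 = (cmod w)\<^sup>2 * (1 - (sin u)\<^sup>2)"
    using cmod_power2[of w] a by (simp add: power_mult_distrib algebra_simps)
  then have "(Im w)\<^sup>2 = (cmod w * cos u)\<^sup>2" by (simp add: su power_mult_distrib)
  then have b: "Im w = cmod w * cos u" by (rule power2_eq_imp_eq) (use w w0 cu in auto)
  have "(Im w)\<^sup>2 = (cmod (w - 1))\<^sup>2 - (1 - Re w)\<^sup>2"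
    using cmod_power2[of "w - 1"] by (simp add: power2_eq_square algebra_simps)
  then have "(Im w)\<^sup>2 = (cmod (w - 1) * sin (u - p))\<^sup>2"
    unfolding a1 by (simp add: power_mult_distrib sin_squared_eq algebra_simps)
  then have b1: "Im w = cmod (w - 1) * sin (u - p)" by (rule power2_eq_imp_eq) (use w w0 s in auto)
  have 1: "Re w * cos u = Im w * sin u" using a b by simp
  have 2: "(1 - Re w) * sin (u - p) = Im w * cos (u - p)" using a1 b1 by simp
  have "cos p = cos u * cos (u - p) + sin u * sin (u - p)"
    using cos_diff[of u "u - p"] by simp
  then have "Im w * cos p = cos u * sin (u - p)" using 1 2 by algebra
  then have Im: "Im w = r * cos u" using cp by (simp add: r_def field_simps)
  then have "Re w = r * sin u" using 1 cu by simp
  with Im show "w = W" by (simp add: W_def complex_eq_iff)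
qed

text \<open>The Beltrami quotient is a Moebius function of \<open>Fx / (Fx + Ft)\<close>. The second
  claim guards against the convention \<open>u / 0 = 0\<close>: the two denominators vanish
  together.\<close>

lemma beltrami_of_slope:
  fixes Ft Fx w :: complex
  assumes "Fx + Ft \<noteq> 0" "w = Fx / (Fx + Ft)"
  shows "((Ft + \<i> * Fx) / 2) / ((Ft - \<i> * Fx) / 2) = - ((1 + (\<i> - 1) * w) / (- 1 + (1 + \<i>) * w))" (is ?g1)
    "(Ft - \<i> * Fx) / 2 = 0 \<longleftrightarrow> - 1 + (1 + \<i>) * w = 0"
proof -
  have 1: "1 + (\<i> - 1) * w = (Ft + \<i> * Fx) / (Fx + Ft)"
    and 2: "- 1 + (1 + \<i>) * w = - ((Ft - \<i> * Fx) / (Fx + Ft))"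
    using assms by (simp_all add: field_simps)
  show ?g1
  proof -
    have "(A / 2) / (B / 2) = - ((A / S) / - (B / S))" if "S \<noteq> 0" for A B S :: complex
      using that by simp
    then show ?thesis unfolding 1 2 using assms(1) by blast
  qed
  show "(Ft - \<i> * Fx) / 2 = 0 \<longleftrightarrow> - 1 + (1 + \<i>) * w = 0"
    unfolding 2 using assms(1) by simp
qed

text \<open>\<open>Fx\<close>, \<open>Ft\<close> and \<open>Fx + Ft\<close> are the images of the
  three lattice directions and have the arguments \<pi>/2, \<open>p\<close> and \<open>u\<close>.
  They form a triangle similar to \<open>0, 1, \<Omega>\<close>.\<close>

lemma slope_of_tangents:
  fixes p u d :: real
  assumes "0 < d" "- (pi / 2) < p" "p < u" "u < pi / 2"
  defines "Ft \<equiv> complex_of_real d * (1 + \<i> * complex_of_real (tan p))"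
    and "Fx \<equiv> \<i> * complex_of_real (d * (tan u - tan p))"
  shows "Fx + Ft \<noteq> 0"
    and "Fx / (Fx + Ft) = Complex (sin (u - p) / cos p * sin u) (sin (u - p) / cos p * cos u)" (is ?g1)
proof -
  have c: "0 < cos p" "0 < cos u" using assms by (auto intro!: cos_gt_zero_pi)
  have S: "Fx + Ft = complex_of_real d * Complex 1 (tan u)"
    by (simp add: Ft_def Fx_def complex_eq_iff algebra_simps)
  show n: "Fx + Ft \<noteq> 0" unfolding S using assms(1) by (simp add: complex_eq_iff)
  have t: "tan u - tan p = sin (u - p) / (cos u * cos p)"
    using c by (simp add: tan_def sin_diff field_simps)
  have "Fx = Complex (sin (u - p) / cos p * sin u) (sin (u - p) / cos p * cos u) * (Fx + Ft)"
  proof -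
    define r where "r = sin (u - p) / cos p"
    have 1: "cos u * tan u = sin u" using c by (simp add: tan_def)
    have "cos u + sin u * tan u = 1 / cos u"
      using c sin_cos_squared_add[of u] by (simp add: tan_def power2_eq_square divide_simps)
    then have 2: "r * (cos u + sin u * tan u) = tan u - tan p" unfolding t r_def by simp
    have "r * sin u * d - r * cos u * (d * tan u) = r * d * (sin u - cos u * tan u)"
      by (simp add: algebra_simps)
    then have "r * sin u * d - r * cos u * (d * tan u) = 0" by (simp add: 1)
    moreover have "r * sin u * (d * tan u) + r * cos u * d = d * (r * (cos u + sin u * tan u))"
      by (simp add: algebra_simps)
    then have "r * sin u * (d * tan u) + r * cos u * d = d * (tan u - tan p)" by (simp only: 2)
    ultimately have "r * sin u * d - r * cos u * (d * tan u) = 0 \<and>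
      r * sin u * (d * tan u) + r * cos u * d = d * (tan u - tan p)" ..
    then show ?thesis
      unfolding S unfolding Fx_def r_def[symmetric] by (simp add: complex_eq_iff)
  qed
  then show ?g1 using n by (simp add: field_simps)
qed

section \<open>Identities for the q-Racah recurrence coefficients\<close>

text \<open>
  With \<open>z = q\<^sup>\<xi>\<close>, \<open>\<alpha> = q\<^bsup>-c-1\<^esup>\<close>, \<open>\<alpha>' = q\<^bsup>-b-1\<^esup>\<close>, \<open>\<beta> = q\<^bsup>-t-1\<^esup>\<close> and \<open>K = \<kappa>\<^sup>2 q\<^sup>2\<close> one has
  \<open>A = numA z / (den z)\<^sup>2\<close> and \<open>C = numC z / (den z)\<^sup>2\<close>, where \<open>numC\<close> arises from \<open>numA\<close> by the involution
  \<open>z \<mapsto> 1 / (s z)\<close>. The variable \<open>y = 1 / z + s z\<close> is invariant under it, and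
  \<open>- (den z)\<^sup>2 (4 A C - (\<mu> - b)\<^sup>2) = z\<^sup>2 (quad2 y\<^sup>2 + quad1 y + quad0)\<close>.
\<close>

locale racah =
  fixes \<alpha> \<alpha>' \<beta> K :: real
begin
definition s :: real where "s = \<alpha> * \<alpha>'"
definition k' :: real where "k' = K * \<alpha> * \<beta>"
definition e1 :: real where "e1 = \<alpha> + \<beta> + s + K * s"
definition e2 :: real where "e2 = \<alpha> * \<beta> + \<alpha> * s + \<alpha> * (K * s) + \<beta> * s + \<beta> * (K * s) + K * s\<^sup>2"
definition e3 :: real where "e3 = \<alpha> * \<beta> + K * \<alpha> * \<beta> + K * \<alpha> * s + K * \<beta> * s"
definition numA :: "real \<Rightarrow> real" where
  "numA z = (1 - \<alpha> * z) * (1 - \<beta> * z) * (1 - s * z) * (1 - K * s * z)"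
definition numC :: "real \<Rightarrow> real" where
  "numC z = (1 - z) * (1 - \<alpha>' * z) * (\<alpha> * (K - z)) * (\<beta> - s * z)"
definition den :: "real \<Rightarrow> real" where "den z = 1 - s * z\<^sup>2"
definition skew :: "real \<Rightarrow> real" where "skew z = (1 - k') * (1 + s * z\<^sup>2) - (e1 - e3) * z"
definition quad2 :: "real \<Rightarrow> real" where "quad2 \<mu> = \<mu>\<^sup>2 - 4 * k'"
definition quad1 :: "real \<Rightarrow> real" where "quad1 \<mu> = -2 * (e1 + e3) * \<mu> + 4 * k' * e1 + 4 * e3"
definition quad0 :: "real \<Rightarrow> real" where
  "quad0 \<mu> = - 4 * s * \<mu>\<^sup>2 + (4 * s * (1 + k') + 4 * e2) * \<mu> - 4 * (1 + k') * e2 + (e1 - e3)\<^sup>2"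

lemmas coeffs = s_def k'_def e1_def e2_def e3_def

text \<open>The involution gives \<open>numC z = s^2 * z^4 * numA (1 / (s * z))\<close>. At its
  fixed points \<open>s * z^2 = 1\<close> the two numerators agree, so \<open>den\<close> divides
  their difference.\<close>

lemma numA_numC: "numA z - numC z = den z * skew z"
  unfolding numA_def numC_def den_def skew_def coeffs
  by (simp add: algebra_simps power2_eq_square)

text \<open>With \<open>m = \<mu> - 1 - k'\<close> one has \<open>(m + A + C)^2 - 4 * A * C = m^2 +
  2 * m * (A + C) + (A - C)^2\<close>. After multiplication by \<open>den^2\<close>,
  \<open>numA_numC\<close> removes the remaining pole from the last term.\<close>

lemma quad_eq: "(1 + s * z\<^sup>2)\<^sup>2 * quad2 \<mu> + z * (1 + s * z\<^sup>2) * quad1 \<mu> + z\<^sup>2 * quad0 \<mu>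
   = (skew z)\<^sup>2 + ((\<mu> - 1 - k') * den z)\<^sup>2 + 2 * (\<mu> - 1 - k') * (numA z + numC z)"
  unfolding quad2_def quad1_def quad0_def numA_def numC_def den_def skew_def coeffs
  by (simp add: algebra_simps power2_eq_square)

text \<open>Up to positive factors, the invariants of the two families of circles. With
  \<open>X = q^x\<close> the first two factors of \<open>MX\<close> vanish on the lines
  \<open>x = 0\<close> and \<open>x = 1 + c\<close>, and the corresponding ones of \<open>MU\<close>
  on \<open>x - t = - b\<close> and \<open>x - t = 1\<close>.\<close>

definition MX :: "real \<Rightarrow> real" where
  "MX X = - ((1 - X) * (1 - \<alpha> * X) * (1 - K * s * X) * (1 - K * \<alpha> * X))"
definition MU :: "real \<Rightarrow> real" where
  "MU X = - (\<alpha> * (\<alpha>' - X * \<beta>) * (1 - \<beta> * X) * (1 - k' * X) * (1 - K * \<beta> * X))"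

definition quad1X :: "real \<Rightarrow> real" where
  "quad1X X = X * (-2 * (e1 + e3) * (1 + k' * X\<^sup>2) + (4 * k' * e1 + 4 * e3) * X)"

lemma quad_mu:
  assumes "X \<noteq> 0"
  shows "X\<^sup>2 * quad2 (1 / X + k' * X) = (1 - k' * X\<^sup>2)\<^sup>2" (is ?g1)
    "X\<^sup>2 * quad1 (1 / X + k' * X) = quad1X X" (is ?g2)
    "X\<^sup>2 * quad0 (1 / X + k' * X) = - 4 * s * (1 + k' * X\<^sup>2)\<^sup>2
      + (4 * s * (1 + k') + 4 * e2) * X * (1 + k' * X\<^sup>2) + (- 4 * (1 + k') * e2 + (e1 - e3)\<^sup>2) * X\<^sup>2" (is ?g3)
proof -
  define m where "m = 1 / X + k' * X"
  have m: "X * m = 1 + k' * X\<^sup>2" using assms by (simp add: m_def field_simps power2_eq_square)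
  show ?g1 ?g2 ?g3 unfolding m_def[symmetric] m[symmetric] quad2_def quad1_def quad0_def quad1X_def using m by algebra+
qed

text \<open>The derivative \<open>2 * quad2 * y + quad1\<close> at the \<open>y\<close>-values of
  \<open>z = 1\<close>, \<open>1 / \<alpha>\<close> and \<open>1 / \<beta>\<close>, cleared of
  denominators. Within each factorised right side, all summands have the same sign in the
  hexagon.\<close>

lemma slope_identities:
  "2 * (1 - k' * X\<^sup>2)\<^sup>2 * (1 + s) + quad1X X
   = 2 * ((1 - \<beta> * X) * (1 - \<alpha> * X) * (1 - k' * X) * (1 - K * s * X)
       + \<alpha> * (1 - X) * (\<alpha>' - X * \<beta>) * (1 - K * \<alpha> * X) * (1 - K * \<beta> * X))"
  "2 * (1 - k' * X\<^sup>2)\<^sup>2 * (\<alpha> + \<alpha>') + quad1X X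
   = 2 * (\<alpha> * (1 - X) * (1 - \<beta> * X) * (1 - K * s * X) * (1 - K * \<beta> * X)
       + (\<alpha>' - X * \<beta>) * (1 - \<alpha> * X) * (1 - k' * X) * (1 - K * \<alpha> * X))"
  "2 * (1 - k' * X\<^sup>2)\<^sup>2 * (\<beta>\<^sup>2 + s) + \<beta> * quad1X X = - 2 * (\<beta>\<^sup>2 * MX X + MU X)"
  unfolding quad1X_def MX_def MU_def coeffs by (simp_all add: algebra_simps power2_eq_square)

text \<open>The discriminant is the squared derivative minus four times the leading coefficient
  times the value, at any point. At \<open>z = 1 / \<beta>\<close>, where \<open>numA\<close>
  vanishes, the value is a square, so a difference of two squares appears; these are the sum and the
  difference of \<open>\<beta>^2 * MX\<close> and \<open>MU\<close>.\<close>

lemma discriminant_identity: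
  fixes X :: real
  assumes "\<beta> \<noteq> 0"
  defines "Z \<equiv> - 4 * s * (1 + k' * X\<^sup>2)\<^sup>2
      + (4 * s * (1 + k') + 4 * e2) * X * (1 + k' * X\<^sup>2) + (- 4 * (1 + k') * e2 + (e1 - e3)\<^sup>2) * X\<^sup>2"
  shows "(quad1X X)\<^sup>2 - 4 * (1 - k' * X\<^sup>2)\<^sup>2 * Z = 16 * MX X * MU X"
proof -
  define h where "h = (1 + k' * X\<^sup>2 - X - k' * X) * (\<beta>\<^sup>2 - s) - X * ((1 - k') * (\<beta>\<^sup>2 + s) - (e1 - e3) * \<beta>)"
  define P where "P = 1 - k' * X\<^sup>2"
  define Y where "Y = \<beta>\<^sup>2 + s"
  have 1: "Y\<^sup>2 * P\<^sup>2 + \<beta> * Y * quad1X X + \<beta>\<^sup>2 * Z = h\<^sup>2"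
    unfolding h_def P_def Y_def Z_def quad1X_def coeffs by (simp add: algebra_simps power2_eq_square)
  have 2: "\<beta>\<^sup>2 * MX X - MU X = - (P * h)"
    unfolding h_def P_def MX_def MU_def coeffs by (simp add: algebra_simps power2_eq_square)
  have 3: "2 * P\<^sup>2 * Y + \<beta> * quad1X X = - 2 * (\<beta>\<^sup>2 * MX X + MU X)"
    unfolding P_def Y_def by (rule slope_identities(3))
  have "\<beta>\<^sup>2 * ((quad1X X)\<^sup>2 - 4 * P\<^sup>2 * Z) = (2 * P\<^sup>2 * Y + \<beta> * quad1X X)\<^sup>2
      - 4 * P\<^sup>2 * (Y\<^sup>2 * P\<^sup>2 + \<beta> * Y * quad1X X + \<beta>\<^sup>2 * Z)"
    by (simp add: algebra_simps power2_eq_square)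
  also have "\<dots> = 4 * (\<beta>\<^sup>2 * MX X + MU X)\<^sup>2 - 4 * (- (P * h))\<^sup>2"
    unfolding 1 3 by (simp add: algebra_simps power2_eq_square)
  also have "\<dots> = \<beta>\<^sup>2 * (16 * MX X * MU X)"
    unfolding 2[symmetric] by (simp add: algebra_simps power2_eq_square)
  finally show ?thesis using assms(1) unfolding P_def by simp
qed

text \<open>Once one numerator is zero, the other is \<open>den * skew\<close> up to sign, which
  completes the square in \<open>quad_eq\<close>. The quadratic is therefore nonnegative at such
  points.\<close>

lemma vanishing_numerator:
  "numA z = 0 \<Longrightarrow> (1 + s * z\<^sup>2)\<^sup>2 * quad2 \<mu> + z * (1 + s * z\<^sup>2) * quad1 \<mu> + z\<^sup>2 * quad0 \<mu>
     = ((\<mu> - 1 - k') * den z - skew z)\<^sup>2"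
  "numC z = 0 \<Longrightarrow> (1 + s * z\<^sup>2)\<^sup>2 * quad2 \<mu> + z * (1 + s * z\<^sup>2) * quad1 \<mu> + z\<^sup>2 * quad0 \<mu>
     = ((\<mu> - 1 - k') * den z + skew z)\<^sup>2"
  unfolding quad_eq using numA_numC[of z] by algebra+

text \<open>
  At \<open>z = q\<close>, that is \<open>\<xi> = 1\<close>: here \<open>A(1;t) = a (1 - q\<beta>) / den q\<close> and \<open>C(1;t) = d (q\<beta> - s q\<^sup>2) / den q\<close>. All
  identities below are linear in \<open>a\<close> and \<open>d\<close>, and hence follow from the two relations \<open>a_d_linear\<close>.
\<close>

context
  fixes q X a d f0 g0 F0 G0 :: real
  assumes nz: "q \<noteq> 0" "X \<noteq> 0" "\<beta> \<noteq> 0" "den q \<noteq> 0"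
  defines "a \<equiv> (1 - \<alpha> * q) * (1 - s * q) * (1 - K * s * q) / den q"
    and "d \<equiv> (1 - q) * (1 - \<alpha>' * q) * \<alpha> * (K - q) / (q * den q)"
    and "f0 \<equiv> (1 / X - 1) * (1 - K * s * \<alpha> * q * X)"
    and "g0 \<equiv> (1 / X - 1) * (1 - K * \<alpha> * X / q)"
    and "F0 \<equiv> s * q / (\<beta> * X) - K * s * \<alpha> * q + K * \<alpha> * \<beta> * X - 1"
    and "G0 \<equiv> 1 / (q * \<beta> * X) - K * \<alpha> / q + K * \<alpha> * \<beta> * X - 1"
begin

lemma a_d_linear:
  "a + d * s * q\<^sup>2 = 1 + s * q\<^sup>2 - q * (\<alpha> + s + K * s - K * \<alpha> * s)" (is ?g1)
  "q * (a + d) = K * \<alpha> * (1 + s * q\<^sup>2) + q * (1 - \<alpha> - K * \<alpha> - K * s)" (is ?g2)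
proof -
  have a: "a * den q = (1 - \<alpha> * q) * (1 - s * q) * (1 - K * s * q)"
    and d: "q * (d * den q) = (1 - q) * (1 - \<alpha>' * q) * \<alpha> * (K - q)"
    using nz by (simp_all add: a_def d_def)
  have "(a + d * s * q\<^sup>2) * den q = a * den q + q * s * (q * (d * den q))"
    by (simp add: algebra_simps power2_eq_square)
  also have "\<dots> = (1 + s * q\<^sup>2 - q * (\<alpha> + s + K * s - K * \<alpha> * s)) * den q"
    unfolding a d unfolding den_def s_def by (simp add: algebra_simps power2_eq_square)
  finally show ?g1 using nz(4) by simp
  have "q * (a + d) * den q = q * (a * den q) + q * (d * den q)"
    by (simp add: algebra_simps)
  also have "\<dots> = (K * \<alpha> * (1 + s * q\<^sup>2) + q * (1 - \<alpha> - K * \<alpha> - K * s)) * den q"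
    unfolding a d unfolding den_def s_def by (simp add: algebra_simps power2_eq_square)
  finally show ?g2 using nz(4) by simp
qed

lemma circle_X: "a * d - (f0 + a) * (g0 + d) = MX X / X\<^sup>2"
proof -
  have "a * d - (f0 + a) * (g0 + d) = - f0 * g0 - (a * g0 + d * f0)" by (simp add: algebra_simps)
  also have "a * g0 + d * f0 = (1 / X - 1) * (q * (a + d) - K * \<alpha> * X * (a + d * s * q\<^sup>2)) / q"
    using nz unfolding f0_def g0_def by (simp add: field_simps power2_eq_square)
  also have "- f0 * g0 - (1 / X - 1) * (q * (a + d) - K * \<alpha> * X * (a + d * s * q\<^sup>2)) / q = MX X / X\<^sup>2"
    unfolding a_d_linear unfolding f0_def g0_def MX_def using nz
    by (simp add: field_simps power2_eq_square)
  finally show ?thesis .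
qed

lemma circle_U: "a * d - (F0 + a) * (G0 + d) = MU X / (\<beta> * X)\<^sup>2"
proof -
  \<comment> \<open>With this \<open>v\<close> the mixed term \<open>a * G0 + d * F0\<close> becomes
    a combination of the two quantities in \<open>a_d_linear\<close>.\<close>
  define v where "v = 1 / (q * \<beta> * X) - K * \<alpha> / q"
  have F: "F0 = s * q\<^sup>2 * v + (K * \<alpha> * \<beta> * X - 1)" and G: "G0 = v + (K * \<alpha> * \<beta> * X - 1)"
    unfolding F0_def G0_def v_def using nz by (simp_all add: field_simps power2_eq_square)
  have "a * d - (F0 + a) * (G0 + d) = - F0 * G0 - (v * (a + d * s * q\<^sup>2) + (K * \<alpha> * \<beta> * X - 1) * (q * (a + d)) / q)"
    unfolding F G using nz(1) by (simp add: field_simps)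
  also have "\<dots> = MU X / (\<beta> * X)\<^sup>2"
    unfolding a_d_linear F G unfolding v_def MU_def k'_def s_def using nz
    by (simp add: field_simps power2_eq_square)
  finally show ?thesis .
qed

text \<open>Links the derivative of the quadratic at \<open>\<xi> = 1\<close>, the numerator of the
  arccosine in \<open>rho\<close>, with the right side of
  \<open>inner_product_identity\<close>.\<close>

lemma slope_identity_1:
  "2 * (1 - k' * X\<^sup>2)\<^sup>2 * (1 / q + s * q) + quad1X X
   = - X\<^sup>2 * \<beta> * (4 * (a * d) - 2 * ((f0 + a) * (G0 + d) + (g0 + d) * (F0 + a)))"
proof -
  \<comment> \<open>\<open>l\<close> solves \<open>f0 + F0 = g0 + G0 - l + l * s * q^2\<close>, so
    that the part linear in \<open>a\<close> and \<open>d\<close> is again covered by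
    \<open>a_d_linear\<close>.\<close>
  define l where "l = - ((1 - X) * (K * \<alpha> / q) + K * \<alpha> / q - 1 / (q * \<beta> * X))"
  have "d * (f0 + F0) + a * (g0 + G0) = (g0 + G0 - l) * (q * (a + d)) / q + l * (a + d * s * q\<^sup>2)"
    unfolding f0_def g0_def F0_def G0_def l_def using nz by (simp add: field_simps power2_eq_square)
  moreover have "4 * (a * d) - 2 * ((f0 + a) * (G0 + d) + (g0 + d) * (F0 + a))
     = - 2 * (f0 * G0 + g0 * F0 + (d * (f0 + F0) + a * (g0 + G0)))"
    by (simp add: algebra_simps)
  ultimately have e: "4 * (a * d) - 2 * ((f0 + a) * (G0 + d) + (g0 + d) * (F0 + a))
     = - 2 * (f0 * G0 + g0 * F0 + ((g0 + G0 - l) * (q * (a + d)) / q + l * (a + d * s * q\<^sup>2)))"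
    by (simp only:)
  have "- X\<^sup>2 * \<beta> * (4 * (a * d) - 2 * ((f0 + a) * (G0 + d) + (g0 + d) * (F0 + a)))
     = 2 * X\<^sup>2 * \<beta> * (f0 * G0 + g0 * F0 + ((g0 + G0 - l) * (q * (a + d)) / q + l * (a + d * s * q\<^sup>2)))"
    unfolding e by (simp only: mult_minus_left mult_minus_right minus_minus mult_ac)
  also have "\<dots> = 2 * (1 - k' * X\<^sup>2)\<^sup>2 * (1 / q + s * q) + quad1X X"
    unfolding a_d_linear unfolding f0_def g0_def F0_def G0_def l_def quad1X_def e1_def e3_def k'_def using nz
    by (simp add: field_simps power2_eq_square)
  finally show ?thesis by simp
qed

lemma circle_order: "f0 - F0 = (1 - s * q / \<beta>) * (1 / X - k' * X)"
  unfolding f0_def F0_def k'_def using nz by (simp add: field_simps)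

end

context
  fixes q X :: real
  assumes nz: "q \<noteq> 0" "X \<noteq> 0" "\<beta> \<noteq> 0"
begin
lemma circle_order':
  "(1 / (q * \<beta> * X) - K * \<alpha> / q + K * \<alpha> * \<beta> * X - 1) - (1 / X - 1) * (1 - K * \<alpha> * X / q)
   = (1 / (q * \<beta>) - 1) * (1 / X - k' * X)"
  unfolding k'_def using nz by (simp add: field_simps)

lemma circle_w:
  "(1 / X - 1) * (1 - K * s * \<alpha> * q * X) * (1 - q * \<beta>) + (1 / X - 1) * (1 - K * \<alpha> * X / q) * (q * \<beta> - s * q\<^sup>2)
   = (1 / X + k' * X - 1 - k') * den q"
  unfolding k'_def den_def using nz by (simp add: field_simps power2_eq_square)
end

end

text \<open>A nonnegative value with positive or negative derivative lies beyond both roots, so the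
  assumptions at \<open>0\<close> and \<open>M\<close> enclose the roots. As \<open>y\<close>
  decreases, the smaller solution belongs to the larger root. The quotient is the derivative at
  \<open>y 1\<close> over the root of the discriminant, and the constant cases of the density are
  those in which clipping acts.\<close>

lemma arccos_between_roots:
  fixes y :: "real \<Rightarrow> real" and M p u r :: real
  assumes cont: "continuous_on {0..M} y"
    and anti: "\<And>\<xi> \<eta>. 0 \<le> \<xi> \<Longrightarrow> \<xi> < \<eta> \<Longrightarrow> \<eta> \<le> M \<Longrightarrow> y \<eta> < y \<xi>"
    and M: "1 \<le> M" and p: "0 < p" and disc: "0 < u\<^sup>2 - 4 * p * r"
    and R0: "0 \<le> p * (y 0)\<^sup>2 + u * y 0 + r" "0 < 2 * p * y 0 + u"
    and RM: "0 \<le> p * (y M)\<^sup>2 + u * y M + r" "2 * p * y M + u < 0"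
  defines "S \<equiv> {\<xi>. 0 \<le> \<xi> \<and> \<xi> \<le> M \<and> p * (y \<xi>)\<^sup>2 + u * y \<xi> + r = 0}"
  shows "(if Inf S < Sup S \<and> Sup S \<le> 1 then 1 else if 1 \<le> Inf S \<and> Inf S < Sup S then 0
      else 1 / pi * arccos ((2 * y 1 - y (Inf S) - y (Sup S)) / \<bar>y (Inf S) - y (Sup S)\<bar>))
    = arccos (clip ((2 * p * y 1 + u) / sqrt (u\<^sup>2 - 4 * p * r))) / pi"
proof -
  define \<Delta> where "\<Delta> = sqrt (u\<^sup>2 - 4 * p * r)"
  have \<Delta>: "0 < \<Delta>" "\<Delta>\<^sup>2 = u\<^sup>2 - 4 * p * r" using disc by (simp_all add: \<Delta>_def)
  define ym yp where "ym = (- u - \<Delta>) / (2 * p)" and "yp = (- u + \<Delta>) / (2 * p)"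
  have pm: "2 * p * ym = - u - \<Delta>" and pp: "2 * p * yp = - u + \<Delta>"
    using p by (simp_all add: ym_def yp_def)
  have sq: "(2 * p * v + u)\<^sup>2 = \<Delta>\<^sup>2 + 4 * p * (p * v\<^sup>2 + u * v + r)" for v
    unfolding \<Delta>(2) by (simp add: algebra_simps power2_eq_square)
  have root: "p * v\<^sup>2 + u * v + r = 0 \<longleftrightarrow> v = ym \<or> v = yp" for v
  proof -
    have "p * v\<^sup>2 + u * v + r = 0 \<longleftrightarrow> (2 * p * v + u)\<^sup>2 = \<Delta>\<^sup>2" unfolding sq using p by simp
    also have "\<dots> \<longleftrightarrow> 2 * p * v + u = \<Delta> \<or> 2 * p * v + u = - \<Delta>" by (rule power2_eq_iff)
    also have "\<dots> \<longleftrightarrow> 2 * p * v = 2 * p * yp \<or> 2 * p * v = 2 * p * ym" unfolding pm pp by auto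
    also have "\<dots> \<longleftrightarrow> v = ym \<or> v = yp" using p by auto
    finally show ?thesis .
  qed
  have "\<Delta>\<^sup>2 \<le> (2 * p * y 0 + u)\<^sup>2" unfolding sq using R0(1) p by simp
  then have "\<Delta> \<le> 2 * p * y 0 + u" using R0(2) by (auto intro: power2_le_imp_le)
  then have "2 * p * yp \<le> 2 * p * y 0" unfolding pp by simp
  then have y0: "yp \<le> y 0" using p by simp
  have "\<Delta>\<^sup>2 \<le> (- (2 * p * y M + u))\<^sup>2" unfolding power2_minus sq using RM(1) p by simp
  then have "\<Delta> \<le> - (2 * p * y M + u)" by (rule power2_le_imp_le) (use RM(2) in simp)
  then have "2 * p * y M \<le> 2 * p * ym" unfolding pm by simp
  then have yM: "y M \<le> ym" using p by simp
  have "2 * p * ym < 2 * p * yp" unfolding pm pp using \<Delta>(1) by simp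
  then have less: "ym < yp" using p by simp
  obtain \<xi>1 where 1: "0 \<le> \<xi>1" "\<xi>1 \<le> M" "y \<xi>1 = yp"
    using IVT2'[of y M yp 0] cont y0 yM less M by auto
  obtain \<xi>2 where 2: "0 \<le> \<xi>2" "\<xi>2 \<le> M" "y \<xi>2 = ym"
    using IVT2'[of y M ym 0] cont y0 yM less M by auto
  have mono: "y \<eta> \<le> y \<xi>" if "0 \<le> \<xi>" "\<xi> \<le> \<eta>" "\<eta> \<le> M" for \<xi> \<eta>
    using anti[of \<xi> \<eta>] that by (cases "\<xi> = \<eta>") auto
  have lt: "\<xi>1 < \<xi>2"
    using mono[of \<xi>2 \<xi>1] 1 2 less by (cases "\<xi>1 < \<xi>2") auto
  have inj: "\<xi> = \<eta>" if "0 \<le> \<xi>" "\<xi> \<le> M" "0 \<le> \<eta>" "\<eta> \<le> M" "y \<xi> = y \<eta>" for \<xi> \<eta>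
    using anti[of \<xi> \<eta>] anti[of \<eta> \<xi>] that by (cases \<xi> \<eta> rule: linorder_cases) auto
  have S: "S = {\<xi>1, \<xi>2}"
  proof
    show "S \<subseteq> {\<xi>1, \<xi>2}"
    proof
      fix \<xi> assume "\<xi> \<in> S"
      then have "0 \<le> \<xi>" "\<xi> \<le> M" "y \<xi> = ym \<or> y \<xi> = yp" unfolding S_def root by simp_all
      then show "\<xi> \<in> {\<xi>1, \<xi>2}" using inj[of \<xi> \<xi>1] inj[of \<xi> \<xi>2] 1 2 by simp metis
    qed
    show "{\<xi>1, \<xi>2} \<subseteq> S" unfolding S_def root using 1 2 by simp
  qed
  have I: "Inf S = \<xi>1" unfolding S by (rule cInf_eq_minimum) (use lt in auto)
  have U: "Sup S = \<xi>2" unfolding S by (rule cSup_eq_maximum) (use lt in auto)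
  define v where "v = (2 * p * y 1 + u) / \<Delta>"
  have ratio: "(2 * y 1 - y \<xi>1 - y \<xi>2) / \<bar>y \<xi>1 - y \<xi>2\<bar> = v"
  proof -
    have "2 * p * (yp - ym) = 2 * \<Delta>" using pm pp by (simp add: right_diff_distrib)
    then have "\<bar>yp - ym\<bar> = \<Delta> / p" using less p by (simp add: field_simps)
    moreover have "2 * y 1 - yp - ym = (2 * p * y 1 + u) / p"
      using pm pp p by (simp add: field_simps)
    ultimately show ?thesis unfolding 1(3) 2(3) v_def using p by simp
  qed
  have v1: "v \<le> -1 \<longleftrightarrow> y 1 \<le> ym" and v2: "1 \<le> v \<longleftrightarrow> yp \<le> y 1"
  proof -
    have "v \<le> -1 \<longleftrightarrow> 2 * p * y 1 \<le> 2 * p * ym"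
      unfolding pm v_def pos_divide_le_eq[OF \<Delta>(1)] by (rule iffI; linarith)
    then show "v \<le> -1 \<longleftrightarrow> y 1 \<le> ym" using p by simp
    have "1 \<le> v \<longleftrightarrow> 2 * p * yp \<le> 2 * p * y 1"
      unfolding pp v_def pos_le_divide_eq[OF \<Delta>(1)] by (rule iffI; linarith)
    then show "1 \<le> v \<longleftrightarrow> yp \<le> y 1" using p by simp
  qed
  consider "\<xi>2 \<le> 1" | "1 \<le> \<xi>1" | "\<xi>1 < 1" "1 < \<xi>2" by linarith
  then have "(if \<xi>1 < \<xi>2 \<and> \<xi>2 \<le> 1 then 1 else if 1 \<le> \<xi>1 \<and> \<xi>1 < \<xi>2 then 0 else 1 / pi * arccos v)
      = arccos (clip v) / pi" (is ?goal)
  proof cases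
    case 1
    then have "v \<le> -1" unfolding v1 using mono[of \<xi>2 1] 2 M by simp
    then show ?goal using lt 1 by (simp add: clip_le)
  next
    case 2
    then have "1 \<le> v" unfolding v2 using mono[of 1 \<xi>1] 1 by simp
    then show ?goal using lt 2 by (simp add: clip_ge)
  next
    case 3
    then have "y 1 < yp" "ym < y 1" using anti[of \<xi>1 1] anti[of 1 \<xi>2] 1 2 by auto
    then have "\<bar>v\<bar> \<le> 1" using v1 v2 by linarith
    then show ?goal using lt 3 by (simp add: clip_id)
  qed
  then show ?thesis unfolding I U ratio \<Delta>_def[symmetric] v_def[symmetric] .
qed

section \<open>The rescaled hexagon\<close>

lemma prod_pos4: "0 < u1 \<Longrightarrow> 0 < u2 \<Longrightarrow> 0 < u3 \<Longrightarrow> 0 < u4 \<Longrightarrow> 0 < u1 * u2 * u3 * (u4 :: real)"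
  by simp

lemma prod_pos6: "0 < u1 \<Longrightarrow> 0 < u2 \<Longrightarrow> 0 < u3 \<Longrightarrow> 0 < u4 \<Longrightarrow> 0 < u5 \<Longrightarrow> 0 < u6 \<Longrightarrow>
    0 < u1 * u2 * u3 * u4 * u5 * (u6 :: real)"
  by simp

lemma sign_product4:
  fixes L m u1 u2 u3 u4 :: real
  shows "- (L * u1) * (L * u2) * (m * u3) * (m * u4) = L * L * (m * m) * - (u1 * u2 * u3 * u4)"
  by simp

lemma sign_product4':
  fixes L m u1 u2 u3 u4 :: real
  shows "r * p * - (L * u1) * (L * u2) * (m * u3) * (m * u4) = L * L * (m * m) * - (r * (p * u1) * u2 * u3 * u4)"
  by simp

lemma sign_product6:
  fixes L m u1 u2 u3 u4 u5 u6 :: real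
  shows "L * u1 * (L * u2) * (m * u3) * - (L * u4) * (L * u5) * (m * u6)
    = (L * L)\<^sup>2 * (m * m) * (u1 * u2 * u3 * - u4 * u5 * u6)"
  by (simp add: power2_eq_square)

lemma quotient_product:
  fixes x1 x2 x3 x4 x5 y r v w :: real
  shows "x1 * x2 * x3 / w * (x4 * x5 * r * y / (v * w)) = x1 * x2 * x3 * x4 * x5 * (y / v) * r / w\<^sup>2"
  by (simp add: power2_eq_square mult_ac)

locale tiling =
  fixes b c q :: real and \<kappa> :: complex
  assumes adm: "admissible b c q \<kappa>"
begin

lemma pos: "0 < b" "0 < c" "0 < q" "q \<noteq> 1"
  using adm by (auto simp: admissible_def)

definition k :: real where "k = ksq \<kappa>"
text \<open>
  \<open>kap\<close> is the common sign of all factors \<open>1 - \<kappa>\<^sup>2 q\<^sup>e\<close> that occur, and \<open>ori\<close> is \<open>1\<close> or \<open>-1\<close> according to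
  whether \<open>\<mu>\<close> decreases or increases in \<open>x\<close>.
\<close>

definition L :: real where "L = sgn (ln q)"
definition kap :: real where "kap = (if upper_branch b c q \<kappa> then -1 else 1)"
definition ori :: real where "ori = kap * L"

lemma L_sq: "L * L = 1" and L_cases: "q < 1 \<Longrightarrow> L = -1" "1 < q \<Longrightarrow> L = 1"
  using pos by (auto simp: L_def sgn_if)
lemma kap_sq: "kap * kap = 1" by (simp add: kap_def)
lemma ori_sq: "ori * ori = 1"
  using L_sq kap_sq unfolding ori_def by algebra

text \<open>The factor \<open>L\<close> allows \<open>q < 1\<close> and \<open>1 < q\<close> to be
  treated at once.\<close>

lemma powr_sign:
  "a < 0 \<Longrightarrow> 0 < L * (1 - q powr a)" "0 < a \<Longrightarrow> L * (1 - q powr a) < 0"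
  "a \<le> 0 \<Longrightarrow> 0 \<le> L * (1 - q powr a)" "0 \<le> a \<Longrightarrow> L * (1 - q powr a) \<le> 0"
proof -
  have q: "q powr a = exp (a * ln q)" using pos by (simp add: powr_def)
  have "(a < 0 \<longrightarrow> 0 < L * (1 - q powr a)) \<and> (0 < a \<longrightarrow> L * (1 - q powr a) < 0)"
  proof (cases "1 < q")
    case True
    then have "0 < ln q" "L = 1" using L_cases by simp_all
    then show ?thesis unfolding q by (simp add: mult_neg_pos)
  next
    case False
    then have "q < 1" using pos by simp
    then have "ln q < 0" "L = -1" using L_cases pos by simp_all
    then show ?thesis unfolding q by (simp add: mult_neg_neg mult_pos_neg)
  qed
  then show "a < 0 \<Longrightarrow> 0 < L * (1 - q powr a)" "0 < a \<Longrightarrow> L * (1 - q powr a) < 0" by blast+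
  then show "a \<le> 0 \<Longrightarrow> 0 \<le> L * (1 - q powr a)" "0 \<le> a \<Longrightarrow> L * (1 - q powr a) \<le> 0"
    using pos by (cases "a = 0"; simp)+
qed

text \<open>Squaring moves the ends of the excluded interval to \<open>q^(-2)\<close> and
  \<open>q^(b+c)\<close>. Imaginary \<kappa> have \<open>k \<le> 0\<close> and count as lying below
  it.\<close>

lemma k_bounds:
  "\<not> upper_branch b c q \<kappa> \<Longrightarrow> k \<le> q powr (-2) \<and> k \<le> q powr (b + c)"
  "upper_branch b c q \<kappa> \<Longrightarrow> q powr (-2) \<le> k \<and> q powr (b + c) \<le> k"
proof -
  have sq: "(1 / q)\<^sup>2 = q powr (-2)" "(q powr ((b + c) / 2))\<^sup>2 = q powr (b + c)"
    using pos(3) by (simp_all add: powr_minus_divide power_divide power2_eq_square flip: powr_add)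
  have k: "Im \<kappa> = 0 \<Longrightarrow> k = (cmod \<kappa>)\<^sup>2" "Re \<kappa> = 0 \<Longrightarrow> k \<le> 0"
    by (auto simp: k_def ksq_def cmod_def power2_eq_square)
  show "k \<le> q powr (-2) \<and> k \<le> q powr (b + c)" if u: "\<not> upper_branch b c q \<kappa>"
  proof (cases "Re \<kappa> = 0")
    case True
    then show ?thesis using k(2) powr_ge_zero[of q] by (meson order_trans)
  next
    case False
    then have i: "Im \<kappa> = 0" "cmod \<kappa> \<notin> {min (1/q) (q powr ((b+c)/2)) <..< max (1/q) (q powr ((b+c)/2))}"
      using adm by (auto simp: admissible_def)
    then have "cmod \<kappa> \<le> 1 / q" "cmod \<kappa> \<le> q powr ((b+c)/2)"
      using u unfolding upper_branch_def by auto
    then show ?thesis unfolding k(1)[OF i(1)] sq[symmetric] by (auto intro: power_mono)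
  qed
  show "q powr (-2) \<le> k \<and> q powr (b + c) \<le> k" if u: "upper_branch b c q \<kappa>"
  proof -
    have i: "Im \<kappa> = 0" "1 / q \<le> cmod \<kappa>" "q powr ((b+c)/2) \<le> cmod \<kappa>"
      using u unfolding upper_branch_def by auto
    then show ?thesis unfolding k(1)[OF i(1)] sq[symmetric] using pos(3) by (auto intro!: power_mono)
  qed
qed

text \<open>For these exponents \<open>q powr (e - 2)\<close> and
  \<open>q powr (e + (b + c))\<close> lie on opposite sides of 1, and \<open>k * q powr e\<close> is
  at most the smaller or at least the larger of them. At the extreme exponents the factor vanishes
  when \<open>k\<close> is \<open>q^(-2)\<close> or \<open>q^(b+c)\<close>.\<close>

lemma kfac_nonneg: "- (b + c) \<le> e \<Longrightarrow> e \<le> 2 \<Longrightarrow> 0 \<le> kap * (1 - k * q powr e)"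
  and kfac_pos: "- (b + c) < e \<Longrightarrow> e < 2 \<Longrightarrow> 0 < kap * (1 - k * q powr e)"
proof -
  have m: "q powr (-2) * q powr e = q powr (e - 2)" "q powr (b + c) * q powr e = q powr (e + (b + c))"
    by (simp_all add: algebra_simps flip: powr_add)
  have lo: "k * q powr e \<le> q powr (e - 2)" "k * q powr e \<le> q powr (e + (b + c))" if "\<not> upper_branch b c q \<kappa>"
    using k_bounds(1)[OF that] unfolding m[symmetric] by (auto intro: mult_right_mono)
  have hi: "q powr (e - 2) \<le> k * q powr e" "q powr (e + (b + c)) \<le> k * q powr e" if "upper_branch b c q \<kappa>"
    using k_bounds(2)[OF that] unfolding m[symmetric] by (auto intro: mult_right_mono)
  show "0 \<le> kap * (1 - k * q powr e)" if "- (b + c) \<le> e" "e \<le> 2"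
  proof -
    have 1: "0 \<le> L * (1 - q powr (e - 2))" "L * (1 - q powr (e + (b + c))) \<le> 0"
      by (rule powr_sign; use that in simp)+
    show ?thesis
    proof (cases "1 < q")
      case True
      then show ?thesis using 1 L_cases lo hi by (auto simp: kap_def)
    next
      case False
      then have "q < 1" using pos by simp
      then show ?thesis using 1 L_cases lo hi by (auto simp: kap_def)
    qed
  qed
  show "0 < kap * (1 - k * q powr e)" if "- (b + c) < e" "e < 2"
  proof -
    have 1: "0 < L * (1 - q powr (e - 2))" "L * (1 - q powr (e + (b + c))) < 0"
      by (rule powr_sign; use that in simp)+
    show ?thesis
    proof (cases "1 < q")
      case True
      then show ?thesis using 1 L_cases lo hi by (force simp: kap_def)
    next
      case False
      then have "q < 1" using pos by simp
      then show ?thesis using 1 L_cases lo hi by (force simp: kap_def)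
    qed
  qed
qed

section \<open>The circles of the q-Racah weight and their invariants\<close>

definition \<alpha> :: real where "\<alpha> = q powr (- c - 1)"
definition \<alpha>' :: real where "\<alpha>' = q powr (- b - 1)"
definition K :: real where "K = k * q powr 2"
definition \<beta> :: "real \<Rightarrow> real" where "\<beta> t = q powr (- t - 1)"

abbreviation s :: real where "s \<equiv> racah.s \<alpha> \<alpha>'"
abbreviation W :: real where "W \<equiv> racah.den \<alpha> \<alpha>' q"

definition a :: real where "a = (1 - \<alpha> * q) * (1 - s * q) * (1 - K * s * q) / W"
definition d :: real where "d = (1 - q) * (1 - \<alpha>' * q) * \<alpha> * (K - q) / (q * W)"
definition \<sigma> :: real where "\<sigma> = sqrt (a * d)"
text \<open>With \<open>X = q^x\<close> one has
  \<open>\<mu> - 1 - k' = (1 / X - 1) * (1 - k' * X)\<close>, which is affine in \<beta> for fixed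
  \<open>x\<close>. Its values at \<open>\<beta> = s * q\<close> and \<open>\<beta> = 1 / q\<close>,
  the zeros of the \<open>t\<close>-dependent factors of C(1;t) and A(1;t), are \<open>f0\<close>
  and \<open>g0\<close>. Holding \<open>\<beta> * X\<close> fixed instead gives \<open>F0\<close>
  and \<open>G0\<close>.\<close>

definition f0 :: "real \<Rightarrow> real" where
  "f0 x = (1 / q powr x - 1) * (1 - K * s * \<alpha> * q * q powr x)"
definition g0 :: "real \<Rightarrow> real" where
  "g0 x = (1 / q powr x - 1) * (1 - K * \<alpha> * q powr x / q)"
definition F0 :: "real \<Rightarrow> real" where
  "F0 v = s * q / q powr (v - 1) - K * s * \<alpha> * q + K * \<alpha> * q powr (v - 1) - 1"
definition G0 :: "real \<Rightarrow> real" where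
  "G0 v = 1 / (q * q powr (v - 1)) - K * \<alpha> / q + K * \<alpha> * q powr (v - 1) - 1"
definition f :: "real \<Rightarrow> real" where "f x = ori * (f0 x + a) / (2 * \<sigma>)"
definition g :: "real \<Rightarrow> real" where "g x = ori * (g0 x + d) / (2 * \<sigma>)"
definition F :: "real \<Rightarrow> real" where "F v = ori * (F0 v + a) / (2 * \<sigma>)"
definition G :: "real \<Rightarrow> real" where "G v = ori * (G0 v + d) / (2 * \<sigma>)"

lemma positive: "0 < \<alpha>" "0 < \<alpha>'" "0 < \<beta> t" "0 < q powr x" "0 < s"
  using pos by (simp_all add: \<alpha>_def \<alpha>'_def \<beta>_def racah.s_def)

lemma q_inj: "q powr u = q powr v \<longleftrightarrow> u = v"
  using pos by (simp add: powr_inj)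

lemma q_collect:
  "q powr u * q = q powr (u + 1)" "q * q powr u = q powr (u + 1)"
  "q powr u * q\<^sup>2 = q powr (u + 2)" "(q powr u)\<^sup>2 = q powr (u + u)" (is ?g1)
proof -
  show ?g1 by (simp only: powr_add power2_eq_square)
qed (use pos in \<open>simp_all add: powr_add\<close>)

lemma exponents:
  "\<alpha> * q = q powr (- c)" "\<alpha>' * q = q powr (- b)" "s * q = q powr (- b - c - 1)"
  "s * q\<^sup>2 = q powr (- b - c)" "K * s * q = k * q powr (1 - b - c)"
  "q * \<beta> t = q powr (- t)"
  "\<alpha> * q powr x = q powr (x - c - 1)" "\<beta> t * q powr x = q powr (x - t - 1)"
  "K * \<alpha> * q powr x = k * q powr (1 - c + x)"
  "K * \<beta> t * q powr x = k * q powr (1 - t + x)"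
  "K * s * q powr x = k * q powr (x - b - c)"
  "K * \<alpha> * \<beta> t * q powr x = k * q powr (x - t - c)"
  "K * \<alpha> * \<beta> t * (q powr x)\<^sup>2 = k * q powr (2 * x - t - c)"
  "\<alpha>' - q powr x * \<beta> t = \<alpha>' * (1 - q powr (x - t + b))"
  "K * \<alpha> * q powr (v - 1) = k * q powr (v - c)"
  "K * q powr (v - 1) = k * q powr (v + 1)"
  "\<alpha>' - q powr (v - 1) = \<alpha>' * (1 - q powr (v + b))"
  unfolding \<alpha>_def \<alpha>'_def \<beta>_def K_def racah.s_def
  by (simp_all only: mult.assoc q_collect powr_add[symmetric] right_diff_distrib mult_1_right)
    (simp_all add: q_inj algebra_simps)

lemma K_eq: "K = q * (k * q powr 1)"
  using pos by (simp add: K_def power2_eq_square)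

lemma W_eq: "W = 1 - q powr (- b - c)"
  unfolding racah.den_def exponents ..

lemma W_sign: "0 < L * W"
  unfolding W_eq by (rule powr_sign) (use pos in simp)

lemma W_nz: "W \<noteq> 0" using W_sign by auto

text \<open>Four factors carry the sign \<open>L\<close> and two the sign \<open>kap\<close>. The
  two reversed signs, in \<open>1 - q\<close> and in \<open>K - q = - q * (1 - k * q)\<close>,
  cancel.\<close>

lemma ad_pos: "0 < a * d"
proof -
  have 1: "0 < L * (1 - q powr (- c))" "0 < L * (1 - q powr (- b - c - 1))"
    "0 < kap * (1 - k * q powr (1 - b - c))" "L * (1 - q powr 1) < 0" "0 < L * (1 - q powr (- b))"
    "0 < kap * (1 - k * q powr 1)"
    by (rule powr_sign(1,2) kfac_pos; use pos in simp)+
  have "0 < (L * (1 - q powr (- c))) * (L * (1 - q powr (- b - c - 1))) * (kap * (1 - k * q powr (1 - b - c)))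
     * (- (L * (1 - q powr 1))) * (L * (1 - q powr (- b))) * (kap * (1 - k * q powr 1))" (is "0 < ?p")
    by (rule prod_pos6; use 1 in \<open>simp only: neg_0_less_iff_less\<close>)
  moreover have "a * d = ?p * \<alpha> / W\<^sup>2"
  proof -
    have "?p = (L * L)\<^sup>2 * (kap * kap) * ((1 - q powr (- c)) * (1 - q powr (- b - c - 1)) * (1 - k * q powr (1 - b - c))
     * (- (1 - q powr 1)) * (1 - q powr (- b)) * (1 - k * q powr 1))"
      by (rule sign_product6)
    also have "\<dots> = (1 - \<alpha> * q) * (1 - s * q) * (1 - K * s * q)
     * (1 - q) * (1 - \<alpha>' * q) * ((K - q) / q)"
      unfolding L_sq kap_sq exponents(1-5) using pos K_eq by (simp add: field_simps)
    finally have p: "?p = (1 - \<alpha> * q) * (1 - s * q) * (1 - K * s * q)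
     * (1 - q) * (1 - \<alpha>' * q) * ((K - q) / q)" .
    show ?thesis unfolding p unfolding a_def d_def by (rule quotient_product)
  qed
  moreover have "0 < r" if "0 < P" "r = P * \<alpha> / W\<^sup>2" for P r
    using that positive(1) W_nz by simp
  ultimately show ?thesis by blast
qed

lemma ad_nz: "a \<noteq> 0" "d \<noteq> 0" using ad_pos by auto

lemma sigma: "0 < \<sigma>" "\<sigma>\<^sup>2 = a * d"
  using ad_pos by (simp_all add: \<sigma>_def)

lemma times_ori: "(ori * u / (2 * \<sigma>)) * (ori * v / (2 * \<sigma>)) = u * v / (4 * (a * d))"
proof -
  have "(ori * u / (2 * \<sigma>)) * (ori * v / (2 * \<sigma>)) = (ori * ori) * (u * v) / (4 * \<sigma>\<^sup>2)"
    by (simp add: power2_eq_square mult_ac)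
  then show ?thesis by (simp add: ori_sq sigma(2))
qed

abbreviation MX :: "real \<Rightarrow> real" where "MX \<equiv> racah.MX \<alpha> \<alpha>' K"
abbreviation MU :: "real \<Rightarrow> real \<Rightarrow> real" where "MU y \<equiv> racah.MU \<alpha> \<alpha>' y K"

lemma fg_eq: "1 - 4 * f x * g x = MX (q powr x) / ((q powr x)\<^sup>2 * (a * d))"
proof -
  have "a * d - (f0 x + a) * (g0 x + d) = MX (q powr x) / (q powr x)\<^sup>2"
    unfolding f0_def g0_def a_def d_def
    \<comment> \<open>This identity is free of \<beta>, so the value 1 is arbitrary.\<close>
    by (rule racah.circle_X[where \<beta> = 1]) (use pos W_nz in simp_all)
  moreover have "1 - 4 * f x * g x = (a * d - (f0 x + a) * (g0 x + d)) / (a * d)"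
  proof -
    have "4 * f x * g x = (f0 x + a) * (g0 x + d) / (a * d)"
      unfolding f_def g_def mult.assoc times_ori by simp
    then show ?thesis using ad_nz by (simp add: diff_divide_distrib)
  qed
  ultimately show ?thesis by simp
qed

lemma FG_eq: "1 - 4 * F v * G v = MU (q powr (v - 1)) 1 / ((q powr (v - 1))\<^sup>2 * (a * d))"
proof -
  have "a * d - (F0 v + a) * (G0 v + d) = MU (q powr (v - 1)) 1 / (q powr (v - 1))\<^sup>2"
    \<comment> \<open>Here \<beta> and \<open>X\<close> enter only through their product
      \<open>q powr (v - 1)\<close>, which may be assigned to \<beta> alone.\<close>
    using racah.circle_U[where \<beta> = "q powr (v - 1)" and X = 1 and \<alpha> = \<alpha> and \<alpha>' = \<alpha>' and K = K and q = q]
      pos W_nz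
    by (simp add: F0_def G0_def a_def d_def)
  moreover have "1 - 4 * F v * G v = (a * d - (F0 v + a) * (G0 v + d)) / (a * d)"
  proof -
    have "4 * F v * G v = (F0 v + a) * (G0 v + d) / (a * d)"
      unfolding F_def G_def mult.assoc times_ori by simp
    then show ?thesis using ad_nz by (simp add: diff_divide_distrib)
  qed
  ultimately show ?thesis by simp
qed

lemma MX_pos:
  assumes "0 < x" "x < 1 + c" shows "0 < MX (q powr x)"
proof -
  have 1: "L * (1 - q powr x) < 0" "0 < L * (1 - q powr (x - c - 1))"
    "0 < kap * (1 - k * q powr (x - b - c))" "0 < kap * (1 - k * q powr (1 - c + x))"
    by (rule powr_sign(1,2) kfac_pos; use pos assms in simp)+
  have "0 < (- (L * (1 - q powr x))) * (L * (1 - q powr (x - c - 1))) * (kap * (1 - k * q powr (x - b - c)))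
      * (kap * (1 - k * q powr (1 - c + x)))"
    by (rule prod_pos4; use 1 in \<open>simp only: neg_0_less_iff_less\<close>)
  also have "\<dots> = (L * L) * (kap * kap) * MX (q powr x)"
    unfolding racah.MX_def exponents by (rule sign_product4)
  finally show ?thesis by (simp add: L_sq kap_sq)
qed

lemma MU_pos:
  assumes "- b < v" "v < 1" shows "0 < MU (q powr (v - 1)) 1"
proof -
  have e: "1 - c + (v - 1) = v - c" by simp
  have 1: "L * (1 - q powr (v + b)) < 0" "0 < L * (1 - q powr (v - 1))"
    "0 < kap * (1 - k * q powr (v - c))" "0 < kap * (1 - k * q powr (v + 1))"
    by (rule powr_sign(1,2) kfac_pos; use pos assms in simp)+
  have "0 < \<alpha> * \<alpha>' * (- (L * (1 - q powr (v + b)))) * (L * (1 - q powr (v - 1))) * (kap * (1 - k * q powr (v - c)))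
      * (kap * (1 - k * q powr (v + 1)))"
    by (rule prod_pos6; use 1 positive in \<open>simp only: neg_0_less_iff_less\<close>)
  also have "\<dots> = (L * L) * (kap * kap) * MU (q powr (v - 1)) 1"
    unfolding racah.MU_def racah.k'_def mult_1 mult_1_right exponents e by (rule sign_product4')
  finally show ?thesis by (simp add: L_sq kap_sq)
qed

section \<open>The time change and the web identity\<close>

definition tau' :: "real \<Rightarrow> real" where
  "tau' t = ln q / 2 * (q powr t / (q powr t - 1) + q powr (t - b - c) / (1 - q powr (t - b - c)))"

lemma E_factors:
  assumes "0 < t" "t < b + c"
  shows "0 < L * (q powr t - 1)" "0 < L * (1 - q powr (t - b - c))" (is ?g1)
proof -
  have "L * (1 - q powr t) < 0" by (rule powr_sign(2)[OF assms(1)])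
  then show "0 < L * (q powr t - 1)" by (simp add: algebra_simps)
  show ?g1 by (rule powr_sign(1)) (use assms in simp)
qed

lemma exp_tau:
  assumes "0 < t" "t < b + c"
  shows "(exp (tau b c q t))\<^sup>2 * (1 - q powr (t - b - c)) = q powr t - 1"
proof -
  note E = E_factors[OF assms]
  have "0 < (L * (q powr t - 1)) / (L * (1 - q powr (t - b - c)))" using E by (rule divide_pos_pos)
  then have p: "0 < (q powr t - 1) / (1 - q powr (t - b - c))"
    using L_sq by (subst (asm) mult_divide_mult_cancel_left) auto
  have "(exp (tau b c q t))\<^sup>2 = exp (2 * tau b c q t)" by (rule exp_double[symmetric])
  also have "\<dots> = (q powr t - 1) / (1 - q powr (t - b - c))"
    unfolding tau_def abs_of_pos[OF p] using p by simp
  finally show ?thesis using E by auto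
qed

lemma DERIV_q: "((\<lambda>x. q powr x) has_real_derivative q powr x * ln q) (at x)"
  unfolding powr_def using pos by (auto intro!: derivative_eq_intros)

lemma DERIV_q_shift: "((\<lambda>x. q powr (x - e)) has_real_derivative q powr (x - e) * ln q) (at x)"
  by (rule DERIV_shift(1)[OF DERIV_q])

lemma tau_eq:
  assumes "0 < t" "t < b + c"
  shows "tau b c q t = 1 / 2 * (ln (L * (q powr t - 1)) - ln (L * (1 - q powr (t - (b + c)))))"
proof -
  note E = E_factors[OF assms, unfolded diff_diff_eq]
  have "\<bar>(q powr t - 1) / (1 - q powr (t - (b + c)))\<bar> = L * (q powr t - 1) / (L * (1 - q powr (t - (b + c))))"
  proof -
    have "L * (q powr t - 1) / (L * (1 - q powr (t - (b + c)))) = (q powr t - 1) / (1 - q powr (t - (b + c)))"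
      using L_sq by (intro mult_divide_mult_cancel_left) auto
    moreover have "0 < L * (q powr t - 1) / (L * (1 - q powr (t - (b + c))))"
      using E by (rule divide_pos_pos)
    ultimately show ?thesis by (metis abs_of_pos)
  qed
  then show ?thesis unfolding tau_def diff_diff_eq using ln_divide_pos[OF E] by simp
qed

lemma DERIV_tau:
  assumes "0 < t" "t < b + c"
  shows "(tau b c q has_real_derivative tau' t) (at t)"
proof -
  note E = E_factors[OF assms, unfolded diff_diff_eq]
  have L: "L \<noteq> 0" using L_sq by auto
  have d1: "((\<lambda>t. L * (q powr t - 1)) has_real_derivative L * (q powr t * ln q)) (at t)"
    by (rule DERIV_cong[OF DERIV_cmult[OF DERIV_diff[OF DERIV_q DERIV_const]]]) simp
  have d2: "((\<lambda>t. L * (1 - q powr (t - (b + c)))) has_real_derivative - (L * (q powr (t - (b + c)) * ln q))) (at t)"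
    by (rule DERIV_cong[OF DERIV_cmult[OF DERIV_diff[OF DERIV_const DERIV_q_shift]]]) simp
  have "((\<lambda>t. 1 / 2 * (ln (L * (q powr t - 1)) - ln (L * (1 - q powr (t - (b + c))))))
     has_real_derivative tau' t) (at t)"
  proof (rule DERIV_cong[OF DERIV_cmult[OF DERIV_diff[OF DERIV_chain2[OF DERIV_ln[OF E(1)] d1]
      DERIV_chain2[OF DERIV_ln[OF E(2)] d2]]]])
    have c: "inverse (L * u) * (L * v) = v / u" for u v using L by (simp add: field_simps)
    show "1 / 2 * (inverse (L * (q powr t - 1)) * (L * (q powr t * ln q))
       - inverse (L * (1 - q powr (t - (b + c)))) * - (L * (q powr (t - (b + c)) * ln q))) = tau' t"
      unfolding mult_minus_right c tau'_def diff_diff_eq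
      by (simp only: diff_minus_eq_add distrib_left times_divide_eq_left times_divide_eq_right mult_1 mult.commute mult.left_commute)
  qed
  then show ?thesis
    by (rule has_field_derivative_transform_within_open[of _ _ _ "{0<..<b+c}"])
      (use assms tau_eq in auto)
qed

lemma tau'_pos:
  assumes "0 < t" "t < b + c"
  shows "0 < tau' t"
proof -
  note E = E_factors[OF assms]
  have lnq: "ln q = L * \<bar>ln q\<bar>" "0 < \<bar>ln q\<bar>" using pos by (simp_all add: L_def sgn_mult_abs)
  have S: "q powr (t - b - c) = q powr t * q powr (- b - c)"
    unfolding powr_add[symmetric] by (rule arg_cong[where f = "\<lambda>u. q powr u"]) simp
  have nz: "q powr t - 1 \<noteq> 0" "1 - q powr (t - b - c) \<noteq> 0" using E by auto
  have "tau' t = ln q / 2 * (q powr t - q powr (t - b - c)) / ((q powr t - 1) * (1 - q powr (t - b - c)))"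
    unfolding tau'_def using nz by (simp add: divide_simps) (simp add: algebra_simps)
  also have "q powr t - q powr (t - b - c) = q powr t * W" unfolding W_eq S by (simp add: algebra_simps)
  also have "ln q / 2 * (q powr t * W) / ((q powr t - 1) * (1 - q powr (t - b - c)))
     = (\<bar>ln q\<bar> / 2 * q powr t * (L * W)) / ((L * (q powr t - 1)) * (L * (1 - q powr (t - b - c))))"
  proof -
    have "(L * (q powr t - 1)) * (L * (1 - q powr (t - b - c))) = (L * L) * ((q powr t - 1) * (1 - q powr (t - b - c)))"
      by (simp only: mult_ac)
    moreover have "ln q / 2 * (q powr t * W) = \<bar>ln q\<bar> / 2 * q powr t * (L * W)"
      by (subst lnq(1)) (simp only: mult_ac times_divide_eq_left times_divide_eq_right)
    ultimately show ?thesis unfolding L_sq mult_1 by (simp only:)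
  qed
  also have "0 < \<dots>"
    by (intro divide_pos_pos mult_pos_pos lnq W_sign positive E) simp
  finally show ?thesis .
qed

lemma cont_q: "continuous_on S h \<Longrightarrow> continuous_on S (\<lambda>p. q powr h p)"
  using pos by (intro continuous_on_powr continuous_on_const) auto

text \<open>The common last factor is the \<open>x\<close>-derivative of \<mu> divided by
  \<open>- ln q\<close>; its sign gives the order of \<open>f\<close> and \<open>F\<close>. The
  quotient of the two differences is \<open>exp (2 * \<tau>)\<close>, which is the web
  identity.\<close>

lemma order_identities:
  "f0 x - F0 (x - t) = (1 - q powr (t - b - c)) * (1 / q powr x * (1 - k * q powr (2 * x - t - c)))" (is ?g1)
  "G0 (x - t) - g0 x = (q powr t - 1) * (1 / q powr x * (1 - k * q powr (2 * x - t - c)))" (is ?g2)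
proof -
  have nz: "q \<noteq> 0" "q powr x \<noteq> 0" "\<beta> t \<noteq> 0" using pos positive(3)[of t] by auto
  have y: "q powr (x - t - 1) = \<beta> t * q powr x" by (rule exponents(8)[symmetric])
  have S: "s * q / \<beta> t = q powr (t - b - c)"
    unfolding exponents \<beta>_def powr_diff[symmetric] by (rule arg_cong[where f = "\<lambda>u. q powr u"]) simp
  have T: "1 / (q * \<beta> t) = q powr t" unfolding exponents by (simp add: powr_minus divide_inverse)
  have X: "1 / q powr x - racah.k' \<alpha> (\<beta> t) K * q powr x = 1 / q powr x * (1 - k * q powr (2 * x - t - c))"
    unfolding exponents(13)[symmetric] racah.k'_def using nz by (simp add: field_simps power2_eq_square)
  show ?g1 unfolding X[symmetric] S[symmetric] f0_def F0_def y
    using racah.circle_order[OF nz W_nz, of K, unfolded mult.assoc] by (simp only: mult.assoc)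
  show ?g2 unfolding X[symmetric] T[symmetric] g0_def G0_def y
    using racah.circle_order'[OF nz, of K \<alpha>, unfolded mult.assoc] by (simp only: mult.assoc)
qed

definition f' :: "real \<Rightarrow> real" where
  "f' x = ori * ((- ln q / q powr x) * (1 - K * s * \<alpha> * q * q powr x)
     - (1 / q powr x - 1) * (K * s * \<alpha> * q * (q powr x * ln q))) / (2 * \<sigma>)"
definition g' :: "real \<Rightarrow> real" where
  "g' x = ori * ((- ln q / q powr x) * (1 - K * \<alpha> * q powr x / q)
     - (1 / q powr x - 1) * (K * \<alpha> * (q powr x * ln q) / q)) / (2 * \<sigma>)"
definition F' :: "real \<Rightarrow> real" where
  "F' v = ori * (K * \<alpha> * (q powr (v - 1) * ln q) - s * q * ln q / q powr (v - 1)) / (2 * \<sigma>)"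
definition G' :: "real \<Rightarrow> real" where
  "G' v = ori * (K * \<alpha> * (q powr (v - 1) * ln q) - ln q / (q * q powr (v - 1))) / (2 * \<sigma>)"

lemma DERIV_fgFG:
  "(f has_real_derivative f' x) (at x)" (is ?g1) "(g has_real_derivative g' x) (at x)" (is ?g2)
  "(F has_real_derivative F' x) (at x)" (is ?g3) "(G has_real_derivative G' x) (at x)" (is ?g4)
proof -
  have q: "q powr u \<noteq> 0" for u using pos by simp
  have i: "((\<lambda>x. 1 / q powr x) has_real_derivative - ln q / q powr x) (at x)" for x
    by (rule DERIV_cong[OF DERIV_divide[OF DERIV_const DERIV_q q]]) (use q[of x] in \<open>simp add: field_simps\<close>)
  have j: "((\<lambda>x. 1 / q powr (x - 1)) has_real_derivative - ln q / q powr (x - 1)) (at x)" for x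
    by (rule DERIV_shift(1)[OF i])
  have h: "((\<lambda>x. ori * (h x + e) / (2 * \<sigma>)) has_real_derivative ori * h' / (2 * \<sigma>)) (at x)"
    if "(h has_real_derivative h') (at x)" for h h' e
    by (rule DERIV_cong[OF DERIV_cdivide[OF DERIV_cmult[OF DERIV_add[OF that DERIV_const]]]]) simp
  show ?g1 unfolding f_def[abs_def] f'_def f0_def
    by (rule h, rule DERIV_cong[OF DERIV_mult[OF DERIV_diff[OF i DERIV_const]
            DERIV_diff[OF DERIV_const DERIV_cmult[OF DERIV_q]]]]) (simp add: algebra_simps)
  show ?g2 unfolding g_def[abs_def] g'_def g0_def
    by (rule h, rule DERIV_cong[OF DERIV_mult[OF DERIV_diff[OF i DERIV_const]
            DERIV_diff[OF DERIV_const DERIV_cdivide[OF DERIV_cmult[OF DERIV_q]]]]]) (simp add: algebra_simps)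
  have F0: "F0 = (\<lambda>v. (s * q * (1 / q powr (v - 1)) - K * s * \<alpha> * q) + K * \<alpha> * q powr (v - 1) - 1)"
    and G0: "G0 = (\<lambda>v. (1 / q * (1 / q powr (v - 1)) - K * \<alpha> / q) + K * \<alpha> * q powr (v - 1) - 1)"
    by (auto simp: F0_def G0_def)
  show ?g3 unfolding F_def[abs_def] F'_def F0
    by (rule h, rule DERIV_cong[OF DERIV_diff[OF DERIV_add[OF DERIV_diff[OF DERIV_cmult[OF j] DERIV_const]
            DERIV_cmult[OF DERIV_q_shift]] DERIV_const]]) simp
  show ?g4 unfolding G_def[abs_def] G'_def G0
    by (rule h, rule DERIV_cong[OF DERIV_diff[OF DERIV_add[OF DERIV_diff[OF DERIV_cmult[OF j] DERIV_const]
            DERIV_cmult[OF DERIV_q_shift]] DERIV_const]]) simp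
qed

sublocale web: circle_web b c "tau b c q" tau' f f' g g' F F' G G'
proof
  show "0 < b" "0 < c" by (fact pos)+
  show "(tau b c q has_real_derivative tau' t) (at t)" "0 < tau' t" if "0 < t" "t < b + c" for t
    using DERIV_tau tau'_pos that by blast+
  show "continuous_on {0<..<b+c} tau'"
    unfolding tau'_def
  proof (intro continuous_intros cont_q; clarsimp)
    fix t assume "0 < t" "t < b + c"
    from E_factors[OF this] show "q powr t = 1 \<Longrightarrow> False" "q powr (t - b - c) = 1 \<Longrightarrow> False" by auto
  qed (use pos in auto)
  show "(f has_real_derivative f' x) (at x)" "(g has_real_derivative g' x) (at x)"
    "(F has_real_derivative F' x) (at x)" "(G has_real_derivative G' x) (at x)" for x
    by (fact DERIV_fgFG)+
  show "continuous_on UNIV F'" "continuous_on UNIV G'"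
    unfolding F'_def G'_def by (intro continuous_intros cont_q; use pos sigma in simp)+
  show "f x * exp (tau b c q t) + g x * exp (- tau b c q t)
      = F (x - t) * exp (tau b c q t) + G (x - t) * exp (- tau b c q t)" if t: "0 < t" "t < b + c" for t x
  proof -
    define e where "e = exp (tau b c q t)"
    have e: "0 < e" "exp (- tau b c q t) = 1 / e" by (simp_all add: e_def exp_minus divide_inverse)
    define m where "m = 1 / q powr x * (1 - k * q powr (2 * x - t - c))"
    have "(f0 x - F0 (x - t)) * e\<^sup>2 = (e\<^sup>2 * (1 - q powr (t - b - c))) * m"
      unfolding order_identities m_def by (simp only: mult_ac)
    also have "\<dots> = G0 (x - t) - g0 x"
      unfolding e_def exp_tau[OF t] order_identities m_def ..
    finally have "(f0 x + a) * e\<^sup>2 + (g0 x + d) = (F0 (x - t) + a) * e\<^sup>2 + (G0 (x - t) + d)"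
      by (simp add: algebra_simps)
    moreover have "ori * (u + a) / (2 * \<sigma>) * e + ori * (v + d) / (2 * \<sigma>) * (1 / e)
        = ori / (2 * \<sigma> * e) * ((u + a) * e\<^sup>2 + (v + d))" for u v
      using e(1) sigma(1) by (simp add: field_simps power2_eq_square)
    ultimately show ?thesis
      unfolding e(2) e_def[symmetric] f_def g_def F_def G_def by simp
  qed
  show "4 * f x * g x < 1" if "0 < x" "x < 1 + c" for x
  proof -
    have "0 < 1 - 4 * f x * g x"
      unfolding fg_eq using MX_pos[OF that] ad_pos positive(4)[of x] by simp
    then show ?thesis by simp
  qed
  have "MX (q powr 0) = 0" using pos by (simp add: racah.MX_def)
  then have "1 - 4 * f 0 * g 0 = 0" unfolding fg_eq by simp
  then show "4 * f 0 * g 0 = 1" by simp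
  show "4 * F v * G v < 1" if "- b < v" "v < 1" for v
  proof -
    have "0 < 1 - 4 * F v * G v"
      unfolding FG_eq using MU_pos[OF that] ad_pos positive(4)[of "v - 1"] by simp
    then show ?thesis by simp
  qed
  have "MU (q powr (- b - 1)) 1 = 0" by (simp add: racah.MU_def \<alpha>'_def)
  then have "1 - 4 * F (- b) * G (- b) = 0" unfolding FG_eq by simp
  then show "4 * F (- b) * G (- b) = 1" by simp
  show "F (x - t) < f x" if H: "0 < t" "t < b + c" "max 0 (t - b) \<le> x" "x < 1 + min t c" "t \<noteq> b \<or> x \<noteq> 0" for t x
  proof -
    \<comment> \<open>The lower bound would become an equality exactly at the excluded corner
      \<open>t = b\<close>, \<open>x = 0\<close>.\<close>
    have "- (b + c) < 2 * x - t - c" "2 * x - t - c < 2" using H by (auto simp: max_def min_def split: if_splits)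
    then have "0 < L * (1 - q powr (t - b - c)) * (1 / q powr x * (kap * (1 - k * q powr (2 * x - t - c))))"
      by (intro mult_pos_pos[OF E_factors(2)[OF H(1,2)] mult_pos_pos[OF divide_pos_pos[OF zero_less_one positive(4)]]] kfac_pos)
    also have "\<dots> = ori * (f0 x - F0 (x - t))"
      unfolding order_identities ori_def by (simp only: mult_ac)
    finally have "0 < ori * (f0 x - F0 (x - t)) / (2 * \<sigma>)" using sigma(1) by simp
    moreover have "f x - F (x - t) = ori * (f0 x - F0 (x - t)) / (2 * \<sigma>)"
      unfolding f_def F_def diff_divide_distrib[symmetric] right_diff_distrib[symmetric] by simp
    ultimately show ?thesis by linarith
  qed
qed

end

section \<open>The recurrence coefficients at \<open>\<xi> = 1\<close> and the liquid region\<close>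

context tiling begin

abbreviation k' :: "real \<Rightarrow> real" where "k' t \<equiv> racah.k' \<alpha> (\<beta> t) K"

lemma exponents':
  "q powr (- c + \<xi> - 1) = \<alpha> * q powr \<xi>" "q powr (\<xi> - t - 1) = \<beta> t * q powr \<xi>"
  "q powr (- b - c + \<xi> - 2) = s * q powr \<xi>" "ksq \<kappa> * q powr (- b - c + \<xi>) = K * s * q powr \<xi>"
  "q powr (- b - c + 2 * \<xi> - 2) = s * (q powr \<xi>)\<^sup>2" "q powr (- b + \<xi> - 1) = \<alpha>' * q powr \<xi>"
  "ksq \<kappa> * q powr (1 - c) = \<alpha> * K" (is ?g1) "q powr (- t - 1) = \<beta> t" "ksq \<kappa> * q powr (- t - c) = k' t"
  "ksq \<kappa> * q powr (- t - c + x) = k' t * q powr x"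
  "q powr (\<xi> - b - c - 2) = s * q powr \<xi>"
proof -
  show ?g1 unfolding K_def \<alpha>_def k_def[symmetric] mult.left_commute[of _ k]
    by (simp only: powr_add[symmetric]) (simp add: q_inj)
qed (unfold \<alpha>_def \<alpha>'_def \<beta>_def K_def racah.s_def racah.k'_def k_def[symmetric],
    simp_all only: mult.assoc q_collect(4) powr_add[symmetric], simp_all add: q_inj algebra_simps)

lemma den_eq: "1 - q powr (- b - c + 2 * \<xi> - 2) = racah.den \<alpha> \<alpha>' (q powr \<xi>)"
  unfolding exponents'(5) racah.den_def ..

lemma coefA_eq: "coefA b c q \<kappa> \<xi> t
    = racah.numA \<alpha> \<alpha>' (\<beta> t) K (q powr \<xi>) / (racah.den \<alpha> \<alpha>' (q powr \<xi>))\<^sup>2"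
  unfolding coefA_def den_eq unfolding exponents'(1-4) racah.numA_def ..

lemma coefC_eq: "coefC b c q \<kappa> \<xi> t
    = racah.numC \<alpha> \<alpha>' (\<beta> t) K (q powr \<xi>) / (racah.den \<alpha> \<alpha>' (q powr \<xi>))\<^sup>2"
proof -
  have "\<alpha> * K - \<alpha> * q powr \<xi> = \<alpha> * (K - q powr \<xi>)" by (simp add: right_diff_distrib)
  then show ?thesis
    unfolding coefC_def den_eq unfolding exponents'(1-3,6-8) racah.numC_def by (simp only:)
qed

lemma mu_eq: "mu b c q \<kappa> t x = 1 / q powr x + k' t * q powr x"
  unfolding mu_def exponents'(10) by (simp add: powr_minus divide_inverse)

lemma rec_b_eq: "rec_b b c q \<kappa> \<xi> t = 1 + k' t - coefA b c q \<kappa> \<xi> t - coefC b c q \<kappa> \<xi> t"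
  unfolding rec_b_def exponents'(9) ..

definition e :: "real \<Rightarrow> real" where "e t = exp (tau b c q t)"
definition P :: "real \<Rightarrow> real" where "P t = q * \<beta> t - s * q\<^sup>2"

lemma e_pos: "0 < e t" by (simp add: e_def)

lemma P_eq: "P t = q * \<beta> t * (1 - q powr (t - b - c))"
proof -
  have "q * \<beta> t * q powr (t - b - c) = s * q\<^sup>2"
    unfolding exponents powr_add[symmetric] by (rule arg_cong[where f = "\<lambda>u. q powr u"]) simp
  then show ?thesis by (simp add: P_def right_diff_distrib)
qed

text \<open>The origin of \<open>tau\<close>: \<open>exp (2 * \<tau>)\<close> is the quotient of the
  \<open>t\<close>-dependent factors of A(1;t) and C(1;t). So \<open>sqrt (A * C)\<close> is a
  constant times \<open>exp \<tau> * P\<close>, and dividing by it leaves only the powers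
  \<open>exp \<tau>\<close> and \<open>exp (- \<tau>)\<close>.\<close>

lemma e_sq:
  assumes "0 < t" "t < b + c"
  shows "(e t)\<^sup>2 * P t = 1 - q * \<beta> t"
proof -
  have "(e t)\<^sup>2 * P t = q * \<beta> t * ((e t)\<^sup>2 * (1 - q powr (t - b - c)))" by (simp add: P_eq)
  also have "\<dots> = q * \<beta> t * q powr t - q * \<beta> t" unfolding e_def exp_tau[OF assms] by (simp add: right_diff_distrib)
  also have "q * \<beta> t * q powr t = 1" unfolding exponents powr_add[symmetric] using pos by simp
  finally show ?thesis .
qed

lemma P_W_pos:
  assumes "0 < t" "t < b + c"
  shows "0 < P t / W"
proof -
  have "0 < q * \<beta> t * (L * (1 - q powr (t - b - c))) / (L * W)"
    by (intro divide_pos_pos mult_pos_pos pos positive W_sign E_factors assms)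
  also have "\<dots> = (L * P t) / (L * W)" unfolding P_eq by (simp only: mult_ac)
  also have "\<dots> = P t / W" using L_sq by (intro mult_divide_mult_cancel_left) auto
  finally show ?thesis .
qed

lemma coefA_1: "coefA b c q \<kappa> 1 t = a * (1 - q * \<beta> t) / W"
proof -
  have "racah.numA \<alpha> \<alpha>' (\<beta> t) K q = (1 - \<alpha> * q) * (1 - s * q) * (1 - K * s * q) * (1 - q * \<beta> t)"
    by (simp add: racah.numA_def mult_ac)
  also have "\<dots> = a * W * (1 - q * \<beta> t)" using W_nz by (simp add: a_def)
  finally show ?thesis unfolding coefA_eq using pos W_nz by (simp add: power2_eq_square)
qed

lemma coefC_1: "coefC b c q \<kappa> 1 t = d * P t / W"
proof -
  have "racah.numC \<alpha> \<alpha>' (\<beta> t) K q = ((1 - q) * (1 - \<alpha>' * q) * \<alpha> * (K - q)) * (\<beta> t - s * q)"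
    by (simp add: racah.numC_def mult_ac)
  also have "(1 - q) * (1 - \<alpha>' * q) * \<alpha> * (K - q) = d * (q * W)" using W_nz pos by (simp add: d_def)
  also have "d * (q * W) * (\<beta> t - s * q) = d * W * P t" by (simp add: P_def algebra_simps power2_eq_square)
  finally show ?thesis unfolding coefC_eq using pos W_nz by (simp add: power2_eq_square)
qed

lemma rec_a_1:
  assumes "0 < t" "t < b + c"
  shows "rec_a b c q \<kappa> 1 t = \<sigma> * e t * (P t / W)" (is ?g1) "0 < rec_a b c q \<kappa> 1 t"
proof -
  have "coefA b c q \<kappa> 1 t * coefC b c q \<kappa> 1 t = (a * d) * (((e t)\<^sup>2 * P t) * P t) / W\<^sup>2"
    unfolding coefA_1 coefC_1 e_sq[OF assms] by (simp add: power2_eq_square mult_ac)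
  also have "\<dots> = (\<sigma> * e t * (P t / W))\<^sup>2"
    unfolding sigma(2)[symmetric] by (simp add: power2_eq_square mult_ac)
  finally have AC: "coefA b c q \<kappa> 1 t * coefC b c q \<kappa> 1 t = (\<sigma> * e t * (P t / W))\<^sup>2" .
  have p: "0 < \<sigma> * e t * (P t / W)" by (intro mult_pos_pos sigma(1) e_pos P_W_pos[OF assms])
  show ?g1 unfolding rec_a_def AC real_sqrt_abs by (rule abs_of_pos[OF p])
  then show "0 < rec_a b c q \<kappa> 1 t" using p by simp
qed

lemma w_eq:
  assumes t: "0 < t" "t < b + c"
  shows "(mu b c q \<kappa> t x - rec_b b c q \<kappa> 1 t) / (2 * rec_a b c q \<kappa> 1 t) = ori * web.w t x"
proof -
  define m where "m = mu b c q \<kappa> t x - rec_b b c q \<kappa> 1 t"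
  have nz: "q \<noteq> 0" "q powr x \<noteq> 0" "\<beta> t \<noteq> 0" using pos positive(3)[of t] by auto
  have P: "P t \<noteq> 0" using P_W_pos[OF t] by auto
  have "m * W = (1 / q powr x + k' t * q powr x - 1 - k' t) * W + a * (1 - q * \<beta> t) + d * P t"
  proof -
    have "coefA b c q \<kappa> 1 t * W = a * (1 - q * \<beta> t)" "coefC b c q \<kappa> 1 t * W = d * P t"
      unfolding coefA_1 coefC_1 using W_nz by simp_all
    moreover have "m * W = (1 / q powr x + k' t * q powr x - 1 - k' t) * W
        + coefA b c q \<kappa> 1 t * W + coefC b c q \<kappa> 1 t * W"
      unfolding m_def mu_eq rec_b_eq by (simp add: algebra_simps)
    ultimately show ?thesis by (simp only:)
  qed
  also have "(1 / q powr x + k' t * q powr x - 1 - k' t) * W = f0 x * (1 - q * \<beta> t) + g0 x * P t"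
    unfolding f0_def g0_def P_def by (rule racah.circle_w[OF nz, symmetric])
  also have "f0 x * (1 - q * \<beta> t) + g0 x * P t + a * (1 - q * \<beta> t) + d * P t
      = P t * ((f0 x + a) * (e t)\<^sup>2 + (g0 x + d))"
    unfolding e_sq[OF t, symmetric] by (simp add: algebra_simps)
  finally have m: "m = P t * ((f0 x + a) * (e t)\<^sup>2 + (g0 x + d)) / W" using W_nz by (simp add: field_simps)
  have "web.w t x = ori * (((f0 x + a) * (e t)\<^sup>2 + (g0 x + d)) / (2 * \<sigma> * e t))"
    unfolding web.w_def f_def g_def exp_minus e_def[symmetric] using e_pos[of t] sigma(1)
    by (simp add: field_simps power2_eq_square)
  moreover have "m / (2 * rec_a b c q \<kappa> 1 t) = ((f0 x + a) * (e t)\<^sup>2 + (g0 x + d)) / (2 * \<sigma> * e t)"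
    unfolding m rec_a_1(1)[OF t] using P W_nz by simp
  ultimately show ?thesis unfolding m_def[symmetric] by (simp add: ori_sq flip: mult.assoc)
qed

lemma discr_1:
  assumes "0 < t" "t < b + c"
  shows "discr b c q \<kappa> 1 t x = 4 * (rec_a b c q \<kappa> 1 t)\<^sup>2 * (1 - (web.w t x)\<^sup>2)"
proof -
  have "mu b c q \<kappa> t x - rec_b b c q \<kappa> 1 t = 2 * rec_a b c q \<kappa> 1 t * (ori * web.w t x)"
    using w_eq[OF assms, of x] rec_a_1(2)[OF assms] by (simp add: field_simps)
  then have "(mu b c q \<kappa> t x - rec_b b c q \<kappa> 1 t)\<^sup>2 = 4 * (rec_a b c q \<kappa> 1 t)\<^sup>2 * ((ori * ori) * (web.w t x)\<^sup>2)"
    by (simp add: power2_eq_square mult_ac)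
  then show ?thesis unfolding discr_def ori_sq by (simp add: algebra_simps)
qed

text \<open>\<open>liquid\<close> includes no edge points although \<open>hexagon\<close> does: on
  each edge in \<open>x\<close> one invariant vanishes, which makes \<open>w^2 - 1\<close> a
  square.\<close>

lemma liquid_subset:
  assumes "(t, x) \<in> liquid b c q \<kappa>"
  shows "(t, x) \<in> web.liq"
proof -
  have t: "0 < t" "t < b + c" and x: "max 0 (t - b) \<le> x" "x \<le> 1 + min t c"
    and D: "0 < discr b c q \<kappa> 1 t x"
    using assms by (auto simp: liquid_def hexagon_def)
  have w: "(web.w t x)\<^sup>2 < 1"
    using D unfolding discr_1[OF t] using rec_a_1(2)[OF t] by (simp add: zero_less_mult_iff)
  have HX: "web.HX x \<noteq> 0"
    using web.nuX_sq[of t x] w zero_le_power2[of "web.nuX t x"] by auto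
  have HU: "web.HU (x - t) \<noteq> 0"
    using web.nuU_sq[OF t, of x] w zero_le_power2[of "web.nuU t x"] by auto
  have "\<alpha> * q powr (1 + c) = 1" unfolding exponents using pos by simp
  then have "MX (q powr (1 + c)) = 0" by (simp add: racah.MX_def)
  then have "web.HX (1 + c) = 0" unfolding web.HX_def fg_eq by simp
  moreover have "MU (q powr (1 - 1)) 1 = 0" using pos by (simp add: racah.MU_def)
  then have "web.HU 1 = 0" unfolding web.HU_def FG_eq by simp
  ultimately have "x \<noteq> 0" "x - t \<noteq> - b" "x \<noteq> 1 + c" "x - t \<noteq> 1"
    using HX HU web.HX_0 web.HU_b by metis+
  then have "(t, x) \<in> web.hexint"
    using t x unfolding web.hexint_def by (auto simp: max_def min_def split: if_splits)
  then show ?thesis using w by (simp add: web.liq_def)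
qed

section \<open>The solutions \<open>\<xi>\<close> as roots of a quadratic in
  \<open>y\<close>\<close>

abbreviation quad2 :: "real \<Rightarrow> real \<Rightarrow> real" where
  "quad2 t x \<equiv> racah.quad2 \<alpha> (\<beta> t) K (mu b c q \<kappa> t x)"
abbreviation quad1 :: "real \<Rightarrow> real \<Rightarrow> real" where
  "quad1 t x \<equiv> racah.quad1 \<alpha> \<alpha>' (\<beta> t) K (mu b c q \<kappa> t x)"
abbreviation quad0 :: "real \<Rightarrow> real \<Rightarrow> real" where
  "quad0 t x \<equiv> racah.quad0 \<alpha> \<alpha>' (\<beta> t) K (mu b c q \<kappa> t x)"

definition R :: "real \<Rightarrow> real \<Rightarrow> real \<Rightarrow> real" where
  "R t x y = quad2 t x * y\<^sup>2 + quad1 t x * y + quad0 t x"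

lemma yfun_eq: "yfun b c q \<xi> = 1 / q powr \<xi> + s * q powr \<xi>"
  unfolding yfun_def exponents'(11) by (simp add: powr_minus divide_inverse)

lemma R_at:
  assumes "z \<noteq> 0"
  shows "z\<^sup>2 * R t x (1 / z + s * z)
    = (1 + s * z\<^sup>2)\<^sup>2 * quad2 t x + z * (1 + s * z\<^sup>2) * quad1 t x + z\<^sup>2 * quad0 t x"
proof -
  have "z * (1 / z + s * z) = 1 + s * z\<^sup>2" using assms by (simp add: field_simps power2_eq_square)
  then show ?thesis unfolding R_def by algebra
qed

lemma R_numA_zero:
  assumes "z \<noteq> 0" "racah.numA \<alpha> \<alpha>' (\<beta> t) K z = 0"
  shows "z\<^sup>2 * R t x (1 / z + s * z) = ((mu b c q \<kappa> t x - 1 - k' t) * racah.den \<alpha> \<alpha>' z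
    - racah.skew \<alpha> \<alpha>' (\<beta> t) K z)\<^sup>2"
  unfolding R_at[OF assms(1)] by (rule racah.vanishing_numerator(1)[OF assms(2)])

lemma R_numC_zero:
  assumes "z \<noteq> 0" "racah.numC \<alpha> \<alpha>' (\<beta> t) K z = 0"
  shows "z\<^sup>2 * R t x (1 / z + s * z) = ((mu b c q \<kappa> t x - 1 - k' t) * racah.den \<alpha> \<alpha>' z
    + racah.skew \<alpha> \<alpha>' (\<beta> t) K z)\<^sup>2"
  unfolding R_at[OF assms(1)] by (rule racah.vanishing_numerator(2)[OF assms(2)])

lemma R_nonneg:
  assumes "z \<noteq> 0" "racah.numA \<alpha> \<alpha>' (\<beta> t) K z = 0 \<or> racah.numC \<alpha> \<alpha>' (\<beta> t) K z = 0"
  shows "0 \<le> R t x (1 / z + s * z)"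
proof -
  have "0 \<le> z\<^sup>2 * R t x (1 / z + s * z)"
    using assms(2) R_numA_zero[OF assms(1)] R_numC_zero[OF assms(1)] by auto
  then show ?thesis using assms(1) by (simp add: zero_le_mult_iff)
qed

text \<open>Needed because \<open>rec_a\<close> squares back to \<open>A * C\<close> only where this
  product is nonnegative.\<close>

lemma numA_numC_nonneg:
  assumes "0 \<le> \<xi>" "\<xi> \<le> 1 + t" "\<xi> \<le> 1 + b" "\<xi> \<le> 1 + c" "\<xi> \<le> 1 + (b + c - t)"
  shows "0 \<le> racah.numA \<alpha> \<alpha>' (\<beta> t) K (q powr \<xi>) * racah.numC \<alpha> \<alpha>' (\<beta> t) K (q powr \<xi>)"
proof -
  let ?z = "q powr \<xi>"
  have 1: "\<alpha> * ?z = q powr (\<xi> - c - 1)" "\<beta> t * ?z = q powr (\<xi> - t - 1)"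
    "s * ?z = q powr (\<xi> - b - c - 2)" "K * s * ?z = k * q powr (\<xi> - b - c)" "\<alpha>' * ?z = q powr (\<xi> - b - 1)"
    using exponents exponents'(11) exponents'(6)[of \<xi>] by (simp_all add: algebra_simps)
  have 2: "K = ?z * (k * q powr (2 - \<xi>))"
    unfolding K_def by (simp add: powr_add[symmetric] q_inj mult.left_commute[of _ k])
  have 3: "s * ?z = \<beta> t * q powr (\<xi> - 1 - (b + c - t))"
    unfolding 1 \<beta>_def by (simp add: powr_add[symmetric] q_inj)
  have "0 \<le> (L * (1 - q powr (\<xi> - c - 1))) * (L * (1 - q powr (\<xi> - t - 1))) * (L * (1 - q powr (\<xi> - b - c - 2)))
      * (kap * (1 - k * q powr (\<xi> - b - c))) * - (L * (1 - ?z)) * (L * (1 - q powr (\<xi> - b - 1)))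
      * (kap * (1 - k * q powr (2 - \<xi>))) * (L * (1 - q powr (\<xi> - 1 - (b + c - t)))) * (\<alpha> * ?z * \<beta> t)" (is "_ \<le> ?p")
  proof -
    have "0 \<le> - (L * (1 - ?z))" using powr_sign(4)[OF assms(1)] by simp
    then show ?thesis
      by (intro mult_nonneg_nonneg powr_sign(3) kfac_nonneg less_imp_le[OF positive(1)] less_imp_le[OF positive(3)])
        (use assms pos in simp_all)
  qed
  also have "?p = (L * L)\<^sup>2 * (L * L) * (kap * kap) * (racah.numA \<alpha> \<alpha>' (\<beta> t) K ?z * racah.numC \<alpha> \<alpha>' (\<beta> t) K ?z)"
  proof -
    have A: "racah.numA \<alpha> \<alpha>' (\<beta> t) K ?z = (1 - q powr (\<xi> - c - 1)) * (1 - q powr (\<xi> - t - 1))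
        * (1 - q powr (\<xi> - b - c - 2)) * (1 - k * q powr (\<xi> - b - c))"
      unfolding racah.numA_def 1 ..
    have k2: "K - ?z = ?z * - (1 - k * q powr (2 - \<xi>))"
      using 2 by (simp add: algebra_simps)
    have b3: "\<beta> t - s * ?z = \<beta> t * (1 - q powr (\<xi> - 1 - (b + c - t)))"
      unfolding 3 by (simp add: algebra_simps)
    have C: "racah.numC \<alpha> \<alpha>' (\<beta> t) K ?z = (1 - ?z) * (1 - q powr (\<xi> - b - 1))
        * (\<alpha> * (?z * - (1 - k * q powr (2 - \<xi>)))) * (\<beta> t * (1 - q powr (\<xi> - 1 - (b + c - t))))"
      unfolding racah.numC_def k2 b3 unfolding 1 ..
    have gen: "(l * u1) * (l * u2) * (l * u3) * (m * u4) * - (l * u5) * (l * u6) * (m * u7) * (l * u8) * (r * z * v)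
        = (l * l)\<^sup>2 * (l * l) * (m * m) * (u1 * u2 * u3 * u4 * (u5 * u6 * (r * (z * - u7)) * (v * u8)))"
      for l m u1 u2 u3 u4 u5 u6 u7 u8 r z v :: real by (simp add: power2_eq_square)
    show ?thesis unfolding A C by (rule gen)
  qed
  finally show ?thesis by (simp add: L_sq kap_sq)
qed

lemma discr_eq_zero_iff:
  assumes t: "0 < t" "t < b + c"
    and \<xi>: "0 \<le> \<xi>" "\<xi> \<le> 1 + t" "\<xi> \<le> 1 + b" "\<xi> \<le> 1 + c" "\<xi> \<le> 1 + (b + c - t)"
  shows "(1 - q powr (- b - c + 2 * \<xi> - 2))\<^sup>2 * discr b c q \<kappa> \<xi> t x = 0 \<longleftrightarrow> R t x (yfun b c q \<xi>) = 0"
proof -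
  let ?z = "q powr \<xi>"
  have z: "?z \<noteq> 0" using pos by simp
  define D where "D = racah.den \<alpha> \<alpha>' ?z"
  define A where "A = racah.numA \<alpha> \<alpha>' (\<beta> t) K ?z"
  define C where "C = racah.numC \<alpha> \<alpha>' (\<beta> t) K ?z"
  define N where "N = racah.skew \<alpha> \<alpha>' (\<beta> t) K ?z"
  define m where "m = mu b c q \<kappa> t x - 1 - k' t"
  have AC: "A - C = D * N" unfolding A_def C_def D_def N_def by (rule racah.numA_numC)
  have RR: "?z\<^sup>2 * R t x (yfun b c q \<xi>) = N\<^sup>2 + (m * D)\<^sup>2 + 2 * m * (A + C)"
    unfolding yfun_eq R_at[OF z] racah.quad_eq A_def C_def D_def N_def m_def ..
  show ?thesis
  proof (cases "D = 0")
    case False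
    have "0 \<le> A * C" unfolding A_def C_def by (rule numA_numC_nonneg[OF \<xi>])
    then have "0 \<le> A / D\<^sup>2 * (C / D\<^sup>2)" by simp
    then have ra: "(rec_a b c q \<kappa> \<xi> t)\<^sup>2 = A / D\<^sup>2 * (C / D\<^sup>2)"
      unfolding rec_a_def coefA_eq coefC_eq A_def C_def D_def by simp
    have "D\<^sup>2 * discr b c q \<kappa> \<xi> t x = D\<^sup>2 * (4 * (A / D\<^sup>2 * (C / D\<^sup>2)) - (m + A / D\<^sup>2 + C / D\<^sup>2)\<^sup>2)"
      unfolding discr_def ra rec_b_eq coefA_eq coefC_eq A_def[symmetric] C_def[symmetric] D_def[symmetric] m_def
      by (simp add: algebra_simps)
    also have "\<dots> = - (((A - C) / D)\<^sup>2 + (m * D)\<^sup>2 + 2 * m * (A + C))"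
      using False by (simp add: field_simps power2_eq_square)
    also have "\<dots> = - (?z\<^sup>2 * R t x (yfun b c q \<xi>))" unfolding RR AC using False by simp
    finally show ?thesis unfolding den_eq D_def[symmetric] using z by simp
  next
    case True
    have "q powr (- b - c + 2 * \<xi> - 2) = q powr 0"
      using True unfolding D_def den_eq[symmetric] using pos by simp
    then have x0: "- b - c + 2 * \<xi> - 2 = 0" using powr_inj[OF pos(3,4), of "- b - c + 2 * \<xi> - 2" 0] by simp
    have e: "c = b" "t = b" "\<xi> = 1 + b" using x0 \<xi> by linarith+
    have eq: "\<alpha>' = \<alpha>" "\<beta> t = \<alpha>" unfolding \<alpha>_def \<alpha>'_def \<beta>_def unfolding e by simp_all
    have z1: "\<alpha> * ?z = 1" unfolding exponents unfolding e using pos by simp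
    have "A = 0" unfolding A_def racah.numA_def z1 by simp
    then have "C = 0" using AC True by simp
    have "N = (1 - K * \<alpha> * \<alpha>) * (1 + (\<alpha> * ?z)\<^sup>2) - (2 * (\<alpha> * ?z) - 2 * K * \<alpha> * \<alpha> * (\<alpha> * ?z))"
      unfolding N_def racah.skew_def racah.coeffs eq by (simp add: algebra_simps power2_eq_square)
    then have "N = 0" unfolding z1 by simp
    then have "?z\<^sup>2 * R t x (yfun b c q \<xi>) = 0" unfolding RR using \<open>A = 0\<close> \<open>C = 0\<close> True by simp
    then show ?thesis unfolding den_eq D_def[symmetric] using z True by simp
  qed
qed

text \<open>\<open>y\<close> is a multiple of a hyperbolic cosine, symmetric about
  \<open>1 + (b + c) / 2\<close>; the second assumption places the midpoint of the two arguments to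
  the left of this axis.\<close>

lemma yfun_decreasing:
  assumes "\<xi> < \<eta>" "\<xi> + \<eta> < b + c + 2"
  shows "yfun b c q \<eta> < yfun b c q \<xi>"
proof -
  have 1: "0 < L * (q powr (\<eta> - \<xi>) - 1)" "0 < L * (1 - q powr (\<xi> + \<eta> - b - c - 2))"
    using powr_sign(2)[of "\<eta> - \<xi>"] powr_sign(1)[of "\<xi> + \<eta> - b - c - 2"] assms by (simp_all add: algebra_simps)
  define u v where "u = q powr \<xi>" and "v = q powr (\<eta> - \<xi>)"
  have uv: "0 < u" "0 < v" using pos by (simp_all add: u_def v_def)
  have e: "q powr \<eta> = u * v" unfolding u_def v_def powr_add[symmetric] by simp
  have "q powr (\<xi> + \<eta> - b - c - 2) = s * q powr (\<xi> + \<eta>)" by (rule exponents'(11))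
  also have "\<dots> = s * (u * (u * v))" unfolding powr_add e[symmetric] by (simp add: u_def)
  finally have S: "q powr (\<xi> + \<eta> - b - c - 2) = s * (u * (u * v))" .
  have "yfun b c q \<xi> - yfun b c q \<eta> = (L * L) * ((v - 1) * (1 - s * (u * (u * v)))) / (u * v)"
    unfolding yfun_eq e L_sq u_def[symmetric] using uv by (simp add: field_simps)
  also have "\<dots> = (L * (v - 1)) * (L * (1 - s * (u * (u * v)))) / (u * v)" by simp
  also have "0 < \<dots>"
    by (rule divide_pos_pos[OF mult_pos_pos[OF 1[folded v_def, unfolded S]] mult_pos_pos[OF uv]])
  finally show ?thesis by simp
qed
lemma quad_scaled:
  "(q powr x)\<^sup>2 * quad2 t x = (1 - k * q powr (2 * x - t - c))\<^sup>2" (is ?g1)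
  "(q powr x)\<^sup>2 * quad1 t x = racah.quad1X \<alpha> \<alpha>' (\<beta> t) K (q powr x)" (is ?g2)
proof -
  have X: "q powr x \<noteq> 0" using pos by simp
  have "k' t * (q powr x)\<^sup>2 = k * q powr (2 * x - t - c)"
    unfolding racah.k'_def by (rule exponents(13))
  then show ?g1 unfolding mu_eq using racah.quad_mu(1)[OF X, of \<alpha> "\<beta> t" K] by simp
  show ?g2 unfolding mu_eq by (rule racah.quad_mu(2)[OF X])
qed

lemma MU_shift: "MU (\<beta> t) (q powr x) = MU (q powr (x - t - 1)) 1"
proof -
  have "q powr (x - t - 1) = \<beta> t * q powr x" by (rule exponents(8)[symmetric])
  then show ?thesis by (simp add: racah.MU_def racah.k'_def mult_ac)
qed

lemma discriminant_eq:
  "(quad1 t x)\<^sup>2 - 4 * quad2 t x * quad0 t x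
    = (4 * (a * d) * \<beta> t)\<^sup>2 * (web.HX x * web.HU (x - t))"
proof -
  define X where "X = q powr x"
  have X: "X \<noteq> 0" using pos by (simp add: X_def)
  have bt: "\<beta> t \<noteq> 0" using positive(3)[of t] by simp
  have B: "q powr (x - t - 1) = \<beta> t * X" unfolding X_def by (rule exponents(8)[symmetric])
  have h: "web.HX x = MX X / (X\<^sup>2 * (a * d))" "web.HU (x - t) = MU (\<beta> t) X / ((\<beta> t * X)\<^sup>2 * (a * d))"
    unfolding web.HX_def web.HU_def fg_eq FG_eq X_def MU_shift unfolding X_def[symmetric] B by simp_all
  have "X ^ 4 * ((quad1 t x)\<^sup>2 - 4 * quad2 t x * quad0 t x)
      = (X\<^sup>2 * quad1 t x)\<^sup>2 - 4 * (X\<^sup>2 * quad2 t x) * (X\<^sup>2 * quad0 t x)"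
    by (simp add: algebra_simps power2_eq_square power4_eq_xxxx)
  also have "\<dots> = 16 * MX X * MU (\<beta> t) X"
    unfolding mu_eq X_def[symmetric] racah.quad_mu[OF X] by (rule racah.discriminant_identity[OF bt])
  also have "\<dots> = X ^ 4 * ((4 * (a * d) * \<beta> t)\<^sup>2 * (web.HX x * web.HU (x - t)))"
  proof -
    have "16 * M * N = X ^ 4 * ((4 * A * B)\<^sup>2 * (M / (X\<^sup>2 * A) * (N / ((B * X)\<^sup>2 * A))))"
      if "A \<noteq> 0" "B \<noteq> 0" for M N A B :: real
      using that X by (simp add: field_simps power2_eq_square power4_eq_xxxx)
    note gen = this
    show ?thesis unfolding h by (rule gen) (use ad_nz bt in simp_all)
  qed
  finally show ?thesis using X by simp
qed

lemma slope_eq: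
  assumes t: "0 < t" "t < b + c"
  shows "2 * quad2 t x * yfun b c q 1 + quad1 t x
    = - (4 * (a * d) * \<beta> t) * (1 - (web.w t x)\<^sup>2 + web.nuX t x * web.nuU t x)"
proof -
  define X where "X = q powr x"
  have nz: "q \<noteq> 0" "X \<noteq> 0" "\<beta> t \<noteq> 0" using pos positive(3)[of t] by (auto simp: X_def)
  have B: "q powr (x - t - 1) = \<beta> t * X" unfolding X_def by (rule exponents(8)[symmetric])
  have k: "k' t * X\<^sup>2 = k * q powr (2 * x - t - c)"
    unfolding X_def racah.k'_def by (rule exponents(13))
  have y: "yfun b c q 1 = 1 / q + s * q" unfolding yfun_eq using pos by simp
  have fG: "(f0 x + a) * (G0 (x - t) + d) = 4 * (a * d) * (f x * G (x - t))"
    and gF: "(g0 x + d) * (F0 (x - t) + a) = 4 * (a * d) * (g x * F (x - t))"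
    unfolding f_def G_def g_def F_def times_ori using ad_nz by simp_all
  have "X\<^sup>2 * (2 * quad2 t x * yfun b c q 1 + quad1 t x)
     = 2 * (1 - k' t * X\<^sup>2)\<^sup>2 * (1 / q + s * q) + racah.quad1X \<alpha> \<alpha>' (\<beta> t) K X"
    unfolding y k using quad_scaled[of x t] unfolding X_def[symmetric] by algebra
  also have "\<dots> = - X\<^sup>2 * \<beta> t * (4 * (a * d) - 2 * ((f0 x + a) * (G0 (x - t) + d) + (g0 x + d) * (F0 (x - t) + a)))"
    using racah.slope_identity_1[OF nz W_nz, of K]
    unfolding f0_def g0_def F0_def G0_def B X_def[symmetric] a_def d_def by (simp only: mult.assoc)
  also have "\<dots> = X\<^sup>2 * (- (4 * (a * d) * \<beta> t) * (1 - 2 * (f x * G (x - t) + g x * F (x - t))))"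
    unfolding fG gF by (simp add: algebra_simps)
  finally show ?thesis unfolding web.inner_product_identity[OF t]
    by (rule mult_left_cancel[THEN iffD1, rotated]) (use nz(2) in simp)
qed

lemma kfac_product:
  "- (b + c) < e1 \<Longrightarrow> e1 < 2 \<Longrightarrow> - (b + c) < e2 \<Longrightarrow> e2 < 2 \<Longrightarrow>
    0 < (1 - k * q powr e1) * (1 - k * q powr e2)"
proof -
  assume "- (b + c) < e1" "e1 < 2" "- (b + c) < e2" "e2 < 2"
  then have "0 < (kap * (1 - k * q powr e1)) * (kap * (1 - k * q powr e2))"
    by (intro mult_pos_pos[OF kfac_pos kfac_pos])
  also have "\<dots> = (kap * kap) * ((1 - k * q powr e1) * (1 - k * q powr e2))" by (simp only: mult_ac)
  finally show ?thesis by (simp add: kap_sq)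
qed

lemma powr_product:
  "e1 < 0 \<Longrightarrow> e2 < 0 \<Longrightarrow> 0 < (1 - q powr e1) * (1 - q powr e2)"
  "0 < e1 \<Longrightarrow> 0 < e2 \<Longrightarrow> 0 < (1 - q powr e1) * (1 - q powr e2)"
  "0 < e1 \<Longrightarrow> e2 < 0 \<Longrightarrow> (1 - q powr e1) * (1 - q powr e2) < 0"
proof -
  have "(L * (1 - q powr e1)) * (L * (1 - q powr e2)) = (L * L) * ((1 - q powr e1) * (1 - q powr e2))"
    by (simp only: mult_ac)
  then have e: "(1 - q powr e1) * (1 - q powr e2) = (L * (1 - q powr e1)) * (L * (1 - q powr e2))"
    by (simp add: L_sq)
  show "e1 < 0 \<Longrightarrow> e2 < 0 \<Longrightarrow> 0 < (1 - q powr e1) * (1 - q powr e2)"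
    unfolding e by (intro mult_pos_pos powr_sign)
  show "0 < e1 \<Longrightarrow> 0 < e2 \<Longrightarrow> 0 < (1 - q powr e1) * (1 - q powr e2)"
    unfolding e by (intro mult_neg_neg powr_sign)
  show "0 < e1 \<Longrightarrow> e2 < 0 \<Longrightarrow> (1 - q powr e1) * (1 - q powr e2) < 0"
    unfolding e by (intro mult_neg_pos powr_sign)
qed

text \<open>
  The quadratic in \<open>y\<close> is nonnegative at the values of \<open>y\<close> at the ends of the range of \<open>\<xi>\<close>, because \<open>A\<close> or \<open>C\<close>
  vanishes there. These signs of its derivative therefore show that both roots lie in the range.
\<close>

lemma slopes_at_ends:
  assumes "(t, x) \<in> web.hexint"
  shows "0 < 2 * quad2 t x * (1 + s) + quad1 t x" (is ?g1)
    "2 * quad2 t x * (\<alpha> + \<alpha>') + quad1 t x < 0" (is ?g2)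
    "2 * quad2 t x * (\<beta> t + s / \<beta> t) + quad1 t x < 0" (is ?g3)
proof -
  note h = web.hexintD[OF assms]
  have x: "0 < x" "t - b < x" "x < 1 + t" "x < 1 + c" using h(3,4) by simp_all
  define X where "X = q powr x"
  have X: "0 < X" using pos by (simp add: X_def)
  define u where "u = 1 - k' t * X\<^sup>2"
  define v where "v = racah.quad1X \<alpha> \<alpha>' (\<beta> t) K X"
  have k: "k' t * X\<^sup>2 = k * q powr (2 * x - t - c)"
    unfolding X_def racah.k'_def by (rule exponents(13))
  have k1: "k' t * X = k * q powr (x - t - c)"
    unfolding X_def racah.k'_def by (rule exponents(12))
  have sc: "X\<^sup>2 * (2 * quad2 t x * y + quad1 t x) = 2 * u\<^sup>2 * y + v" for y
    using quad_scaled[of x t] unfolding X_def[symmetric] u_def v_def k[symmetric] by algebra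
  note id = racah.slope_identities[of \<alpha> "\<beta> t" K X \<alpha>', folded u_def v_def]
  have e: "\<beta> t * X = q powr (x - t - 1)" "\<alpha> * X = q powr (x - c - 1)" "K * s * X = k * q powr (x - b - c)"
    "\<alpha>' - X * \<beta> t = \<alpha>' * (1 - q powr (x - t + b))" "K * \<alpha> * X = k * q powr (1 - c + x)"
    "K * \<beta> t * X = k * q powr (1 - t + x)"
    unfolding X_def by (fact exponents)+
  have p1: "0 < (1 - q powr (x - t - 1)) * (1 - q powr (x - c - 1))"
    and p2: "0 < (1 - k * q powr (x - t - c)) * (1 - k * q powr (x - b - c))"
    and p3: "0 < (1 - q powr x) * (1 - q powr (x - t + b))"
    and p4: "0 < (1 - k * q powr (1 - c + x)) * (1 - k * q powr (1 - t + x))"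
    and p5: "(1 - q powr x) * (1 - q powr (x - t - 1)) < 0"
    and p6: "0 < (1 - k * q powr (x - b - c)) * (1 - k * q powr (1 - t + x))"
    and p7: "(1 - q powr (x - t + b)) * (1 - q powr (x - c - 1)) < 0"
    and p8: "0 < (1 - k * q powr (x - t - c)) * (1 - k * q powr (1 - c + x))"
    by (rule powr_product kfac_product; use x h(1,2) pos in linarith)+
  have "0 < 2 * (((1 - q powr (x - t - 1)) * (1 - q powr (x - c - 1))) * ((1 - k * q powr (x - t - c)) * (1 - k * q powr (x - b - c)))
      + \<alpha> * \<alpha>' * (((1 - q powr x) * (1 - q powr (x - t + b))) * ((1 - k * q powr (1 - c + x)) * (1 - k * q powr (1 - t + x)))))"
    by (rule mult_pos_pos[OF zero_less_numeral add_pos_pos[OF mult_pos_pos[OF p1 p2]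
          mult_pos_pos[OF mult_pos_pos[OF positive(1,2)] mult_pos_pos[OF p3 p4]]]])
  also have "\<dots> = 2 * u\<^sup>2 * (1 + s) + v"
    unfolding id e k1 unfolding X_def by (simp only: mult_ac)
  finally have "0 < X\<^sup>2 * (2 * quad2 t x * (1 + s) + quad1 t x)" unfolding sc .
  then show ?g1 using X by (simp add: zero_less_mult_iff)
  have "0 > 2 * (\<alpha> * (((1 - q powr x) * (1 - q powr (x - t - 1))) * ((1 - k * q powr (x - b - c)) * (1 - k * q powr (1 - t + x))))
      + \<alpha>' * (((1 - q powr (x - t + b)) * (1 - q powr (x - c - 1))) * ((1 - k * q powr (x - t - c)) * (1 - k * q powr (1 - c + x)))))"
    by (rule mult_pos_neg[OF zero_less_numeral add_neg_neg[OF mult_pos_neg[OF positive(1) mult_neg_pos[OF p5 p6]]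
          mult_pos_neg[OF positive(2) mult_neg_pos[OF p7 p8]]]])
  also have "2 * (\<alpha> * (((1 - q powr x) * (1 - q powr (x - t - 1))) * ((1 - k * q powr (x - b - c)) * (1 - k * q powr (1 - t + x))))
      + \<alpha>' * (((1 - q powr (x - t + b)) * (1 - q powr (x - c - 1))) * ((1 - k * q powr (x - t - c)) * (1 - k * q powr (1 - c + x)))))
      = 2 * u\<^sup>2 * (\<alpha> + \<alpha>') + v"
    unfolding id e k1 unfolding X_def by (simp only: mult_ac)
  finally have "X\<^sup>2 * (2 * quad2 t x * (\<alpha> + \<alpha>') + quad1 t x) < 0" unfolding sc .
  then show ?g2 using X by (simp add: mult_less_0_iff)
  have bt: "0 < \<beta> t" by (rule positive)
  have "0 < MX X" unfolding X_def by (rule MX_pos[OF x(1,4)])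
  moreover have "0 < MU (\<beta> t) X"
    unfolding X_def MU_shift using MU_pos[of "x - t"] x by simp
  ultimately have "0 < (\<beta> t)\<^sup>2 * MX X + MU (\<beta> t) X" using bt by (simp add: add_pos_pos)
  then have "2 * u\<^sup>2 * ((\<beta> t)\<^sup>2 + s) + \<beta> t * v < 0" unfolding id by simp
  moreover have "2 * u\<^sup>2 * ((\<beta> t)\<^sup>2 + s) + \<beta> t * v = \<beta> t * (X\<^sup>2 * (2 * quad2 t x * (\<beta> t + s / \<beta> t) + quad1 t x))"
    unfolding sc using bt by (simp add: field_simps power2_eq_square)
  ultimately show ?g3 using bt X by (simp add: mult_less_0_iff)
qed

lemma quad2_pos:
  assumes "(t, x) \<in> web.hexint"
  shows "0 < quad2 t x"
proof -
  note h = web.hexintD[OF assms]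
  have "- (b + c) < 2 * x - t - c" "2 * x - t - c < 2" using h(1-4) pos by linarith+
  then have "1 - k * q powr (2 * x - t - c) \<noteq> 0" using kfac_pos by force
  then have "0 < (q powr x)\<^sup>2 * quad2 t x" unfolding quad_scaled by simp
  then show ?thesis by (simp add: zero_less_mult_iff)
qed

lemma rho_eq:
  assumes "(t, x) \<in> web.hexint"
  shows "rho b c q \<kappa> t x = web.dens t x"
proof -
  note h = web.hexintD[OF assms]
  define m where "m = Min {t, b, c, b + c - t}"
  have m: "0 < m" "m \<le> t" "m \<le> b" "m \<le> c" "m \<le> b + c - t" "m = t \<or> m = b \<or> m = c \<or> m = b + c - t"
    using h(1,2) pos unfolding m_def by (auto simp: min_def)
  define y where "y = yfun b c q"
  have S: "xi_solutions b c q \<kappa> t x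
      = {\<xi>. 0 \<le> \<xi> \<and> \<xi> \<le> 1 + m \<and> quad2 t x * (y \<xi>)\<^sup>2 + quad1 t x * y \<xi> + quad0 t x = 0}"
    unfolding xi_solutions_def m_def[symmetric] y_def R_def[symmetric]
    using discr_eq_zero_iff[OF h(1,2), of _ x] m by (intro Collect_cong conj_cong refl) simp_all
  \<comment> \<open>Kept in the shape \<open>1 / z + s * z\<close> at \<open>z = 1\<close>, where
    \<open>numC\<close> vanishes.\<close>
  have y0: "y 0 = 1 / 1 + s * 1" unfolding y_def yfun_eq using pos by simp
  have R0: "0 \<le> R t x (1 / 1 + s * 1)"
    by (rule R_nonneg) (simp_all add: racah.numC_def)
  have a0: "\<alpha> \<noteq> 0" "\<beta> t \<noteq> 0" using positive(1) positive(3)[of t] by simp_all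
  \<comment> \<open>The involution pairs \<open>b\<close> with \<open>c\<close> and \<open>t\<close>
    with \<open>b + c - t\<close>, with equal values of \<open>y\<close>. So only
    \<open>z = 1 / \<alpha>\<close> and \<open>z = 1 / \<beta>\<close> remain, and
    \<open>numA\<close> vanishes at both.\<close>
  have "y (1 + m) = 1 / (1 / \<alpha>) + s * (1 / \<alpha>) \<or> y (1 + m) = 1 / (1 / \<beta> t) + s * (1 / \<beta> t)"
  proof -
    have "s * (1 / \<alpha>) = \<alpha>'" using a0 by (simp add: racah.s_def)
    moreover have "yfun b c q (1 + c) = \<alpha> + \<alpha>'" "yfun b c q (1 + b) = \<alpha>' + \<alpha>"
      unfolding yfun_def \<alpha>_def \<alpha>'_def by (intro arg_cong2[where f = "(+)"] arg_cong[where f = "\<lambda>u. q powr u"]; simp)+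
    moreover have "s * (1 / \<beta> t) = q powr (t - b - c - 1)"
    proof -
      have "q powr (t - b - c - 1) * \<beta> t = s"
        unfolding \<alpha>_def \<alpha>'_def \<beta>_def racah.s_def powr_add[symmetric] by (simp add: powr_inj pos algebra_simps)
      then show ?thesis using a0 by (simp add: field_simps)
    qed
    moreover have "yfun b c q (1 + t) = \<beta> t + q powr (t - b - c - 1)"
      "yfun b c q (1 + (b + c - t)) = q powr (t - b - c - 1) + \<beta> t"
      unfolding yfun_def \<beta>_def by (intro arg_cong2[where f = "(+)"] arg_cong[where f = "\<lambda>u. q powr u"]; simp)+
    ultimately show ?thesis using m(6) unfolding y_def by (elim disjE) simp_all
  qed
  then have yM: "0 \<le> R t x (y (1 + m)) \<and> 2 * quad2 t x * y (1 + m) + quad1 t x < 0"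
  proof
    assume y: "y (1 + m) = 1 / (1 / \<alpha>) + s * (1 / \<alpha>)"
    have "s * (1 / \<alpha>) = \<alpha>'" using a0 by (simp add: racah.s_def)
    then have "y (1 + m) = \<alpha> + \<alpha>'" unfolding y by simp
    moreover have "0 \<le> R t x (y (1 + m))" unfolding y
      by (rule R_nonneg) (use a0 in \<open>simp_all add: racah.numA_def\<close>)
    ultimately show ?thesis using slopes_at_ends(2)[OF assms] by simp
  next
    assume y: "y (1 + m) = 1 / (1 / \<beta> t) + s * (1 / \<beta> t)"
    then have "y (1 + m) = \<beta> t + s / \<beta> t" by simp
    moreover have "0 \<le> R t x (y (1 + m))" unfolding y
      by (rule R_nonneg) (use a0 in \<open>simp_all add: racah.numA_def\<close>)
    ultimately show ?thesis using slopes_at_ends(3)[OF assms] by simp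
  qed
  have c4: "0 < 4 * (a * d) * \<beta> t" using ad_pos positive(3)[of t] by simp
  have "rho b c q \<kappa> t x = arccos (clip ((2 * quad2 t x * y 1 + quad1 t x)
      / sqrt ((quad1 t x)\<^sup>2 - 4 * quad2 t x * quad0 t x))) / pi"
    unfolding rho_def xi_minus_def xi_plus_def Let_def y_def[symmetric] S
  proof (rule arccos_between_roots)
    show "continuous_on {0..1 + m} y"
      unfolding y_def yfun_def by (intro continuous_intros cont_q)
    show "y \<eta> < y \<xi>" if "0 \<le> \<xi>" "\<xi> < \<eta>" "\<eta> \<le> 1 + m" for \<xi> \<eta>
      unfolding y_def by (rule yfun_decreasing) (use that m in linarith)+
    show "0 < quad2 t x" by (rule quad2_pos[OF assms])
    show "0 < (quad1 t x)\<^sup>2 - 4 * quad2 t x * quad0 t x"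
      unfolding discriminant_eq by (intro mult_pos_pos zero_less_power c4 h)
    show "0 \<le> quad2 t x * (y 0)\<^sup>2 + quad1 t x * y 0 + quad0 t x"
      using R0 unfolding R_def y0 .
    show "0 < 2 * quad2 t x * y 0 + quad1 t x" unfolding y0 using slopes_at_ends(1)[OF assms] by simp
    show "0 \<le> quad2 t x * (y (1 + m))\<^sup>2 + quad1 t x * y (1 + m) + quad0 t x"
      using yM unfolding R_def by blast
    show "2 * quad2 t x * y (1 + m) + quad1 t x < 0" using yM by blast
  qed (use m in simp)
  also have "(2 * quad2 t x * y 1 + quad1 t x) / sqrt ((quad1 t x)\<^sup>2 - 4 * quad2 t x * quad0 t x)
     = - (1 - (web.w t x)\<^sup>2 + web.nuX t x * web.nuU t x) / (sqrt (web.HX x) * sqrt (web.HU (x - t)))"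
  proof -
    have "- C * v / sqrt (C\<^sup>2 * (H * H')) = - v / (sqrt H * sqrt H')" if "0 < C" for C v H H' :: real
      using that by (simp add: real_sqrt_mult)
    then show ?thesis unfolding y_def slope_eq[OF h(1,2)] discriminant_eq using c4 by blast
  qed
  finally show ?thesis unfolding web.dens_eq_arccos[OF assms] .
qed

section \<open>The height function and the Beltrami equation\<close>

lemma height_eq:
  assumes "(t, x) \<in> web.hexint"
  shows "height b c q \<kappa> t x = web.Ht t x"
  unfolding height_def web.Ht_def
proof (rule integral_spike[of "{max 0 (t - b)}"])
  fix u assume "u \<in> {max 0 (t - b)..x} - {max 0 (t - b)}"
  then have "max 0 (t - b) \<le> u" "u \<noteq> max 0 (t - b)" "u \<le> x" by simp_all
  then have "max 0 (t - b) < u" "u \<le> x" by linarith+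
  then have "(t, u) \<in> web.hexint" using assms unfolding web.hexint_def by simp
  then show "web.dens t u = rho b c q \<kappa> t u" by (simp add: rho_eq)
qed simp

lemma DERIV_height:
  assumes "(t, x) \<in> web.liq"
  shows "((\<lambda>s. height b c q \<kappa> s x) has_real_derivative web.flux t x) (at t)" (is ?g1)
    "((\<lambda>u. height b c q \<kappa> t u) has_real_derivative web.dens t x) (at x)" (is ?g2)
proof -
  have h: "(t, x) \<in> web.hexint" by (rule web.liqD(1)[OF assms])
  show ?g1 by (rule has_field_derivative_transform_within_open[OF web.DERIV_Ht_t[OF assms]
          web.open_slices(1)[OF web.open_hexint, of x]]) (use h height_eq in auto)
  show ?g2 by (rule has_field_derivative_transform_within_open[OF web.DERIV_Ht_x[OF h]
          web.open_slices(2)[OF web.open_hexint, of t]]) (use h height_eq in auto)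
qed

lemma angles:
  assumes "(t, x) \<in> web.liq"
  shows "rho_I b c q \<kappa> t x = pi / 2 - web.phU t x" (is ?g1)
    "rho_III b c q \<kappa> t x = web.phU t x - web.phX t x" (is ?g2)
    "rho_II b c q \<kappa> t x = web.phX t x + pi / 2" (is ?g3)
proof -
  have "height_t b c q \<kappa> t x = web.flux t x" "height_x b c q \<kappa> t x = web.dens t x"
    unfolding height_t_def height_x_def using DERIV_height[OF assms] by (simp_all add: DERIV_imp_deriv)
  then show ?g1 ?g2 ?g3 unfolding rho_I_def rho_II_def rho_III_def web.flux_def web.dens_def by (simp_all add: field_simps)
qed

definition W0 :: "real \<Rightarrow> real \<Rightarrow> complex" where
  "W0 t x = (let p = web.phX t x; u = web.phU t x; r = sin (u - p) / cos p in Complex (r * sin u) (r * cos u))"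

lemma angle_bounds:
  assumes "(t, x) \<in> web.liq"
  shows "- (pi / 2) < web.phX t x" "web.phX t x < web.phU t x" "web.phU t x < pi / 2"
proof -
  note l = web.liqD[OF assms]
  note h = web.hexintD[OF l(1)]
  show "web.phX t x < web.phU t x" by (rule web.phX_less_phU[OF l])
  show "- (pi / 2) < web.phX t x" "web.phU t x < pi / 2"
    using web.phX_liquid(5)[OF h(5) l(2)] web.phU_liquid(5)[OF h(1,2,6) l(2)] by linarith+
qed

lemma complex_slope:
  assumes "(t, x) \<in> web.liq"
  shows "\<exists>!w. is_complex_slope b c q \<kappa> t x w" "Omega b c q \<kappa> t x = W0 t x" (is ?g1)
proof -
  note T = triangle_of_angles[OF angle_bounds[OF assms]]
  have 1: "is_complex_slope b c q \<kappa> t x (W0 t x)"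
    unfolding is_complex_slope_def angles[OF assms] W0_def Let_def using T(1) by simp
  have 2: "w = W0 t x" if "is_complex_slope b c q \<kappa> t x w" for w
    using that T(2)[of w] unfolding is_complex_slope_def angles[OF assms] W0_def Let_def by simp
  show ex: "\<exists>!w. is_complex_slope b c q \<kappa> t x w" using 1 2 by blast
  show ?g1 unfolding Omega_def by (rule the1_equality[OF ex 1])
qed

lemma Fmap_eq:
  assumes "0 < t" "t < b + c"
  shows "Fmap b c q \<kappa> t x = complex_of_real (tau b c q t) + \<i> * complex_of_real (arccos (ori * web.w t x))"
  unfolding Fmap_def w_eq[OF assms] ..

lemma ori_w_bounds:
  assumes "(t, x) \<in> web.liq"
  shows "- 1 < ori * web.w t x" "ori * web.w t x < 1" "(ori * web.w t x)\<^sup>2 = (web.w t x)\<^sup>2"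
proof -
  show e: "(ori * web.w t x)\<^sup>2 = (web.w t x)\<^sup>2"
    using ori_sq by (simp add: power_mult_distrib power2_eq_square)
  have "(ori * web.w t x)\<^sup>2 < 1" unfolding e by (rule web.liqD(2)[OF assms])
  then show "- 1 < ori * web.w t x" "ori * web.w t x < 1" by (simp_all add: abs_square_less_1)
qed

lemma Fmap_differentiable:
  assumes "(t, x) \<in> web.liq"
  shows "(\<lambda>p. Fmap b c q \<kappa> (fst p) (snd p)) differentiable (at (t, x))"
proof -
  note h = web.hexintD[OF web.liqD(1)[OF assms]]
  have T: "((\<lambda>p. tau b c q (fst p)) has_derivative (\<lambda>v. tau' t * fst v)) (at (t, x))"
    by (rule has_derivative_compose[OF has_derivative_fst[OF has_derivative_ident],
          of "tau b c q" "(*) (tau' t)" "(t, x)" UNIV, simplified])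
      (use DERIV_tau[OF h(1,2)] in \<open>simp add: has_field_derivative_def\<close>)
  have f: "((\<lambda>p. f (snd p)) has_derivative (\<lambda>v. f' x * snd v)) (at (t, x))"
    by (rule has_derivative_compose[OF has_derivative_snd[OF has_derivative_ident],
          of f "(*) (f' x)" "(t, x)" UNIV, simplified])
      (use DERIV_fgFG(1)[of x] in \<open>simp add: has_field_derivative_def\<close>)
  have g: "((\<lambda>p. g (snd p)) has_derivative (\<lambda>v. g' x * snd v)) (at (t, x))"
    by (rule has_derivative_compose[OF has_derivative_snd[OF has_derivative_ident],
          of g "(*) (g' x)" "(t, x)" UNIV, simplified])
      (use DERIV_fgFG(2)[of x] in \<open>simp add: has_field_derivative_def\<close>)
  note e = differentiableI[OF has_derivative_exp[OF T]] differentiableI[OF has_derivative_exp[OF has_derivative_minus[OF T]]]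
  have w: "(\<lambda>p. ori * web.w (fst p) (snd p)) differentiable (at (t, x))"
    unfolding web.w_def
    by (intro differentiable_mult differentiable_add differentiable_const e differentiableI[OF f] differentiableI[OF g])
  then obtain D where D: "((\<lambda>p. ori * web.w (fst p) (snd p)) has_derivative D) (at (t, x))"
    unfolding differentiable_def by blast
  have "(arccos has_real_derivative inverse (- sqrt (1 - (ori * web.w t x)\<^sup>2))) (at (ori * web.w t x))"
    by (rule DERIV_arccos[OF ori_w_bounds(1,2)[OF assms]])
  then have "((\<lambda>p. arccos (ori * web.w (fst p) (snd p))) has_derivative
      (\<lambda>v. inverse (- sqrt (1 - (ori * web.w t x)\<^sup>2)) * D v)) (at (t, x))"
    using has_derivative_compose[OF D, of arccos "(*) (inverse (- sqrt (1 - (ori * web.w t x)\<^sup>2)))"]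
    by (simp add: has_field_derivative_def)
  then have "((\<lambda>p. complex_of_real (tau b c q (fst p)) + \<i> * complex_of_real (arccos (ori * web.w (fst p) (snd p))))
      has_derivative (\<lambda>v. complex_of_real (tau' t * fst v)
        + \<i> * complex_of_real (inverse (- sqrt (1 - (ori * web.w t x)\<^sup>2)) * D v))) (at (t, x))"
    by (intro has_derivative_add has_derivative_mult_right has_derivative_of_real T)
  then have "((\<lambda>p. Fmap b c q \<kappa> (fst p) (snd p)) has_derivative (\<lambda>v. complex_of_real (tau' t * fst v)
        + \<i> * complex_of_real (inverse (- sqrt (1 - (ori * web.w t x)\<^sup>2)) * D v))) (at (t, x))"
    by (rule has_derivative_transform_within_open[where s = "{0<..<b+c} \<times> UNIV"])
      (use h Fmap_eq in \<open>auto intro: open_Times\<close>)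
  then show ?thesis by (rule differentiableI)
qed

text \<open>The minus sign in the derivative of arccos reverses those of the derivatives of
  \<open>w\<close>, and division by \<open>sqrt (1 - w^2)\<close> turns the slopes into tangents of
  the directions.\<close>

lemma Fmap_partials:
  assumes "(t, x) \<in> web.liq"
  defines "T \<equiv> tau' t" and "p \<equiv> web.phX t x" and "u \<equiv> web.phU t x"
  shows "vector_derivative (\<lambda>s. Fmap b c q \<kappa> s x) (at t)
      = complex_of_real T * (1 + \<i> * complex_of_real (ori * tan p))" (is ?g1)
    "vector_derivative (\<lambda>v. Fmap b c q \<kappa> t v) (at x)
      = \<i> * complex_of_real (ori * (T * (tan u - tan p)))" (is ?g2)
proof -
  note l = web.liqD[OF assms(1)]
  note h = web.hexintD[OF l(1)]
  note o = ori_w_bounds[OF assms(1)]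
  have X: "tan p = web.nuX t x / sqrt (1 - (web.w t x)\<^sup>2)" "tan u = web.nuU t x / sqrt (1 - (web.w t x)\<^sup>2)"
    unfolding p_def u_def using web.phX_liquid(4)[OF h(5) l(2)] web.phU_liquid(4)[OF h(1,2,6) l(2)] by simp_all
  have chain: "((\<lambda>s. arccos (ori * v s)) has_real_derivative - (ori * v') / sqrt (1 - (web.w t x)\<^sup>2)) (at r)"
    if "(v has_real_derivative v') (at r)" "v r = web.w t x" for v v' r
  proof -
    have "((\<lambda>s. arccos (ori * v s)) has_real_derivative
        inverse (- sqrt (1 - (ori * web.w t x)\<^sup>2)) * (ori * v')) (at r)"
    proof (rule DERIV_chain2[of arccos _ "\<lambda>s. ori * v s"])
      show "(arccos has_real_derivative inverse (- sqrt (1 - (ori * web.w t x)\<^sup>2))) (at (ori * v r))"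
        unfolding that(2) by (rule DERIV_arccos[OF o(1,2)])
      show "((\<lambda>s. ori * v s) has_real_derivative ori * v') (at r)" by (rule DERIV_cmult[OF that(1)])
    qed
    then show ?thesis unfolding o(3) by (simp add: divide_inverse mult.commute)
  qed
  have At: "((\<lambda>s. arccos (ori * web.w s x)) has_real_derivative ori * (T * tan p)) (at t)"
    by (rule DERIV_cong[OF chain[OF web.DERIV_w_t[OF h(1,2)]]]) (simp_all add: X T_def)
  have Ax: "((\<lambda>v. arccos (ori * web.w t v)) has_real_derivative ori * (T * (tan u - tan p))) (at x)"
    by (rule DERIV_cong[OF chain[OF web.DERIV_w_x[OF h(1,2)]]])
      (simp_all add: X T_def diff_divide_distrib algebra_simps)
  have re: "((\<lambda>s. complex_of_real (v s)) has_vector_derivative complex_of_real v') (at r)"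
    if "(v has_real_derivative v') (at r)" for v v' r
    by (rule bounded_linear.has_vector_derivative[OF bounded_linear_of_real])
      (use that in \<open>simp add: has_real_derivative_iff_has_vector_derivative\<close>)
  have "((\<lambda>s. complex_of_real (tau b c q s) + \<i> * complex_of_real (arccos (ori * web.w s x)))
      has_vector_derivative complex_of_real T + \<i> * complex_of_real (ori * (T * tan p))) (at t)"
    unfolding T_def
    by (intro has_vector_derivative_add has_vector_derivative_mult_right re DERIV_tau h At[unfolded T_def])
  then have "((\<lambda>s. Fmap b c q \<kappa> s x)
      has_vector_derivative complex_of_real T + \<i> * complex_of_real (ori * (T * tan p))) (at t)"
    by (rule has_vector_derivative_transform_within_open[where S = "{0<..<b+c}"])
      (use h Fmap_eq in auto)
  then show ?g1 by (simp add: vector_derivative_at algebra_simps)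
  have "((\<lambda>v. complex_of_real (tau b c q t) + \<i> * complex_of_real (arccos (ori * web.w t v)))
      has_vector_derivative 0 + \<i> * complex_of_real (ori * (T * (tan u - tan p)))) (at x)"
    by (intro has_vector_derivative_add has_vector_derivative_mult_right re Ax has_vector_derivative_const)
  then show ?g2 unfolding Fmap_eq[OF h(1,2)] by (simp add: vector_derivative_at)
qed

lemma beltrami:
  assumes "(t, x) \<in> web.liq"
  defines "w \<equiv> if ori = 1 then W0 t x else cnj (W0 t x)"
  shows "d_zbar (Fmap b c q \<kappa>) t x / d_z (Fmap b c q \<kappa>) t x = - ((1 + (\<i> - 1) * w) / (- 1 + (1 + \<i>) * w))" (is ?g1)
    "d_z (Fmap b c q \<kappa>) t x = 0 \<longleftrightarrow> - 1 + (1 + \<i>) * w = 0"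
proof -
  note h = web.hexintD[OF web.liqD(1)[OF assms(1)]]
  define T p u where "T = tau' t" and "p = web.phX t x" and "u = web.phU t x"
  define At Ax where "At = complex_of_real T * (1 + \<i> * complex_of_real (tan p))"
    and "Ax = \<i> * complex_of_real (T * (tan u - tan p))"
  define Ft Fx where "Ft = vector_derivative (\<lambda>s. Fmap b c q \<kappa> s x) (at t)"
    and "Fx = vector_derivative (\<lambda>v. Fmap b c q \<kappa> t v) (at x)"
  have T: "0 < T" unfolding T_def by (rule tau'_pos[OF h(1,2)])
  note A = slope_of_tangents[OF T angle_bounds[OF assms(1), folded p_def u_def], folded At_def Ax_def]
  have W0: "W0 t x = Ax / (Ax + At)"
    unfolding A(2) W0_def Let_def p_def u_def ..
  have F: "Ft = complex_of_real T * (1 + \<i> * complex_of_real (ori * tan p))"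
    "Fx = \<i> * complex_of_real (ori * (T * (tan u - tan p)))"
    unfolding Ft_def Fx_def T_def p_def u_def by (rule Fmap_partials[OF assms(1)])+
  have "ori = 1 \<or> ori = -1" using ori_sq by (simp add: square_eq_1_iff)
  then have "Fx + Ft \<noteq> 0 \<and> w = Fx / (Fx + Ft)"
  proof
    assume "ori = 1"
    then show ?thesis using A(1) W0 unfolding F w_def At_def Ax_def by simp
  next
    assume o: "ori = -1"
    \<comment> \<open>Passing from \<open>w\<close> to \<open>- w\<close> replaces arccos by \<pi>
      minus it; this conjugates both partial derivatives and hence their quotient.\<close>
    have "Ft = cnj At" "Fx = cnj Ax" unfolding F At_def Ax_def o by simp_all
    then have e: "Fx + Ft = cnj (Ax + At)" "Fx = cnj Ax" by simp_all
    have "Fx + Ft \<noteq> 0" unfolding e(1) using A(1) by (simp only: complex_cnj_zero_iff not_False_eq_True)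
    moreover have "w = Fx / (Fx + Ft)" unfolding e(1) unfolding e(2) w_def W0 o by simp
    ultimately show ?thesis by blast
  qed
  then have w: "Fx + Ft \<noteq> 0" "w = Fx / (Fx + Ft)" by blast+
  have z: "d_zbar (Fmap b c q \<kappa>) t x = (Ft + \<i> * Fx) / 2" "d_z (Fmap b c q \<kappa>) t x = (Ft - \<i> * Fx) / 2"
    unfolding d_zbar_def d_z_def Ft_def Fx_def by simp_all
  show ?g1
    "d_z (Fmap b c q \<kappa>) t x = 0 \<longleftrightarrow> - 1 + (1 + \<i>) * w = 0"
    unfolding z by (rule beltrami_of_slope[OF w])+
qed

end

theorem theorem6p5:
  fixes b c q t x :: real and \<kappa> :: complex
  assumes "admissible b c q \<kappa>" and "(t, x) \<in> liquid b c q \<kappa>"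
  shows
    "(\<lambda>p. Fmap b c q \<kappa> (fst p) (snd p)) differentiable (at (t, x)) \<and>
     (\<lambda>s. height b c q \<kappa> s x) differentiable (at t) \<and>
     (\<lambda>u. height b c q \<kappa> t u) differentiable (at x) \<and>
     (\<exists>!w. is_complex_slope b c q \<kappa> t x w) \<and>
     (let F_z = d_z (Fmap b c q \<kappa>) t x;
          F_zbar = d_zbar (Fmap b c q \<kappa>) t x;
          \<Omega> = Omega b c q \<kappa> t x;
          beltrami = (\<lambda>w. F_zbar / F_z = - ((1 + (\<i> - 1) * w) / (- 1 + (1 + \<i>) * w)) \<and>
                          (F_z = 0 \<longleftrightarrow> - 1 + (1 + \<i>) * w = 0))
      in (\<not> upper_branch b c q \<kappa> \<longrightarrow>
            (1 < q \<longrightarrow> beltrami \<Omega>) \<and> (q < 1 \<longrightarrow> beltrami (cnj \<Omega>))) \<and>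
         (upper_branch b c q \<kappa> \<longrightarrow>
            (1 < q \<longrightarrow> beltrami (cnj \<Omega>)) \<and> (q < 1 \<longrightarrow> beltrami \<Omega>)))"
proof -
  interpret tiling b c q \<kappa> by unfold_locales (rule assms(1))
  have l: "(t, x) \<in> web.liq" by (rule liquid_subset[OF assms(2)])
  have "(\<lambda>s. height b c q \<kappa> s x) differentiable (at t)" "(\<lambda>u. height b c q \<kappa> t u) differentiable (at x)"
    using DERIV_height[OF l] unfolding has_field_derivative_def by (auto intro: differentiableI)
  moreover have o: "\<not> upper_branch b c q \<kappa> \<Longrightarrow> 1 < q \<Longrightarrow> ori = 1" "\<not> upper_branch b c q \<kappa> \<Longrightarrow> q < 1 \<Longrightarrow> ori = -1"
    "upper_branch b c q \<kappa> \<Longrightarrow> 1 < q \<Longrightarrow> ori = -1" "upper_branch b c q \<kappa> \<Longrightarrow> q < 1 \<Longrightarrow> ori = 1"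
    by (simp_all add: ori_def kap_def L_cases)
  ultimately show ?thesis
    unfolding Let_def complex_slope(2)[OF l]
    using Fmap_differentiable[OF l] complex_slope(1)[OF l] beltrami[OF l] by simp
qed

end
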